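(* Let $Q:\mathbf{T}\to\mathbb{R}$ be a $C^{1}$ potential and let $\rho>0$. If $Q$ satisfies the free Log-Sobolev inequality $LSI(\rho)$, i.e. $$E_Q(\mu)-E_Q(\mu_Q)\le\frac{1}{4\rho}I_Q(\mu)\quad\text{for every smooth probability measure }\mu\text{ on }\mathbf{T},$$ then $Q$ satisfies the free transportation inequality $T(\rho)$, i.e. $$\rho\,\mathcal{W}_2^{2}(\mu,\mu_Q)\le E_Q(\mu)-E_Q(\mu_Q)\quad\text{for every smooth probability measure }\mu\text{ on }\mathbf{T}.$$
   Context: $\mathbf{T}$ is the unit circle in $\mathbb{C}$ and $\alpha$ is the normalized (probability) Haar measure on $\mathbf{T}$. A measure on $\mathbf{T}$ is called smooth if it has a smooth density with respect to $\alpha$. For a differentiable function $\phi$ on $\mathbf{T}$, $\phi'(z)=\frac{d}{dt}\big|_{t=0}\phi(ze^{it})$. For a continuous $Q:\mathbf{T}\to\mathbb{R}$ (a potential) and a probability measure $\mu$ on $\mathbf{T}$, $E_Q(\mu)=\int Q\,d\mu-\iint\log|x-y|\,\mu(dx)\mu(dy)$; $\mu_Q$ denotes the (unique) minimizer of $E_Q$ over probability measures on $\mathbf{T}$. For a smooth probability measure $\mu$ on $\mathbf{T}$, with density $m$ with respect to $\alpha$, define $H\mu:\mathbf{T}\to\mathbb{R}$ by the principal value integral $H\mu(e^{ix})=\mathrm{p.v.}\int\cot\big(\frac{x-y}{2}\big)\,m(e^{iy})\,\frac{dy}{2\pi}$ over an interval of length $2\pi$, and $I_Q(\mu)=\int(H\mu-Q')^{2}\,d\mu-\big(\int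 Q'\,d\mu\big)^{2}$. Modified Wasserstein distance: let $\exp(x)=e^{ix}$ for $x\in\mathbb{R}$. For a measure $\mu$ on $\mathbf{T}$ let $\bar\mu$ be the measure on $\mathbb{R}$ given by $\bar\mu(A)=\sum_{n\in\mathbb{Z}}\mu(\exp(A\cap[2n\pi,2(n+1)\pi)))$, and let $\bar\mu_u$ be the restriction of $\bar\mu$ to $[u,u+2\pi)$. For probability measures $\mu,\nu$ on $\mathbf{T}$ and $p\ge1$, $$\mathcal{W}_p(\mu,\nu)=\sup\Big\{W_p(\bar\mu_u,\bar\nu_v): u,v\in[0,2\pi],\ \int x\,\bar\mu_u(dx)=\int x\,\bar\nu_v(dx)\Big\},$$ where $W_p$ is the standard $p$-Wasserstein distance on $\mathbb{R}$ (cost $|x-y|^p$, with the power $1/p$), and the supremum over the empty set is $+\infty$. *)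

theory Defs
  imports "HOL-Probability.Probability"
begin

section \<open>The unit circle and its measures\<close>

abbreviation circle :: "complex set" where
  "circle \<equiv> sphere 0 1"

definition circle_borel :: "complex measure" where
  "circle_borel = restrict_space borel circle"

definition circle_prob :: "complex measure \<Rightarrow> bool" where
  "circle_prob \<mu> \<longleftrightarrow> sets \<mu> = sets circle_borel \<and> prob_space \<mu>"

definition circle_haar :: "complex measure" where
  "circle_haar = distr (uniform_measure lborel {0..<2 * pi}) circle_borel cis"

text \<open>Functions on the circle are total functions on the complex plane of which only the values
  on the circle matter. In particular, the derivative below, at a point of the circle, only depends
  on those values.\<close>

definition circle_deriv :: "(complex \<Rightarrow> real) \<Rightarrow> complex \<Rightarrow> real" where
  "circle_deriv \<phi> z = deriv (\<lambda>t::real. \<phi> (z * cis t)) 0"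

definition circle_differentiable :: "(complex \<Rightarrow> real) \<Rightarrow> bool" where
  "circle_differentiable \<phi> \<longleftrightarrow>
     (\<forall>z\<in>circle. (\<lambda>t::real. \<phi> (z * cis t)) differentiable (at 0))"

definition circle_C1 :: "(complex \<Rightarrow> real) \<Rightarrow> bool" where
  "circle_C1 \<phi> \<longleftrightarrow> circle_differentiable \<phi> \<and> continuous_on circle (circle_deriv \<phi>)"

definition circle_smooth :: "(complex \<Rightarrow> real) \<Rightarrow> bool" where
  "circle_smooth \<phi> \<longleftrightarrow> (\<forall>k. circle_differentiable ((circle_deriv ^^ k) \<phi>))"

definition smooth_density :: "complex measure \<Rightarrow> (complex \<Rightarrow> real) \<Rightarrow> bool" where
  "smooth_density \<mu> m \<longleftrightarrow>
     circle_smooth m \<and> (\<forall>z\<in>circle. 0 \<le> m z) \<and> \<mu> = density circle_haar (\<lambda>z. ennreal (m z))"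

definition smooth_circle_prob :: "complex measure \<Rightarrow> bool" where
  "smooth_circle_prob \<mu> \<longleftrightarrow> circle_prob \<mu> \<and> (\<exists>m. smooth_density \<mu> m)"

text \<open>A smooth density is determined on the circle by its measure, so the choice is immaterial.\<close>

definition density_of :: "complex measure \<Rightarrow> complex \<Rightarrow> real" where
  "density_of \<mu> = (SOME m. smooth_density \<mu> m)"


section \<open>Energy and equilibrium measure\<close>

definition ereal_integral :: "'a measure \<Rightarrow> ('a \<Rightarrow> ereal) \<Rightarrow> ereal" where
  "ereal_integral M f =
     enn2ereal (\<integral>\<^sup>+ x. e2ennreal (f x) \<partial>M) - enn2ereal (\<integral>\<^sup>+ x. e2ennreal (- f x) \<partial>M)"

text \<open>The kernel is \<open>-\<infinity>\<close> on the diagonal, whereas \<open>ln 0 = 0\<close> in the library. It is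
  bounded above by \<open>ln 2\<close> on the circle, so its integral is well defined in
  \<open>[-\<infinity>, \<infinity>)\<close> and the energy takes values in \<open>(-\<infinity>, \<infinity>]\<close>.\<close>

definition log_dist :: "complex \<Rightarrow> complex \<Rightarrow> ereal" where
  "log_dist x y = (if x = y then - \<infinity> else ereal (ln (cmod (x - y))))"

definition energy :: "(complex \<Rightarrow> real) \<Rightarrow> complex measure \<Rightarrow> ereal" where
  "energy Q \<mu> = ereal (\<integral>x. Q x \<partial>\<mu>) - ereal_integral (\<mu> \<Otimes>\<^sub>M \<mu>) (\<lambda>(x, y). log_dist x y)"

definition equilibrium_measure :: "(complex \<Rightarrow> real) \<Rightarrow> complex measure \<Rightarrow> bool" where
  "equilibrium_measure Q \<mu> \<longleftrightarrow> is_arg_min (energy Q) circle_prob \<mu>"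


section \<open>Hilbert transform and free Fisher information\<close>

text \<open>The principal value is taken over the period centred at the argument of the point; by
  periodicity, the choice of the argument is immaterial.\<close>

definition hilbert :: "complex measure \<Rightarrow> complex \<Rightarrow> real" where
  "hilbert \<mu> z = (let x = Arg z in
     Lim (at_right 0) (\<lambda>\<epsilon>.
       LBINT y:{y. \<epsilon> \<le> \<bar>x - y\<bar> \<and> \<bar>x - y\<bar> \<le> pi}.
         cot ((x - y) / 2) * density_of \<mu> (cis y) / (2 * pi)))"

definition fisher_info :: "(complex \<Rightarrow> real) \<Rightarrow> complex measure \<Rightarrow> real" where
  "fisher_info Q \<mu> =
     (\<integral>z. (hilbert \<mu> z - circle_deriv Q z)\<^sup>2 \<partial>\<mu>) - (\<integral>z. circle_deriv Q z \<partial>\<mu>)\<^sup>2"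


section \<open>Wasserstein distances\<close>

definition couplings :: "real measure \<Rightarrow> real measure \<Rightarrow> (real \<times> real) measure set" where
  "couplings \<mu> \<nu> = {\<pi>. sets \<pi> = sets borel \<and> distr \<pi> borel fst = \<mu> \<and> distr \<pi> borel snd = \<nu>}"

definition ennreal_powr :: "ennreal \<Rightarrow> real \<Rightarrow> ennreal" where
  "ennreal_powr x a = (if x = \<infinity> then \<infinity> else ennreal (enn2real x powr a))"

definition wasserstein :: "real \<Rightarrow> real measure \<Rightarrow> real measure \<Rightarrow> ennreal" where
  "wasserstein p \<mu> \<nu> =
     ennreal_powr (INF \<pi>\<in>couplings \<mu> \<nu>. \<integral>\<^sup>+ (x, y). ennreal (\<bar>x - y\<bar> powr p) \<partial>\<pi>) (1 / p)"

definition circle_lift :: "complex measure \<Rightarrow> real measure" where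
  "circle_lift \<mu> = measure_of UNIV (sets borel)
     (\<lambda>A. \<integral>\<^sup>+ n. emeasure \<mu> (cis ` (A \<inter> {2 * of_int n * pi..<2 * (of_int n + 1) * pi}))
            \<partial>count_space (UNIV :: int set))"

text \<open>The set function above is countably additive, so \<open>measure_of\<close> does return the measure with
  these values.\<close>

lemma cis_lift_image:
  "cis ` (A \<inter> {2 * of_int n * pi..<2 * (of_int n + 1) * pi}) =
     {z \<in> circle. Arg2pi z + 2 * of_int n * pi \<in> A}"
proof safe
  fix t assume t: "t \<in> A" "t \<in> {2 * of_int n * pi..<2 * (of_int n + 1) * pi}"
  show "cis t \<in> circle" by simp
  have c: "cis t = cis (t - 2 * of_int n * pi)"
    using cos_int_2pin[of n] sin_int_2pin[of n]
    by (simp add: complex_eq_iff cos_diff sin_diff mult_ac)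
  have "Arg2pi (cis t) = t - 2 * of_int n * pi"
    by (rule Arg2pi_unique[of 1]) (use t c in \<open>auto simp: cis_conv_exp algebra_simps\<close>)
  thus "Arg2pi (cis t) + 2 * of_int n * pi \<in> A" using t by simp
next
  fix z :: complex assume z: "z \<in> circle" "Arg2pi z + 2 * of_int n * pi \<in> A"
  let ?t = "Arg2pi z + 2 * of_int n * pi"
  have "cis ?t = cis (Arg2pi z)"
    using cos_int_2pin[of n] sin_int_2pin[of n]
    by (simp add: complex_eq_iff cos_add sin_add mult_ac)
  also have "\<dots> = z" using z Arg2pi_eq[of z] by (simp add: cis_conv_exp)
  finally have "cis ?t = z" .
  moreover have "?t \<in> {2 * of_int n * pi..<2 * (of_int n + 1) * pi}"
    using Arg2pi[of z] by (auto simp: algebra_simps)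
  ultimately show "z \<in> cis ` (A \<inter> {2 * of_int n * pi..<2 * (of_int n + 1) * pi})"
    using z by (metis IntI imageI)
qed

lemma measurable_Arg2pi [measurable]: "Arg2pi \<in> borel_measurable borel"
proof -
  have "(\<lambda>z. if z \<in> - \<real>\<^sub>\<ge>\<^sub>0 then Arg2pi z else 0) \<in> borel_measurable borel"
    by (intro borel_measurable_continuous_on_if)
       (auto intro!: continuous_at_imp_continuous_on continuous_at_Arg2pi borel_open closed_nonneg_Reals_complex
          simp: open_Compl)
  also have "(\<lambda>z. if z \<in> - \<real>\<^sub>\<ge>\<^sub>0 then Arg2pi z else 0) = Arg2pi"
    by (auto simp: fun_eq_iff Arg2pi_eq_0 complex_nonneg_Reals_iff complex_is_Real_iff)
  finally show ?thesis .
qed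

lemma emeasure_circle_lift:
  assumes "circle_prob \<mu>" and A: "A \<in> sets borel"
  shows "emeasure (circle_lift \<mu>) A =
    (\<integral>\<^sup>+ n. emeasure \<mu> (cis ` (A \<inter> {2 * of_int n * pi..<2 * (of_int n + 1) * pi}))
            \<partial>count_space (UNIV :: int set))"
proof -
  have s: "sets \<mu> = sets (restrict_space borel circle)"
    using assms by (simp add: circle_prob_def circle_borel_def)
  have m: "{z \<in> circle. Arg2pi z + 2 * of_int n * pi \<in> A} \<in> sets \<mu>" if "A \<in> sets borel" for A n
    unfolding s using that by (auto simp: sets_restrict_space_iff)
  show ?thesis
  proof (rule emeasure_measure_of[OF circle_lift_def])
    show "positive (sets (circle_lift \<mu>)) (\<lambda>A. \<integral>\<^sup>+ n. emeasure \<mu> (cis ` (A \<inter> {2 * of_int n * pi..<2 * (of_int n + 1) * pi})) \<partial>count_space (UNIV :: int set))"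
      by (simp add: positive_def)
    show "countably_additive (sets (circle_lift \<mu>)) (\<lambda>A. \<integral>\<^sup>+ n. emeasure \<mu> (cis ` (A \<inter> {2 * of_int n * pi..<2 * (of_int n + 1) * pi})) \<partial>count_space (UNIV :: int set))"
    proof (rule countably_additiveI)
      fix F :: "nat \<Rightarrow> real set"
      assume F: "range F \<subseteq> sets (circle_lift \<mu>)" "disjoint_family F"
      have F': "F i \<in> sets borel" for i
        using F(1) sets.sigma_sets_eq[of "borel :: real measure"] by (auto simp: circle_lift_def sets_measure_of)
      have e: "(\<Sum>i. emeasure \<mu> {z \<in> circle. Arg2pi z + 2 * of_int n * pi \<in> F i}) =
          emeasure \<mu> {z \<in> circle. Arg2pi z + 2 * of_int n * pi \<in> \<Union>(range F)}" for n :: int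
        by (subst suminf_emeasure)
           (use F(2) m[OF F'] in \<open>auto simp: disjoint_family_on_def intro!: arg_cong[where f="emeasure \<mu>"]\<close>)
      show "(\<Sum>i. \<integral>\<^sup>+ n. emeasure \<mu> (cis ` (F i \<inter> {2 * of_int n * pi..<2 * (of_int n + 1) * pi})) \<partial>count_space (UNIV :: int set)) =
        (\<integral>\<^sup>+ n. emeasure \<mu> (cis ` (\<Union>(range F) \<inter> {2 * of_int n * pi..<2 * (of_int n + 1) * pi})) \<partial>count_space (UNIV :: int set))"
        unfolding cis_lift_image e[symmetric] by (subst nn_integral_suminf) simp_all
    qed
  qed (use A in \<open>auto simp: circle_lift_def sets_measure_of\<close>)
qed

text \<open>The restriction to \<open>[u, u + 2\<pi>)\<close>, kept as a measure on the whole line.\<close>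

definition lift_from :: "complex measure \<Rightarrow> real \<Rightarrow> real measure" where
  "lift_from \<mu> u = density (circle_lift \<mu>) (indicator {u..<u + 2 * pi})"

text \<open>The supremum over the empty set is by convention \<open>\<infinity>\<close>, unlike in the library.\<close>

definition circle_wasserstein :: "real \<Rightarrow> complex measure \<Rightarrow> complex measure \<Rightarrow> ennreal" where
  "circle_wasserstein p \<mu> \<nu> =
     (let S = {wasserstein p (lift_from \<mu> u) (lift_from \<nu> v) | u v.
                 u \<in> {0..2 * pi} \<and> v \<in> {0..2 * pi} \<and>
                 (\<integral>x. x \<partial>lift_from \<mu> u) = (\<integral>x. x \<partial>lift_from \<nu> v)}
      in if S = {} then \<infinity> else Sup S)"


section \<open>Functional inequalities\<close>

definition free_LSI :: "(complex \<Rightarrow> real) \<Rightarrow> complex measure \<Rightarrow> real \<Rightarrow> bool" where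
  "free_LSI Q \<mu>Q \<rho> \<longleftrightarrow> (\<forall>\<mu>. smooth_circle_prob \<mu> \<longrightarrow>
     energy Q \<mu> - energy Q \<mu>Q \<le> ereal (1 / (4 * \<rho>) * fisher_info Q \<mu>))"

definition free_transport :: "(complex \<Rightarrow> real) \<Rightarrow> complex measure \<Rightarrow> real \<Rightarrow> bool" where
  "free_transport Q \<mu>Q \<rho> \<longleftrightarrow> (\<forall>\<mu>. smooth_circle_prob \<mu> \<longrightarrow>
     ereal \<rho> * enn2ereal ((circle_wasserstein 2 \<mu> \<mu>Q)\<^sup>2) \<le> energy Q \<mu> - energy Q \<mu>Q)"

end

theory Submission
  imports Defs "HOL-Complex_Analysis.Complex_Analysis" "HOL-Real_Asymp.Real_Asymp"
begin

text \<open>A probability measure on the circle is the law of \<open>cis X\<close> for a nondecreasing function \<open>X\<close> on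
  \<open>(0, 1)\<close> whose values lie in an interval of length \<open>2\<pi>\<close>. Once the mean of \<open>X\<close> is prescribed, \<open>X\<close> is
  unique, so the modified Wasserstein distance is a distance of \<open>L\<^sup>2(0, 1)\<close> on this set of functions,
  and \<open>I\<^sub>Q\<close> is the squared norm of the gradient of \<open>E\<^sub>Q\<close> for it. The theorem is then the implication from
  a Polyak-Lojasiewicz inequality to quadratic growth. If the growth fails at \<open>X\<^sub>0\<close>, then, as in Ekeland's
  variational principle, a minimizer \<open>X\<close> of \<open>sqrt (E\<^sub>Q - min E\<^sub>Q) + c * dist X\<^sub>0\<close> with \<open>c\<^sup>2 < \<rho>\<close> (it exists by
  Helly's selection theorem) is not the equilibrium, and there the slope of \<open>sqrt (E\<^sub>Q - min E\<^sub>Q)\<close> is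
  at most \<open>c\<close>.

  The law \<open>\<mu>\<close> of \<open>cis X\<close> need not be smooth, so the log-Sobolev inequality is applied to its Poisson
  smoothing. If \<open>C\<^sub>s(w, a)\<close> is the Herglotz kernel and \<open>a = cis x\<close>, \<open>b = cis y\<close>, then
  \<open>Im (C\<^sub>s(w, a) * C\<^sub>s(w, b)) = cot ((x - y) / 2) * Re (C\<^sub>s(w, a) - C\<^sub>s(w, b))\<close>. Hence the first variation of
  the logarithmic energy at \<open>\<mu>\<close> along the Poisson mean of a function \<open>h\<close> is the integral of \<open>h * H\<mu>\<^sub>s\<close>
  against the smoothed measure \<open>\<mu>\<^sub>s\<close>, and Jensen's inequality bounds the Fisher information of \<open>\<mu>\<^sub>s\<close> by
  the squared slope at \<open>\<mu>\<close>, up to an error that vanishes as \<open>s\<close> tends to \<open>1\<close>.\<close>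

section \<open>Continuous functions on the circle\<close>

text \<open>The square root fixes the constants. If the slope of sqrt F is at most c, where F is the
  excess energy, then the slope of F is at most 2 c sqrt F. The log-Sobolev inequality bounds F by
  the squared slope over 4 \<rho>, hence by c^2 F / \<rho>, which is absurd when F > 0 and c^2 <
  \<rho>. Prescribing the mean of X restricts displacements to fields of mean zero; since a Hilbert
  transform has mean zero, the subtracted square in the Fisher information is exactly the projection
  of the gradient onto these fields.

  Two obstacles shape the rest. The law of the minimizer is only known to have finite logarithmic
  energy, so it has no Hilbert transform to work with; and a displacement must keep X monotone. The
  Poisson mean answers both: it carries a field for the smoothed measure back to the original one,
  keeps its mean, does not increase its norm, and is Lipschitz, so small multiples of it preserve
  monotonicity. The logarithmic energy is handled as a series in the squared moments, from which
  semicontinuity, strict convexity and decrease under smoothing can be read off.\<close>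

lemma circle_probD:
  assumes "circle_prob M"
  shows "prob_space M" "sets M = sets circle_borel" "space M = circle"
  using assms sets_eq_imp_space_eq[of M circle_borel]
  by (auto simp: circle_prob_def circle_borel_def space_restrict_space)

lemma circle_integral_cong:
  assumes "circle_prob M" "\<And>a. cmod a = 1 \<Longrightarrow> f a = g a"
  shows "(\<integral>a. f a \<partial>M) = (\<integral>a. g a \<partial>M)"
  using assms circle_probD(3)[OF assms(1)] by (intro Bochner_Integration.integral_cong) auto

lemma circle_prob_measurable:
  assumes "circle_prob M"
  shows "f \<in> measurable M N \<longleftrightarrow> f \<in> measurable circle_borel N"
  using circle_probD[OF assms] by (intro iffI) (simp_all cong: measurable_cong_sets)

lemma borel_measurable_circle:
  fixes f :: "complex \<Rightarrow> 'b::topological_space"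
  assumes "circle_prob M" "continuous_on circle f"
  shows "f \<in> borel_measurable M"
  unfolding circle_prob_measurable[OF assms(1)] circle_borel_def
  using assms(2) by (rule borel_measurable_continuous_on_restrict)

lemma circle_bounded:
  fixes f :: "complex \<Rightarrow> 'b::real_normed_vector"
  assumes "continuous_on circle f"
  obtains B where "B > 0" "\<And>x. cmod x = 1 \<Longrightarrow> norm (f x) \<le> B"
proof -
  have "bounded (f ` circle)"
    by (intro compact_imp_bounded compact_continuous_image assms compact_sphere)
  then obtain B where "B > 0" "\<forall>y\<in>f ` circle. norm y \<le> B" by (auto simp: bounded_pos)
  thus ?thesis by (intro that[of B]) auto
qed

lemma circle_integrable:
  fixes f :: "complex \<Rightarrow> 'b::{banach,second_countable_topology}"
  assumes M: "circle_prob M" and f: "continuous_on circle f"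
  shows "integrable M f"
proof -
  interpret prob_space M using circle_probD(1)[OF M] .
  obtain B where "B > 0" "\<And>x. cmod x = 1 \<Longrightarrow> norm (f x) \<le> B" using circle_bounded[OF f] by blast
  thus ?thesis
    using borel_measurable_circle[OF M f] circle_probD(3)[OF M]
    by (intro integrable_const_bound[of _ B]) (auto intro!: AE_I2)
qed

section \<open>Product measures and Fubini on the torus\<close>

text \<open>Continuity on \<open>circle \<times> circle\<close> says nothing off the torus, so
  measurability for the product has to pass through the Borel space of the plane times the plane,
  restricted to the torus.\<close>

lemma measurable_pair_circle:
  assumes M: "circle_prob M" and N: "circle_prob N"
  shows "(\<lambda>x. x) \<in> measurable (M \<Otimes>\<^sub>M N) (restrict_space borel (circle \<times> circle))"
proof (rule measurable_restrict_space2)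
  show "(\<lambda>x. x) \<in> space (M \<Otimes>\<^sub>M N) \<rightarrow> circle \<times> circle"
    using circle_probD(3)[OF M] circle_probD(3)[OF N] by (auto simp: space_pair_measure)
  have 1: "(\<lambda>x. x) \<in> borel_measurable M" "(\<lambda>x. x) \<in> borel_measurable N"
    using M N by (auto intro!: borel_measurable_circle continuous_intros)
  show "(\<lambda>x. x) \<in> borel_measurable (M \<Otimes>\<^sub>M N)"
    using borel_measurable_Pair[OF measurable_compose[OF measurable_fst 1(1)]
         measurable_compose[OF measurable_snd 1(2)]] by simp
qed

lemma borel_measurable_pair_circle:
  fixes f :: "complex \<times> complex \<Rightarrow> 'b::topological_space"
  assumes "circle_prob M" "circle_prob N" "continuous_on (circle \<times> circle) f"
  shows "f \<in> borel_measurable (M \<Otimes>\<^sub>M N)"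
  using measurable_compose[OF measurable_pair_circle[OF assms(1,2)]
      borel_measurable_continuous_on_restrict[OF assms(3)]] .

lemma circle2_bounded:
  fixes f :: "complex \<times> complex \<Rightarrow> 'b::real_normed_vector"
  assumes "continuous_on (circle \<times> circle) f"
  obtains B where "B > 0" "\<And>x y. cmod x = 1 \<Longrightarrow> cmod y = 1 \<Longrightarrow> norm (f (x, y)) \<le> B"
proof -
  have "bounded (f ` (circle \<times> circle))"
    by (intro compact_imp_bounded compact_continuous_image assms compact_Times compact_sphere)
  then obtain B where "B > 0" "\<forall>y\<in>f ` (circle \<times> circle). norm y \<le> B" by (auto simp: bounded_pos)
  thus ?thesis by (intro that[of B]) auto
qed

lemma circle_pair_prob:
  assumes M: "circle_prob M" and N: "circle_prob N"
  shows "pair_prob_space M N"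
  using circle_probD(1)[OF M] circle_probD(1)[OF N]
  by (simp add: pair_prob_space_def pair_sigma_finite_def prob_space_imp_sigma_finite)

lemma circle_pair_integrable:
  fixes f :: "complex \<times> complex \<Rightarrow> 'b::{banach,second_countable_topology}"
  assumes M: "circle_prob M" and N: "circle_prob N" and f: "continuous_on (circle \<times> circle) f"
  shows "integrable (M \<Otimes>\<^sub>M N) f"
proof -
  interpret pair_prob_space M N by (rule circle_pair_prob[OF M N])
  obtain B where "B > 0" "\<And>x y. cmod x = 1 \<Longrightarrow> cmod y = 1 \<Longrightarrow> norm (f (x, y)) \<le> B"
    using circle2_bounded[OF f] by blast
  thus ?thesis
    using borel_measurable_pair_circle[OF M N f] circle_probD(3)[OF M] circle_probD(3)[OF N]
    by (intro P.integrable_const_bound[of _ B]) (auto intro!: AE_I2 simp: space_pair_measure)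
qed

lemma circle_Fubini:
  fixes f :: "complex \<times> complex \<Rightarrow> 'b::{banach,second_countable_topology}"
  assumes M: "circle_prob M" and N: "circle_prob N" and f: "continuous_on (circle \<times> circle) f"
  shows "(\<integral>y. \<integral>x. f (x, y) \<partial>M \<partial>N) = (\<integral>x. \<integral>y. f (x, y) \<partial>N \<partial>M)"
    and "integral\<^sup>L (M \<Otimes>\<^sub>M N) f = (\<integral>x. \<integral>y. f (x, y) \<partial>N \<partial>M)"
proof -
  interpret pair_prob_space M N by (rule circle_pair_prob[OF M N])
  show "(\<integral>y. \<integral>x. f (x, y) \<partial>M \<partial>N) = (\<integral>x. \<integral>y. f (x, y) \<partial>N \<partial>M)"
    using Fubini_integral[of "curry f"] circle_pair_integrable[OF assms] by simp
  show "integral\<^sup>L (M \<Otimes>\<^sub>M N) f = (\<integral>x. \<integral>y. f (x, y) \<partial>N \<partial>M)"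
    using integral_fst'[of f] circle_pair_integrable[OF assms] by simp
qed

lemma continuous_on_circle_section:
  assumes "continuous_on (circle \<times> circle) f"
  shows "cmod a = 1 \<Longrightarrow> continuous_on circle (\<lambda>w. f (w, a))"
    and "cmod a = 1 \<Longrightarrow> continuous_on circle (\<lambda>w. f (a, w))"
  by (auto intro!: continuous_on_compose2[OF assms] continuous_intros)

lemma continuous_on_circle_integral:
  fixes f :: "complex \<times> complex \<Rightarrow> 'b::{banach,second_countable_topology}"
  assumes M: "circle_prob M" and f: "continuous_on (circle \<times> circle) f"
  shows "continuous_on circle (\<lambda>w. \<integral>a. f (w, a) \<partial>M)"
proof (unfold continuous_on_sequentially, intro allI ballI impI, elim conjE)
  fix x w assume w: "w \<in> circle" and x: "\<forall>n. x n \<in> circle" "x \<longlonglongrightarrow> w"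
  interpret prob_space M using circle_probD(1)[OF M] .
  obtain B where B: "B > 0" "\<And>x y. cmod x = 1 \<Longrightarrow> cmod y = 1 \<Longrightarrow> norm (f (x, y)) \<le> B"
    using circle2_bounded[OF f] by blast
  have "(\<lambda>n. \<integral>a. f (x n, a) \<partial>M) \<longlonglongrightarrow> (\<integral>a. f (w, a) \<partial>M)"
  proof (rule integral_dominated_convergence[where w="\<lambda>_. B"])
    show "(\<lambda>a. f (w, a)) \<in> borel_measurable M" "\<And>n. (\<lambda>a. f (x n, a)) \<in> borel_measurable M"
      using x w by (auto intro!: borel_measurable_circle[OF M] continuous_on_circle_section[OF f])
    show "AE a in M. (\<lambda>n. f (x n, a)) \<longlonglongrightarrow> f (w, a)"
    proof (rule AE_I2)
      fix a assume "a \<in> space M"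
      hence a: "cmod a = 1" using circle_probD(3)[OF M] by simp
      show "(\<lambda>n. f (x n, a)) \<longlonglongrightarrow> f (w, a)"
        using continuous_on_circle_section(1)[OF f a] w x
        by (auto simp: continuous_on_sequentially o_def)
    qed
  qed (use B x circle_probD(3)[OF M] in auto)
  thus "((\<lambda>w. \<integral>a. f (w, a) \<partial>M) \<circ> x) \<longlonglongrightarrow> (\<integral>a. f (w, a) \<partial>M)" by (simp add: o_def)
qed

text \<open>The factors \<open>f n\<close> are bounded by 1, so absolute summability of the
  coefficients justifies integrating term by term. Every later expansion, of the Herglotz kernel or
  of the regularized logarithm, has this form.\<close>

lemma circle_integral_suminf:
  fixes c :: "nat \<Rightarrow> complex" and f :: "nat \<Rightarrow> complex \<Rightarrow> complex"
  assumes M: "circle_prob M" and c: "summable (\<lambda>n. norm (c n))"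
    and f: "\<And>n. continuous_on circle (f n)" "\<And>n z. cmod z = 1 \<Longrightarrow> cmod (f n z) \<le> 1"
    and g: "\<And>z. cmod z = 1 \<Longrightarrow> (\<lambda>n. c n * f n z) sums g z"
  shows "(\<lambda>n. c n * (\<integral>z. f n z \<partial>M)) sums (\<integral>z. g z \<partial>M)"
proof -
  interpret prob_space M using circle_probD(1)[OF M] .
  note sp = circle_probD(3)[OF M]
  have b: "norm (c n * f n z) \<le> norm (c n)" if "cmod z = 1" for n z
    using f(2)[OF that, of n] by (simp add: norm_mult mult_left_le)
  have i: "integrable M (\<lambda>z. c n * f n z)" for n
    by (intro circle_integrable[OF M] continuous_intros f)
  have s1: "AE z in M. summable (\<lambda>n. norm (c n * f n z))"
    by (rule AE_I2, rule summable_comparison_test'[OF c]) (use b sp in auto)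
  have s2: "summable (\<lambda>n. \<integral>z. norm (c n * f n z) \<partial>M)"
  proof (rule summable_comparison_test'[OF c])
    fix n
    have "(\<integral>z. norm (c n * f n z) \<partial>M) \<le> (\<integral>z. norm (c n) \<partial>M)"
      using i b sp by (intro integral_mono) auto
    thus "norm (\<integral>z. norm (c n * f n z) \<partial>M) \<le> norm (c n)" by (simp add: prob_space)
  qed
  have "(\<lambda>n. \<integral>z. c n * f n z \<partial>M) sums (\<integral>z. (\<Sum>n. c n * f n z) \<partial>M)"
    using integral_suminf[OF i s1 s2] sums_integral[OF i s1 s2] by simp
  also have "(\<integral>z. (\<Sum>n. c n * f n z) \<partial>M) = (\<integral>z. g z \<partial>M)"
    using g sp by (intro Bochner_Integration.integral_cong) (auto simp: sums_iff)
  finally show ?thesis by simp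
qed

section \<open>The Herglotz kernel\<close>

text \<open>For unimodular w and a this is (1 + z) / (1 - z) at z = s w cnj a. Its real part is the
  Poisson kernel and its imaginary part the conjugate Poisson kernel.\<close>

definition herglotz :: "real \<Rightarrow> complex \<Rightarrow> complex \<Rightarrow> complex" where
  "herglotz s w a = (a + s * w) / (a - s * w)"

abbreviation poisson :: "real \<Rightarrow> complex \<Rightarrow> complex \<Rightarrow> real" where
  "poisson s w a \<equiv> Re (herglotz s w a)"

definition moment :: "complex measure \<Rightarrow> nat \<Rightarrow> complex" where
  "moment M n = (\<integral>a. a ^ n \<partial>M)"

lemma circle_moment_le_1:
  assumes M: "circle_prob M" shows "cmod (moment M n) \<le> 1"
proof -
  interpret prob_space M using circle_probD(1)[OF M] .
  have "cmod (moment M n) \<le> (\<integral>a. cmod (a ^ n) \<partial>M)" unfolding moment_def by simp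
  also have "\<dots> = (\<integral>a. 1 \<partial>M)"
    by (rule circle_integral_cong[OF M]) (simp add: norm_power)
  finally show ?thesis by (simp add: prob_space)
qed

lemma circle_diff_nz:
  assumes "cmod a = 1" "cmod w = 1" "0 \<le> s" "s < 1"
  shows "a - of_real s * w \<noteq> 0"
proof
  assume "a - of_real s * w = 0"
  hence "cmod a = cmod (of_real s * w)" by simp
  thus False using assms by (simp add: norm_mult)
qed

lemma circle_mult_cnj: "cmod a = 1 \<Longrightarrow> a * cnj a = 1"
  using complex_norm_square[of a] by simp

lemma continuous_on_herglotz:
  assumes "0 \<le> s" "s < 1"
  shows "continuous_on (circle \<times> circle) (\<lambda>p. herglotz s (fst p) (snd p))"
  unfolding herglotz_def using circle_diff_nz assms by (intro continuous_intros) auto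

lemmas continuous_on_herglotz_section [continuous_intros] =
  continuous_on_circle_section(1)[OF continuous_on_herglotz, simplified]
  continuous_on_circle_section(2)[OF continuous_on_herglotz, simplified]

lemma continuous_on_herglotz_comp [continuous_intros]:
  fixes f g :: "'a::topological_space \<Rightarrow> complex"
  assumes "0 \<le> s" "s < 1" "continuous_on S f" "continuous_on S g"
    and "\<And>x. x \<in> S \<Longrightarrow> cmod (f x) = 1" "\<And>x. x \<in> S \<Longrightarrow> cmod (g x) = 1"
  shows "continuous_on S (\<lambda>x. herglotz s (f x) (g x))"
  unfolding herglotz_def using circle_diff_nz assms by (intro continuous_intros) auto

text \<open>On the circle the kernel depends only on z = s w cnj a, and exchanging the two points
  conjugates z.\<close>

lemma herglotz_commute:
  assumes "cmod a = 1" "cmod w = 1" "0 \<le> s" "s < 1"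
  shows "herglotz s a w = cnj (herglotz s w a)"
proof -
  have nz: "a - s * w \<noteq> 0" "w - s * a \<noteq> 0" using circle_diff_nz assms by blast+
  have nz2: "cnj a - s * cnj w \<noteq> 0"
    using nz(1) complex_cnj_zero_iff[of "a - s * w"] by simp
  have aw: "a * cnj a = 1" "w * cnj w = 1" using circle_mult_cnj assms by auto
  show ?thesis unfolding herglotz_def complex_cnj_divide complex_cnj_add complex_cnj_diff complex_cnj_mult complex_cnj_complex_of_real
    using nz nz2 aw by (simp add: divide_simps) (algebra)
qed

lemma poisson_eq:
  assumes "cmod a = 1" "cmod w = 1" "0 \<le> s" "s < 1"
  shows "poisson s w a = (1 - s\<^sup>2) / (cmod (a - s * w))\<^sup>2"
proof -
  have 1: "(cmod a)\<^sup>2 = 1" "(cmod w)\<^sup>2 = 1" using assms by auto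
  have "Re ((a + s * w) * cnj (a - s * w)) = (cmod a)\<^sup>2 - s\<^sup>2 * (cmod w)\<^sup>2"
    by (simp add: cmod_power2) (simp add: power2_eq_square algebra_simps)
  also have "\<dots> = 1 - s\<^sup>2" by (simp add: 1)
  finally have "Re ((a + s * w) * cnj (a - s * w)) = 1 - s\<^sup>2" .
  moreover have "herglotz s w a = (a + s * w) * cnj (a - s * w) / of_real ((cmod (a - s * w))\<^sup>2)"
    unfolding herglotz_def by (subst complex_div_cnj) simp
  ultimately show ?thesis by (simp only: Re_divide_of_real)
qed

lemma poisson_nonneg:
  assumes "cmod a = 1" "cmod w = 1" "0 \<le> s" "s < 1"
  shows "0 \<le> poisson s w a"
  using assms by (simp add: poisson_eq power_le_one)

text \<open>Both squared sides are affine in c = Re (a cnj w), and their difference is 2 (1 - s)^2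
  (1 + c). The sharp factor 1 + s matters: it tends to 2, so comparing the logarithm of the
  regularized distance with that of the true one costs only ln 2 - ln (1 + s).\<close>

lemma circle_dist_le:
  assumes "cmod a = 1" "cmod w = 1" "0 \<le> s" "s < 1"
  shows "(1 + s) * cmod (a - w) \<le> 2 * cmod (a - s * w)"
proof -
  have 1: "(cmod a)\<^sup>2 = 1" "(cmod w)\<^sup>2 = 1" using assms by auto
  define c where "c = Re a * Re w + Im a * Im w"
  have "\<bar>c\<bar> \<le> cmod a * cmod w"
    using Cauchy_Schwarz_ineq2[of a w] by (simp add: inner_complex_def c_def)
  hence c: "- 1 \<le> c" "c \<le> 1" using assms by auto
  have 2: "(cmod (a - s * w))\<^sup>2 = (cmod a)\<^sup>2 + s\<^sup>2 * (cmod w)\<^sup>2 - 2 * s * c" for s :: real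
    unfolding c_def cmod_power2 by (simp add: power2_eq_square algebra_simps)
  have 3: "(cmod (a - s * w))\<^sup>2 = 1 + s\<^sup>2 - 2 * s * c" for s :: real
    unfolding 2 by (simp add: 1)
  have "0 \<le> 2 * ((1 - s)\<^sup>2 * (1 + c))" using c by simp
  hence "(1 + s)\<^sup>2 * (2 - 2 * c) \<le> 4 * (1 + s\<^sup>2 - 2 * s * c)"
    by (simp add: power2_eq_square algebra_simps)
  hence "((1 + s) * cmod (a - w))\<^sup>2 \<le> (2 * cmod (a - s * w))\<^sup>2"
    using 3[of 1] 3[of s] by (simp add: power_mult_distrib)
  thus ?thesis by (rule power2_le_imp_le) simp
qed

text \<open>The squared distance cancels the denominator of the Poisson kernel and leaves a multiple
  of 1 - s. This second moment bound is all the concentration that the approximate identity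
  uses.\<close>

lemma poisson_dist_le:
  assumes "cmod a = 1" "cmod w = 1" "0 \<le> s" "s < 1"
  shows "poisson s w a * (cmod (w - a))\<^sup>2 \<le> 8 * (1 - s)"
proof -
  have nz: "cmod (a - s * w) > 0" using circle_diff_nz assms by simp
  have "(cmod (w - a))\<^sup>2 \<le> ((1 + s) * cmod (a - w))\<^sup>2"
    using mult_right_mono[of 1 "1 + s" "cmod (a - w)"] assms
    by (intro power_mono) (auto simp: norm_minus_commute)
  also have "\<dots> \<le> (2 * cmod (a - s * w))\<^sup>2"
    using circle_dist_le[OF assms] assms by (intro power_mono) auto
  finally have 1: "(cmod (w - a))\<^sup>2 \<le> 4 * (cmod (a - s * w))\<^sup>2" by (simp add: power_mult_distrib)
  have "(1 - s\<^sup>2) * (cmod (w - a))\<^sup>2 \<le> (1 - s\<^sup>2) * (4 * (cmod (a - s * w))\<^sup>2)"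
    using assms 1 by (intro mult_left_mono) (auto simp: power_le_one)
  hence "(1 - s\<^sup>2) * (cmod (w - a))\<^sup>2 / (cmod (a - s * w))\<^sup>2 \<le> 4 * (1 - s\<^sup>2)"
    using nz by (intro pos_divide_le_eq[THEN iffD2]) (simp, simp only: mult_ac)
  hence "poisson s w a * (cmod (w - a))\<^sup>2 \<le> 4 * (1 - s\<^sup>2)"
    by (simp add: poisson_eq[OF assms])
  also have "\<dots> \<le> 8 * (1 - s)"
  proof -
    have "(1 - s) * (1 + s) \<le> (1 - s) * 2" using assms by (intro mult_left_mono) auto
    thus ?thesis by (simp add: power2_eq_square algebra_simps)
  qed
  finally show ?thesis .
qed

lemma herglotz_sums:
  assumes "cmod a = 1" "cmod w = 1" "0 \<le> s" "s < 1"
  shows "(\<lambda>n. (if n = 0 then 1 else 2 * of_real s ^ n) * (w * cnj a) ^ n) sums herglotz s w a"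
proof -
  define z where "z = of_real s * (w * cnj a)"
  have z: "cmod z < 1" using assms by (simp add: z_def norm_mult)
  have nz: "a - s * w \<noteq> 0" using circle_diff_nz assms by blast
  have nz': "1 - z \<noteq> 0" using z by auto
  have "(\<lambda>n. 2 * z ^ n) sums (2 * (1 / (1 - z)))"
    by (intro sums_mult geometric_sums z)
  hence "(\<lambda>n. 2 * z ^ n + (if n = 0 then - 1 else 0)) sums (2 * (1 / (1 - z)) + (-1))"
    by (intro sums_add sums_single)
  moreover have "2 * (1 / (1 - z)) + (-1) = herglotz s w a"
  proof -
    have "z * a = s * w" using circle_mult_cnj[OF assms(1)] by (simp add: z_def algebra_simps)
    moreover have "a \<noteq> 0" using assms by auto
    ultimately have "herglotz s w a = (a * (1 + z)) / (a * (1 - z))"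
      unfolding herglotz_def by (simp add: algebra_simps)
    also have "\<dots> = (1 + z) / (1 - z)" using \<open>a \<noteq> 0\<close> by simp
    also have "\<dots> = 2 * (1 / (1 - z)) + (-1)" using nz' by (simp add: field_simps)
    finally show ?thesis by simp
  qed
  moreover have "2 * z ^ n + (if n = 0 then - 1 else 0) = (if n = 0 then 1 else 2 * of_real s ^ n) * (w * cnj a) ^ n" for n
    by (simp add: z_def power_mult_distrib)
  ultimately show ?thesis by simp
qed

lemma herglotz_coeff_summable:
  assumes "0 \<le> s" "s < 1"
  shows "summable (\<lambda>n. cmod (if n = 0 then 1 else 2 * of_real s ^ n))"
proof (rule summable_comparison_test')
  show "summable (\<lambda>n. 2 * s ^ n)" using assms by (intro summable_mult summable_geometric) simp
  show "norm (cmod (if n = 0 then 1 else 2 * of_real s ^ n)) \<le> 2 * s ^ n" for n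
    using assms by (simp add: norm_mult norm_power)
qed

lemma herglotz_transform_sums:
  assumes M: "circle_prob M" and s: "0 \<le> s" "s < 1" and w: "cmod w = 1"
  shows "(\<lambda>n. (if n = 0 then 1 else 2 * of_real s ^ n) * (w ^ n * cnj (moment M n)))
           sums (\<integral>a. herglotz s w a \<partial>M)"
proof -
  have "(\<lambda>n. (if n = 0 then 1 else 2 * of_real s ^ n) * (\<integral>a. (w * cnj a) ^ n \<partial>M))
           sums (\<integral>a. herglotz s w a \<partial>M)"
    using herglotz_sums w s
    by (intro circle_integral_suminf[OF M herglotz_coeff_summable[OF s]])
       (auto intro!: continuous_intros simp: norm_power norm_mult)
  moreover have "(\<integral>a. (w * cnj a) ^ n \<partial>M) = w ^ n * cnj (moment M n)" for n
    unfolding moment_def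
    using circle_integrable[OF M, of "\<lambda>a. a ^ n"]
    by (simp add: power_mult_distrib continuous_intros flip: complex_cnj_power integral_cnj)
  ultimately show ?thesis by simp
qed

text \<open>Powers of w are orthogonal for a measure with vanishing moments, so integrating against
  w^n selects a single term of the kernel's expansion: the harmonic extension of w^n takes the value
  s^n a^n at s a.\<close>

lemma poisson_moment:
  assumes M: "circle_prob M" and M0: "\<And>n. n > 0 \<Longrightarrow> moment M n = 0"
    and s: "0 \<le> s" "s < 1" and a: "cmod a = 1"
  shows "(\<integral>w. herglotz s w a \<partial>M) = 1"
    and "(\<integral>w. w ^ n * of_real (poisson s w a) \<partial>M) = of_real s ^ n * a ^ n"
proof -
  interpret prob_space M using circle_probD(1)[OF M] .
  have "(\<integral>w. herglotz s w a \<partial>M) = (\<integral>w. cnj (herglotz s a w) \<partial>M)"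
    by (intro Bochner_Integration.integral_cong refl herglotz_commute)
       (use circle_probD(3)[OF M] s a in simp_all)
  also have "\<dots> = cnj (\<integral>w. herglotz s a w \<partial>M)" by simp
  also have "(\<integral>w. herglotz s a w \<partial>M) = 1"
  proof -
    have 0: "moment M 0 = 1" by (simp add: moment_def prob_space)
    have "(\<lambda>n. (if n = 0 then 1 else 2 * of_real s ^ n) * (a ^ n * cnj (moment M n))) = (\<lambda>n. if n = 0 then 1 else 0)"
      using 0 M0 by (auto simp: fun_eq_iff)
    thus ?thesis using herglotz_transform_sums[OF M s a] sums_single[of 0 "\<lambda>_. 1::complex"]
      by (auto intro: sums_unique2)
  qed
  finally show 1: "(\<integral>w. herglotz s w a \<partial>M) = 1" by simp
  have mom: "(\<integral>w. w ^ n * cnj w ^ k \<partial>M) = (if n = k then 1 else 0)" for n k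
  proof -
    have "(\<integral>w. w ^ n * cnj w ^ k \<partial>M) = (\<integral>w. (if n \<ge> k then w ^ (n - k) else cnj (w ^ (k - n))) \<partial>M)"
    proof (intro Bochner_Integration.integral_cong refl)
      fix w assume "w \<in> space M"
      hence w: "w * cnj w = 1" using circle_mult_cnj circle_probD(3)[OF M] by simp
      show "w ^ n * cnj w ^ k = (if n \<ge> k then w ^ (n - k) else cnj (w ^ (k - n)))"
      proof (cases "n \<ge> k")
        case True
        have "w ^ n * cnj w ^ k = w ^ (n - k) * (w * cnj w) ^ k"
          using True by (simp add: power_mult_distrib flip: power_add mult.assoc)
        thus ?thesis using True w by simp
      next
        case False
        have "w ^ n * cnj w ^ k = (w * cnj w) ^ n * cnj w ^ (k - n)"
          using False by (simp add: power_mult_distrib mult.assoc flip: power_add)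
        thus ?thesis using False w by simp
      qed
    qed
    also have "\<dots> = (if n = k then 1 else 0)"
      using M0[of "n - k"] M0[of "k - n"] prob_space
      by (cases "n = k"; cases "k < n") (simp_all add: moment_def flip: complex_cnj_power)
    finally show ?thesis .
  qed
  have c1: "continuous_on circle (\<lambda>w. herglotz s w a)"
    by (intro continuous_intros s a)
  \<comment> \<open>The Poisson kernel is half the sum of the Herglotz kernel and its conjugate. The
    analytic half only meets the moments of order n + k and survives for n = k = 0 alone; the
    conjugate half survives for k = n.\<close>
  have A: "(\<lambda>k. (if k = 0 then 1 else 2 * of_real s ^ k) * (\<integral>w. w ^ n * (w * cnj a) ^ k \<partial>M))
           sums (\<integral>w. w ^ n * herglotz s w a \<partial>M)"
  proof (intro circle_integral_suminf[OF M herglotz_coeff_summable[OF s]])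
    fix z :: complex assume z: "cmod z = 1"
    show "(\<lambda>k. (if k = 0 then 1 else 2 * complex_of_real s ^ k) * (z ^ n * (z * cnj a) ^ k)) sums (z ^ n * herglotz s z a)"
      using sums_mult[OF herglotz_sums[OF a z s], of "z ^ n"] by (simp add: mult_ac)
  qed (use a in \<open>auto intro!: continuous_intros simp: norm_power norm_mult\<close>)
  have "(\<integral>w. w ^ n * (w * cnj a) ^ k \<partial>M) = cnj a ^ k * moment M (n + k)" for k
    by (simp add: moment_def power_mult_distrib power_add mult_ac
        flip: Bochner_Integration.integral_mult_right_zero)
  hence "(\<lambda>k. (if k = 0 then 1 else 2 * of_real s ^ k) * (\<integral>w. w ^ n * (w * cnj a) ^ k \<partial>M)) = (\<lambda>k. if k = 0 then of_bool (n = 0) else 0)"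
    using M0 prob_space by (auto simp: fun_eq_iff moment_def)
  hence A': "(\<integral>w. w ^ n * herglotz s w a \<partial>M) = of_bool (n = 0)"
    using A sums_single[of 0 "\<lambda>_. of_bool (n = 0)::complex"] sums_unique2 by fastforce
  have B: "(\<lambda>k. (if k = 0 then 1 else 2 * of_real s ^ k) * (\<integral>w. w ^ n * cnj (w * cnj a) ^ k \<partial>M))
           sums (\<integral>w. w ^ n * cnj (herglotz s w a) \<partial>M)"
  proof (intro circle_integral_suminf[OF M herglotz_coeff_summable[OF s]])
    fix z :: complex assume z: "cmod z = 1"
    have "(\<lambda>k. cnj ((if k = 0 then 1 else 2 * complex_of_real s ^ k) * (z * cnj a) ^ k)) sums cnj (herglotz s z a)"
      using herglotz_sums[OF a z s] by (simp only: sums_cnj)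
    moreover have "(\<lambda>k. cnj ((if k = 0 then 1 else 2 * complex_of_real s ^ k) * (z * cnj a) ^ k)) =
        (\<lambda>k. (if k = 0 then 1 else 2 * complex_of_real s ^ k) * cnj (z * cnj a) ^ k)"
      by (auto simp: fun_eq_iff)
    ultimately have "(\<lambda>k. (if k = 0 then 1 else 2 * complex_of_real s ^ k) * cnj (z * cnj a) ^ k) sums cnj (herglotz s z a)"
      by (simp only:)
    from sums_mult[OF this, of "z ^ n"]
    show "(\<lambda>k. (if k = 0 then 1 else 2 * complex_of_real s ^ k) * (z ^ n * cnj (z * cnj a) ^ k)) sums (z ^ n * cnj (herglotz s z a))"
      by (simp add: mult_ac)
  qed (use a in \<open>auto intro!: continuous_intros simp: norm_power norm_mult\<close>)
  have "(\<integral>w. w ^ n * cnj (w * cnj a) ^ k \<partial>M) = a ^ k * (\<integral>w. w ^ n * cnj w ^ k \<partial>M)" for k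
    by (simp add: power_mult_distrib mult_ac flip: Bochner_Integration.integral_mult_right_zero)
  hence "(\<lambda>k. (if k = 0 then 1 else 2 * of_real s ^ k) * (\<integral>w. w ^ n * cnj (w * cnj a) ^ k \<partial>M)) =
     (\<lambda>k. if k = n then (if n = 0 then 1 else 2 * of_real s ^ n * a ^ n) else 0)"
    by (auto simp: fun_eq_iff mom)
  hence B': "(\<integral>w. w ^ n * cnj (herglotz s w a) \<partial>M) = (if n = 0 then 1 else 2 * of_real s ^ n * a ^ n)"
    using B sums_single[of n "\<lambda>_. (if n = 0 then 1 else 2 * of_real s ^ n * a ^ n)::complex"] sums_unique2 by fastforce
  have "of_real (poisson s w a) = (herglotz s w a + cnj (herglotz s w a)) / 2" for w
    by (simp add: complex_add_cnj)
  hence "(\<integral>w. w ^ n * of_real (poisson s w a) \<partial>M) =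
    (\<integral>w. (w ^ n * herglotz s w a + w ^ n * cnj (herglotz s w a)) / 2 \<partial>M)"
    by (simp only: distrib_left times_divide_eq_right)
  also have "\<dots> = ((\<integral>w. w ^ n * herglotz s w a \<partial>M) + (\<integral>w. w ^ n * cnj (herglotz s w a) \<partial>M)) / 2"
    by (subst integral_divide_zero, subst Bochner_Integration.integral_add)
       (auto intro!: circle_integrable[OF M] continuous_intros c1)
  also have "\<dots> = of_real s ^ n * a ^ n" unfolding A' B' by simp
  finally show "(\<integral>w. w ^ n * of_real (poisson s w a) \<partial>M) = of_real s ^ n * a ^ n" .
qed

section \<open>Haar measure and the approximate identity\<close>

text \<open>The same measure for every t, as \<open>arc_eq_haar\<close> shows. The starting point is
  kept free because the principal value is taken over the period centred at the argument of the
  point.\<close>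

definition arc_measure :: "real \<Rightarrow> complex measure" where
  "arc_measure t = distr (uniform_measure lborel {t..<t + 2 * pi}) circle_borel cis"

lemma measurable_cis_circle [measurable]: "cis \<in> measurable borel circle_borel"
  unfolding circle_borel_def
  by (intro measurable_restrict_space2 borel_measurable_continuous_onI continuous_intros) simp

lemma circle_prob_distr:
  assumes "prob_space M" "f \<in> measurable M circle_borel"
  shows "circle_prob (distr M circle_borel f)"
  using assms by (auto simp: circle_prob_def intro: prob_space.prob_space_distr)

lemma circle_prob_arc: "circle_prob (arc_measure t)"
  unfolding arc_measure_def
  by (intro circle_prob_distr prob_space_uniform_measure) simp_all

lemma circle_haar_eq_arc: "circle_haar = arc_measure 0"
  by (simp add: circle_haar_def arc_measure_def)

lemma circle_prob_haar: "circle_prob circle_haar"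
  by (simp add: circle_haar_eq_arc circle_prob_arc)

lemma integral_arc:
  fixes f :: "complex \<Rightarrow> 'b::{banach,second_countable_topology}"
  assumes "continuous_on circle f"
  shows "(\<integral>w. f w \<partial>arc_measure t) = (LBINT y:{t..<t + 2 * pi}. f (cis y)) /\<^sub>R (2 * pi)"
proof -
  have "f \<in> borel_measurable circle_borel"
    using borel_measurable_circle[OF circle_prob_haar assms] circle_prob_measurable[OF circle_prob_haar] by blast
  hence [measurable]: "(\<lambda>y. f (cis y)) \<in> borel_measurable borel" "f \<in> borel_measurable circle_borel"
    by (auto intro: measurable_compose[OF measurable_cis_circle])
  have "(\<integral>w. f w \<partial>arc_measure t) = (\<integral>y. f (cis y) \<partial>uniform_measure lborel {t..<t + 2 * pi})"
    unfolding arc_measure_def by (rule integral_distr) simp_all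
  also have "uniform_measure lborel {t..<t + 2 * pi} =
      density lborel (\<lambda>y. ennreal (indicator {t..<t + 2 * pi} y / (2 * pi)))"
    unfolding uniform_measure_def
    by (intro density_cong) (auto split: split_indicator simp: divide_ennreal ennreal_1[symmetric] simp del: ennreal_1)
  also have "(\<integral>y. f (cis y) \<partial>density lborel (\<lambda>y. ennreal (indicator {t..<t + 2 * pi} y / (2 * pi)))) =
     (\<integral>y. (indicator {t..<t + 2 * pi} y / (2 * pi)) *\<^sub>R f (cis y) \<partial>lborel)"
    by (intro integral_density) auto
  also have "\<dots> = (\<integral>y. (1 / (2 * pi)) *\<^sub>R (indicator {t..<t + 2 * pi} y *\<^sub>R f (cis y)) \<partial>lborel)"
    by (intro Bochner_Integration.integral_cong) auto
  also have "\<dots> = (LBINT y:{t..<t + 2 * pi}. f (cis y)) /\<^sub>R (2 * pi)"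
    unfolding set_lebesgue_integral_def inverse_eq_divide by (rule integral_scaleR_right)
  finally show ?thesis .
qed

lemma arc_moment:
  assumes "n > 0" shows "moment (arc_measure t) n = 0"
proof -
  have "(LBINT y:{t..t + 2 * pi}. cis y ^ n) = cis (n * (t + 2 * pi)) / (\<i> * n) - cis (n * t) / (\<i> * n)"
    unfolding set_lebesgue_integral_def
  proof (rule integral_FTC_Icc)
    fix x :: real
    have "((\<lambda>x. exp (\<i> * (n * x)) / (\<i> * n)) has_vector_derivative (exp (\<i> * (n * x)))) (at x within {t..t + 2 * pi})"
      using assms by (auto intro!: derivative_eq_intros has_vector_derivative_real_field simp: field_simps)
    moreover have "cis x ^ n = exp (\<i> * (n * x))"
      by (simp only: Complex.DeMoivre) (simp add: cis_conv_exp)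
    moreover have "cis (n * x) = exp (\<i> * (n * x))" for x :: real
      by (simp add: cis_conv_exp)
    ultimately show "((\<lambda>x. cis (n * x) / (\<i> * n)) has_vector_derivative (cis x ^ n)) (at x within {t..t + 2 * pi})"
      by simp
  qed (auto intro!: continuous_intros)
  also have "cis (n * (t + 2 * pi)) = cis (n * t) * cis (2 * pi * n)"
    by (simp add: cis_mult algebra_simps)
  also have "cis (2 * pi * n) = 1" by (rule cis_multiple_2pi) simp
  also have "(LBINT y:{t..t + 2 * pi}. cis y ^ n) = (LBINT y:{t..<t + 2 * pi}. cis y ^ n)"
    unfolding set_lebesgue_integral_def
  proof (rule integral_cong_AE)
    have [measurable]: "cis \<in> borel_measurable borel"
      by (intro borel_measurable_continuous_onI continuous_intros)
    show "(\<lambda>y. indicator {t..t + 2 * pi} y *\<^sub>R cis y ^ n) \<in> borel_measurable lborel"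
      "(\<lambda>y. indicator {t..<t + 2 * pi} y *\<^sub>R cis y ^ n) \<in> borel_measurable lborel"
      by measurable
    show "AE y in lborel. indicator {t..t + 2 * pi} y *\<^sub>R cis y ^ n = indicator {t..<t + 2 * pi} y *\<^sub>R cis y ^ n"
      using AE_lborel_singleton[of "t + 2 * pi"] by eventually_elim (auto split: split_indicator)
  qed
  finally show ?thesis
    unfolding moment_def by (subst integral_arc) (auto intro!: continuous_intros)
qed

lemma haar_moment: "n > 0 \<Longrightarrow> moment circle_haar n = 0"
  by (simp add: circle_haar_eq_arc arc_moment)

lemma haar_herglotz:
  assumes "0 \<le> s" "s < 1" "cmod a = 1"
  shows "(\<integral>w. herglotz s w a \<partial>circle_haar) = 1"
  by (rule poisson_moment(1)[OF circle_prob_haar]) (use assms in \<open>auto simp: haar_moment\<close>)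

lemma haar_poisson_moment:
  assumes "0 \<le> s" "s < 1" "cmod a = 1"
  shows "(\<integral>w. w ^ n * of_real (poisson s w a) \<partial>circle_haar) = of_real s ^ n * a ^ n"
  by (rule poisson_moment(2)[OF circle_prob_haar]) (use assms in \<open>auto simp: haar_moment\<close>)

lemma haar_poisson:
  assumes "0 \<le> s" "s < 1" "cmod a = 1"
  shows "(\<integral>w. poisson s w a \<partial>circle_haar) = 1"
proof -
  have "(\<integral>w. poisson s w a \<partial>circle_haar) = Re (\<integral>w. herglotz s w a \<partial>circle_haar)"
    by (intro integral_Re circle_integrable[OF circle_prob_haar] continuous_intros assms)
  thus ?thesis using haar_herglotz[OF assms(1,2,3)] by simp
qed

text \<open>Uniform continuity handles w near a. Away from a, the crude bound 2 B is dominated by K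
  times the squared distance, whose Poisson mean is at most 8 (1 - s). The constant depends on f and
  e only, so the bound is uniform in a.\<close>

lemma poisson_approx:
  fixes f :: "complex \<Rightarrow> real"
  assumes f: "continuous_on circle f" and e: "e > 0"
  obtains K where "K > 0"
    "\<And>s a. 0 \<le> s \<Longrightarrow> s < 1 \<Longrightarrow> cmod a = 1 \<Longrightarrow>
       (\<integral>w. poisson s w a * \<bar>f w - f a\<bar> \<partial>circle_haar) \<le> e + K * (1 - s)"
proof -
  obtain B where B: "B > 0" "\<And>x. cmod x = 1 \<Longrightarrow> norm (f x) \<le> B" using circle_bounded[OF f] by blast
  have "uniformly_continuous_on circle f" using f compact_sphere compact_uniformly_continuous by blast
  then obtain d where d: "d > 0" "\<And>x y. cmod x = 1 \<Longrightarrow> cmod y = 1 \<Longrightarrow> dist y x < d \<Longrightarrow> dist (f y) (f x) < e"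
    using e unfolding uniformly_continuous_on_def by (metis mem_sphere_0)
  define K where "K = 2 * B / d\<^sup>2"
  have K: "K > 0" using B d by (simp add: K_def)
  have pw: "\<bar>f w - f a\<bar> \<le> e + K * (cmod (w - a))\<^sup>2" if "cmod w = 1" "cmod a = 1" for w a
  proof (cases "dist w a < d")
    case True
    have "K * (cmod (w - a))\<^sup>2 \<ge> 0" using K by simp
    thus ?thesis using d(2)[OF that(2,1) True] by (simp add: dist_real_def)
  next
    case False
    hence "d\<^sup>2 \<le> (cmod (w - a))\<^sup>2" using d by (intro power_mono) (auto simp: dist_norm)
    hence "2 * B \<le> K * (cmod (w - a))\<^sup>2"
      using d B by (simp add: K_def field_simps)
    thus ?thesis using B(2)[of w] B(2)[of a] that e by auto
  qed
  show ?thesis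
  proof (rule that[of "8 * K"])
    fix s :: real and a :: complex
    assume s: "0 \<le> s" "s < 1" and a: "cmod a = 1"
    have "(\<integral>w. poisson s w a * \<bar>f w - f a\<bar> \<partial>circle_haar) \<le> (\<integral>w. e * poisson s w a + 8 * K * (1 - s) \<partial>circle_haar)"
    proof (intro integral_mono circle_integrable[OF circle_prob_haar])
      fix w assume "w \<in> space circle_haar"
      hence w: "cmod w = 1" using circle_probD(3)[OF circle_prob_haar] by simp
      have "poisson s w a * \<bar>f w - f a\<bar> \<le> poisson s w a * (e + K * (cmod (w - a))\<^sup>2)"
        using pw[OF w a] poisson_nonneg[OF a w s] by (intro mult_left_mono) auto
      also have "\<dots> = e * poisson s w a + K * (poisson s w a * (cmod (w - a))\<^sup>2)" by (simp add: algebra_simps)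
      also have "\<dots> \<le> e * poisson s w a + K * (8 * (1 - s))"
        using poisson_dist_le[OF a w s] K by (intro add_left_mono mult_left_mono) auto
      finally show "poisson s w a * \<bar>f w - f a\<bar> \<le> e * poisson s w a + 8 * K * (1 - s)" by (simp add: algebra_simps)
    qed (intro continuous_intros s a f)+
    also have "\<dots> = e + 8 * K * (1 - s)"
    proof -
      interpret prob_space circle_haar using circle_probD(1)[OF circle_prob_haar] .
      show ?thesis
        by (subst Bochner_Integration.integral_add)
           (auto intro!: circle_integrable[OF circle_prob_haar] continuous_intros s a simp: haar_poisson s a prob_space)
    qed
    finally show "(\<integral>w. poisson s w a * \<bar>f w - f a\<bar> \<partial>circle_haar) \<le> e + 8 * K * (1 - s)" .
  qed (use K in auto)
qed

text \<open>Kept complex so that one function carries both quantities needed later: its real part is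
  the density of the Poisson smoothing, and its imaginary part turns out to be the Hilbert transform
  of that density.\<close>

definition smoothing :: "complex measure \<Rightarrow> real \<Rightarrow> complex \<Rightarrow> complex" where
  "smoothing M s w = (\<integral>a. herglotz s w a \<partial>M)"

lemma continuous_on_smoothing [continuous_intros]:
  assumes "circle_prob M" "0 \<le> s" "s < 1"
  shows "continuous_on circle (smoothing M s)"
  using continuous_on_circle_integral[OF assms(1) continuous_on_herglotz[OF assms(2,3)]]
  unfolding smoothing_def[abs_def] by simp

lemma Re_smoothing:
  assumes "circle_prob M" "0 \<le> s" "s < 1" "cmod w = 1"
  shows "Re (smoothing M s w) = (\<integral>a. poisson s w a \<partial>M)"
  unfolding smoothing_def
  by (intro integral_Re[symmetric] circle_integrable[OF assms(1)] continuous_intros assms)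

lemma Re_smoothing_nonneg:
  assumes "circle_prob M" "0 \<le> s" "s < 1" "cmod w = 1"
  shows "Re (smoothing M s w) \<ge> 0"
  unfolding Re_smoothing[OF assms] using circle_probD(3)[OF assms(1)] assms
  by (intro integral_nonneg_AE AE_I2 poisson_nonneg) auto

lemma poisson_duality:
  fixes h :: "complex \<Rightarrow> real"
  assumes M: "circle_prob M" and s: "0 \<le> s" "s < 1" and h: "continuous_on circle h"
  shows "(\<integral>a. \<integral>w. h w * poisson s w a \<partial>circle_haar \<partial>M) = (\<integral>w. h w * Re (smoothing M s w) \<partial>circle_haar)"
proof -
  have c: "continuous_on (circle \<times> circle) (\<lambda>(w, a). h w * poisson s w a)"
    unfolding case_prod_beta
    by (intro continuous_intros continuous_on_herglotz s continuous_on_compose2[OF h]) auto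
  have "(\<integral>a. \<integral>w. h w * poisson s w a \<partial>circle_haar \<partial>M) = (\<integral>w. \<integral>a. h w * poisson s w a \<partial>M \<partial>circle_haar)"
    using circle_Fubini(1)[OF circle_prob_haar M c] by simp
  also have "\<dots> = (\<integral>w. h w * Re (smoothing M s w) \<partial>circle_haar)"
    by (rule circle_integral_cong[OF circle_prob_haar]) (simp add: Re_smoothing[OF M s])
  finally show ?thesis .
qed

lemma smoothing_tendsto:
  fixes h :: "complex \<Rightarrow> real" and s :: "nat \<Rightarrow> real"
  assumes M: "circle_prob M" and h: "continuous_on circle h"
    and s: "\<And>n. 0 \<le> s n" "\<And>n. s n < 1" "s \<longlonglongrightarrow> 1"
  shows "(\<lambda>n. \<integral>w. h w * Re (smoothing M (s n) w) \<partial>circle_haar) \<longlonglongrightarrow> (\<integral>a. h a \<partial>M)"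
proof (rule LIMSEQ_I)
  fix r :: real assume r: "r > 0"
  interpret prob_space M using circle_probD(1)[OF M] .
  interpret H: prob_space circle_haar using circle_probD(1)[OF circle_prob_haar] .
  obtain K where K: "K > 0"
    "\<And>s a. 0 \<le> s \<Longrightarrow> s < 1 \<Longrightarrow> cmod a = 1 \<Longrightarrow>
       (\<integral>w. poisson s w a * \<bar>h w - h a\<bar> \<partial>circle_haar) \<le> r / 2 + K * (1 - s)"
    using poisson_approx[OF h, of "r / 2"] r by auto
  have "(\<lambda>n. r / 2 + K * (1 - s n)) \<longlonglongrightarrow> r / 2 + K * (1 - 1)" by (intro tendsto_intros s)
  hence "\<forall>\<^sub>F n in sequentially. r / 2 + K * (1 - s n) < r" using r by (auto simp: order_tendsto_iff)
  then obtain N where N: "\<And>n. n \<ge> N \<Longrightarrow> r / 2 + K * (1 - s n) < r" by (auto simp: eventually_sequentially)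
  show "\<exists>N. \<forall>n\<ge>N. norm ((\<integral>w. h w * Re (smoothing M (s n) w) \<partial>circle_haar) - (\<integral>a. h a \<partial>M)) < r"
  proof (intro exI allI impI)
    fix n assume n: "n \<ge> N"
    have ch: "continuous_on (circle \<times> circle) (\<lambda>(a, w). h w * poisson (s n) w a)"
      unfolding case_prod_beta
      by (intro continuous_intros continuous_on_compose2[OF h] s) auto
    have ig: "integrable M (\<lambda>a. \<integral>w. h w * poisson (s n) w a \<partial>circle_haar)"
      using continuous_on_circle_integral[OF circle_prob_haar ch]
      by (intro circle_integrable[OF M]) simp
    have "(\<integral>w. h w * Re (smoothing M (s n) w) \<partial>circle_haar) - (\<integral>a. h a \<partial>M) =
        (\<integral>a. (\<integral>w. h w * poisson (s n) w a \<partial>circle_haar) - h a \<partial>M)"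
      unfolding poisson_duality[OF M s(1,2) h, symmetric]
      by (rule Bochner_Integration.integral_diff[symmetric, OF ig circle_integrable[OF M h]])
    also have "norm \<dots> \<le> (\<integral>a. r / 2 + K * (1 - s n) \<partial>M)"
    proof (rule Bochner_Integration.integral_norm_bound_integral)
      fix a assume "a \<in> space M"
      hence a: "cmod a = 1" using circle_probD(3)[OF M] by simp
      have i: "integrable circle_haar (\<lambda>w. h w * poisson (s n) w a)" "integrable circle_haar (\<lambda>w. h a * poisson (s n) w a)"
        by (intro circle_integrable[OF circle_prob_haar] continuous_intros h s a)+
      have "(\<integral>w. h w * poisson (s n) w a \<partial>circle_haar) - h a =
         (\<integral>w. h w * poisson (s n) w a \<partial>circle_haar) - (\<integral>w. h a * poisson (s n) w a \<partial>circle_haar)"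
        using haar_poisson[OF s(1,2) a] by simp
      also have "\<dots> = (\<integral>w. (h w - h a) * poisson (s n) w a \<partial>circle_haar)"
        by (subst Bochner_Integration.integral_diff[OF i, symmetric]) (simp add: algebra_simps)
      also have "norm \<dots> \<le> (\<integral>w. norm ((h w - h a) * poisson (s n) w a) \<partial>circle_haar)"
        by simp
      also have "\<dots> = (\<integral>w. poisson (s n) w a * \<bar>h w - h a\<bar> \<partial>circle_haar)"
        using circle_probD(3)[OF circle_prob_haar] poisson_nonneg[OF a _ s(1,2)]
        by (intro Bochner_Integration.integral_cong) (auto simp: abs_mult)
      also have "\<dots> \<le> r / 2 + K * (1 - s n)" by (intro K s a)
      finally show "norm ((\<integral>w. h w * poisson (s n) w a \<partial>circle_haar) - h a) \<le> r / 2 + K * (1 - s n)" .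
    qed (use ig circle_integrable[OF M h] in auto)
    also have "\<dots> < r" using N[OF n] by (simp add: prob_space)
    finally show "norm ((\<integral>w. h w * Re (smoothing M (s n) w) \<partial>circle_haar) - (\<integral>a. h a \<partial>M)) < r" .
  qed
qed

section \<open>Measures determined by continuous functions and by moments\<close>

text \<open>The indicator of a closed set is the bounded limit of the continuous functions
  \<open>max 0 (1 - real n * infdist x C)\<close>, and the closed sets form a generator stable under
  intersection.\<close>

lemma circle_prob_eqI:
  assumes M: "circle_prob M" and N: "circle_prob N"
    and eq: "\<And>h :: complex \<Rightarrow> real. continuous_on circle h \<Longrightarrow> integral\<^sup>L M h = integral\<^sup>L N h"
  shows "M = N"
proof -
  interpret M: prob_space M using circle_probD(1)[OF M] .
  interpret N: prob_space N using circle_probD(1)[OF N] .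
  let ?D = "\<lambda>M. distr M borel (\<lambda>x. x) :: complex measure"
  have m: "(\<lambda>x. x) \<in> borel_measurable M" "(\<lambda>x. x) \<in> borel_measurable N"
    using M N by (auto intro!: borel_measurable_circle continuous_intros)
  interpret DM: prob_space "?D M" by (intro M.prob_space_distr m)
  interpret DN: prob_space "?D N" by (intro N.prob_space_distr m)
  have lim: "(\<lambda>n. \<integral>x. max 0 (1 - real n * infdist x C) \<partial>P) \<longlonglongrightarrow> measure (?D P) C"
    if P: "circle_prob P" and C: "closed C" "C \<noteq> {}" for P C
  proof -
    interpret P: prob_space P using circle_probD(1)[OF P] .
    have mP: "(\<lambda>x. x) \<in> borel_measurable P" using P by (auto intro!: borel_measurable_circle continuous_intros)
    have "(\<lambda>n. \<integral>x. max 0 (1 - real n * infdist x C) \<partial>P) \<longlonglongrightarrow> (\<integral>x. indicator C x \<partial>P)"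
    proof (rule integral_dominated_convergence[where w="\<lambda>_. 1"])
      show "AE x in P. (\<lambda>n. max 0 (1 - real n * infdist x C)) \<longlonglongrightarrow> indicator C x"
      proof (rule AE_I2)
        fix x
        show "(\<lambda>n. max 0 (1 - real n * infdist x C)) \<longlonglongrightarrow> indicator C x"
        proof (cases "x \<in> C")
          case False
          hence pos: "infdist x C > 0" using C in_closed_iff_infdist_zero[of C x] infdist_nonneg[of x C] by auto
          then obtain k :: nat where k: "real k * infdist x C > 1" using reals_Archimedean3 by blast
          have "max 0 (1 - real n * infdist x C) = 0" if "n \<ge> k" for n
          proof -
            have "real k * infdist x C \<le> real n * infdist x C" using that pos by (intro mult_right_mono) auto
            thus ?thesis using k by auto
          qed
          hence "\<forall>\<^sub>F n in sequentially. max 0 (1 - real n * infdist x C) = 0"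
            by (auto simp: eventually_sequentially)
          thus ?thesis using False by (simp add: tendsto_eventually)
        qed simp
      qed
      show "indicator C \<in> borel_measurable P"
        using measurable_compose[OF mP borel_measurable_indicator[of C borel]] C by simp
      show "(\<lambda>x. max 0 (1 - real n * infdist x C)) \<in> borel_measurable P" for n
        by (intro borel_measurable_circle[OF P] continuous_intros)
    qed (auto simp: abs_if infdist_nonneg)
    also have "(\<integral>x. indicator C x \<partial>P) = measure (?D P) C"
      using C mP by (simp add: measure_distr Int_commute vimage_def)
    finally show ?thesis .
  qed
  have cl: "emeasure (?D M) C = emeasure (?D N) C" if "closed C" for C
  proof (cases "C = {}")
    case False
    have "(\<integral>x. max 0 (1 - real n * infdist x C) \<partial>M) = (\<integral>x. max 0 (1 - real n * infdist x C) \<partial>N)" for n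
      by (intro eq continuous_intros)
    hence "measure (?D M) C = measure (?D N) C"
      using lim[OF M that False] lim[OF N that False] LIMSEQ_unique by simp
    thus ?thesis by (simp add: DM.emeasure_eq_measure DN.emeasure_eq_measure)
  qed simp
  have sb: "sets (borel :: complex measure) = sigma_sets UNIV (Collect closed)"
    by (subst borel_eq_closed) simp
  have "?D M = ?D N"
  proof (rule measure_eqI_generator_eq[where E="Collect closed" and \<Omega>=UNIV and A="\<lambda>_. UNIV"])
    show "Int_stable (Collect closed :: complex set set)" by (auto simp: Int_stable_def)
  qed (auto simp: cl sb)
  show "M = N"
  proof (rule measure_eqI)
    show "sets M = sets N" using circle_probD(2) M N by simp
    fix A assume A: "A \<in> sets M"
    hence A': "A \<in> sets borel" "A \<subseteq> circle"
      using circle_probD(2)[OF M] by (auto simp: circle_borel_def sets_restrict_space_iff)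
    have "emeasure (?D M) A = emeasure M A" "emeasure (?D N) A = emeasure N A"
      using A' m circle_probD(3)[OF M] circle_probD(3)[OF N] by (auto simp: emeasure_distr vimage_def Int_absorb2)
    thus "emeasure M A = emeasure N A" using \<open>?D M = ?D N\<close> by simp
  qed
qed

text \<open>Equal moments give equal Herglotz transforms, hence equal Poisson smoothings, which
  determine the integrals of continuous functions as s tends to 1. Negative frequencies are
  conjugates of positive ones, and order 0 is the total mass.\<close>

lemma circle_moments_eqI:
  assumes M: "circle_prob M" and N: "circle_prob N"
    and eq: "\<And>n. n > 0 \<Longrightarrow> moment M n = moment N n"
  shows "M = N"
proof (rule circle_prob_eqI[OF M N])
  fix h :: "complex \<Rightarrow> real" assume h: "continuous_on circle h"
  define s where "s n = 1 - 1 / (real n + 2)" for n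
  have s: "0 \<le> s n" "s n < 1" for n by (auto simp: s_def field_simps)
  have sl: "s \<longlonglongrightarrow> 1" unfolding s_def by real_asymp
  have e0: "moment M n = moment N n" for n
    using eq[of n] prob_space.prob_space circle_probD(1) M N by (cases "n = 0") (auto simp: moment_def prob_space.prob_space)
  have "smoothing M (s n) w = smoothing N (s n) w" if "cmod w = 1" for n w
    using herglotz_transform_sums[OF M s that, of n] herglotz_transform_sums[OF N s that, of n]
    unfolding smoothing_def e0 by (rule sums_unique2)
  hence "(\<integral>w. h w * Re (smoothing M (s n) w) \<partial>circle_haar) = (\<integral>w. h w * Re (smoothing N (s n) w) \<partial>circle_haar)" for n
    using circle_probD(3)[OF circle_prob_haar] by (intro Bochner_Integration.integral_cong) auto
  thus "integral\<^sup>L M h = integral\<^sup>L N h"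
    using smoothing_tendsto[OF M h s sl] smoothing_tendsto[OF N h s sl] by (simp add: LIMSEQ_unique)
qed

lemma arc_eq_haar: "arc_measure t = circle_haar"
  by (rule circle_moments_eqI) (simp_all add: circle_prob_arc circle_prob_haar arc_moment haar_moment)

section \<open>Logarithmic energy\<close>

text \<open>The shift by ln 2, the logarithm of the diameter, makes the kernel nonnegative on the
  torus, so that its integral always exists.\<close>

definition log_kernel :: "complex \<times> complex \<Rightarrow> ennreal" where
  "log_kernel p = (if fst p = snd p then \<infinity> else ennreal (ln 2 - ln (cmod (fst p - snd p))))"

text \<open>The termwise integral of -ln |a - b| = Re (sum over n >= 1 of (a cnj b)^n / n); the term
  n = 0 vanishes because division by 0 gives 0. As a sum of nonnegative multiples of squared
  moments, the energy is lower semicontinuous and strictly convex, and it decreases under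
  smoothing.\<close>

definition log_energy :: "complex measure \<Rightarrow> ennreal" where
  "log_energy M = (\<Sum>n. ennreal ((cmod (moment M n))\<^sup>2 / real n))"

lemma log_kernel_measurable:
  assumes "circle_prob M" "circle_prob N"
  shows "log_kernel \<in> borel_measurable (M \<Otimes>\<^sub>M N)"
proof -
  have 1: "(\<lambda>p. fst p - snd p) \<in> borel_measurable (M \<Otimes>\<^sub>M N)"
    by (intro borel_measurable_pair_circle assms continuous_intros)
  have "(\<lambda>z :: complex. if z = 0 then \<infinity> else ennreal (ln 2 - ln (cmod z))) \<in> borel_measurable borel"
    by measurable
  from measurable_compose[OF 1 this] show ?thesis
    by (rule subst[of _ _ "\<lambda>f. f \<in> borel_measurable (M \<Otimes>\<^sub>M N)", rotated]) (auto simp: log_kernel_def fun_eq_iff)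
qed

lemma log_regular_sums:
  assumes M: "circle_prob M" and r: "0 \<le> r" "r < 1"
  shows "(\<lambda>n. r ^ n * ((cmod (moment M n))\<^sup>2 / real n)) sums
           (\<integral>a. \<integral>b. - ln (cmod (b - r * a)) \<partial>M \<partial>M)"
proof -
  \<comment> \<open>For r < 1 the argument of the logarithm has positive real part, so the principal
    branch is continuous and its power series converges absolutely. Real parts are taken only at the
    end.\<close>
  define L where "L = (\<lambda>p :: complex \<times> complex. - Ln (1 - r * (fst p * cnj (snd p))))"
  have re: "Re (1 - of_real r * (a * cnj b)) > 0" if "cmod a = 1" "cmod b = 1" for a b
  proof -
    have "Re (of_real r * (a * cnj b)) \<le> cmod (of_real r * (a * cnj b))" by (rule complex_Re_le_cmod)
    also have "\<dots> < 1" using that r by (simp add: norm_mult)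
    finally show ?thesis by simp
  qed
  have cL: "continuous_on (circle \<times> circle) L"
  proof -
    have "1 - of_real r * (fst p * cnj (snd p)) \<notin> \<real>\<^sub>\<le>\<^sub>0" if "p \<in> circle \<times> circle" for p
      using re[of "fst p" "snd p"] that by (auto simp: complex_nonpos_Reals_iff)
    thus ?thesis unfolding L_def by (intro continuous_intros) auto
  qed
  define c where "c n = complex_of_real (r ^ n / real n)" for n
  have cs: "summable (\<lambda>n. norm (c n))"
  proof (rule summable_comparison_test')
    show "summable (\<lambda>n. r ^ n)" using r by (intro summable_geometric) simp
    show "norm (norm (c n)) \<le> r ^ n" for n
      using r mult_left_mono[of 1 "real n" "r ^ n"]
      by (cases "n = 0") (auto simp: c_def norm_divide norm_power divide_le_eq)
  qed
  have s1: "(\<lambda>n. c n * (a ^ n * cnj b ^ n)) sums L (a, b)" if "cmod a = 1" "cmod b = 1" for a b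
  proof -
    define z where "z = of_real r * (a * cnj b)"
    have "cmod z < 1" using that r by (simp add: z_def norm_mult)
    hence "(\<lambda>n. - (- ((- (- z)) ^ n) / of_nat n)) sums (- Ln (1 + (- z)))"
      by (intro sums_minus Ln_series') simp
    thus ?thesis by (simp add: c_def L_def z_def power_mult_distrib mult_ac)
  qed
  have s2: "(\<lambda>n. c n * (a ^ n * cnj (moment M n))) sums (\<integral>b. L (a, b) \<partial>M)" if a: "cmod a = 1" for a
  proof -
    have "(\<lambda>n. c n * (\<integral>b. a ^ n * cnj b ^ n \<partial>M)) sums (\<integral>b. L (a, b) \<partial>M)"
      using a by (intro circle_integral_suminf[OF M cs] s1) (auto intro!: continuous_intros simp: norm_mult norm_power)
    moreover have "(\<integral>b. a ^ n * cnj b ^ n \<partial>M) = a ^ n * cnj (moment M n)" for n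
      by (simp add: moment_def flip: complex_cnj_power)
    ultimately show ?thesis by (simp only:)
  qed
  have s3: "(\<lambda>n. c n * (\<integral>a. a ^ n * cnj (moment M n) \<partial>M)) sums (\<integral>a. \<integral>b. L (a, b) \<partial>M \<partial>M)"
    using circle_moment_le_1[OF M]
    by (intro circle_integral_suminf[OF M cs] s2) (auto intro!: continuous_intros simp: norm_mult norm_power)
  have "(\<integral>a. a ^ n * cnj (moment M n) \<partial>M) = of_real ((cmod (moment M n))\<^sup>2)" for n
  proof -
    have "(\<integral>a. a ^ n * cnj (moment M n) \<partial>M) = moment M n * cnj (moment M n)"
      unfolding moment_def by (rule integral_mult_left_zero)
    thus ?thesis by (simp only: complex_norm_square)
  qed
  hence "(\<lambda>n. of_real (r ^ n / real n * (cmod (moment M n))\<^sup>2)) sums (\<integral>a. \<integral>b. L (a, b) \<partial>M \<partial>M)"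
    using s3 by (simp add: c_def)
  hence "(\<lambda>n. Re (of_real (r ^ n / real n * (cmod (moment M n))\<^sup>2))) sums Re (\<integral>a. \<integral>b. L (a, b) \<partial>M \<partial>M)"
    by (rule sums_Re)
  hence "(\<lambda>n. r ^ n * ((cmod (moment M n))\<^sup>2 / real n)) sums Re (\<integral>a. \<integral>b. L (a, b) \<partial>M \<partial>M)"
    by simp
  also have "Re (\<integral>a. \<integral>b. L (a, b) \<partial>M \<partial>M) = (\<integral>a. Re (\<integral>b. L (a, b) \<partial>M) \<partial>M)"
    by (intro integral_Re[symmetric] circle_integrable[OF M] continuous_on_circle_integral[OF M cL])
  also have "\<dots> = (\<integral>a. \<integral>b. - ln (cmod (b - r * a)) \<partial>M \<partial>M)"
  proof (rule circle_integral_cong[OF M])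
    fix a :: complex assume a: "cmod a = 1"
    have "Re (\<integral>b. L (a, b) \<partial>M) = (\<integral>b. Re (L (a, b)) \<partial>M)"
      by (intro integral_Re[symmetric] circle_integrable[OF M] continuous_on_circle_section[OF cL] a)
    also have "\<dots> = (\<integral>b. - ln (cmod (b - r * a)) \<partial>M)"
    proof (rule circle_integral_cong[OF M])
      fix b :: complex assume b: "cmod b = 1"
      have "1 - of_real r * (a * cnj b) \<noteq> 0" using re[OF a b] by (metis less_irrefl zero_complex.sel(1))
      hence "Re (L (a, b)) = - ln (cmod (1 - r * (a * cnj b)))" by (simp add: L_def)
      also have "b * (1 - of_real r * (a * cnj b)) = b - r * a"
        using circle_mult_cnj[OF b] by (simp add: algebra_simps)
      hence "cmod (1 - r * (a * cnj b)) = cmod (b - r * a)"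
        using b norm_mult[of b "1 - of_real r * (a * cnj b)"] by simp
      finally show "Re (L (a, b)) = - ln (cmod (b - r * a))" .
    qed
    finally show "Re (\<integral>b. L (a, b) \<partial>M) = (\<integral>b. - ln (cmod (b - r * a)) \<partial>M)" .
  qed
  finally show ?thesis .
qed

lemma log_regular_bound:
  assumes "cmod a = 1" "cmod b = 1" "0 \<le> r" "r < 1"
  shows "0 \<le> ln 2 - ln (cmod (b - of_real r * a))"
proof -
  have "cmod (b - of_real r * a) \<le> cmod b + cmod (of_real r * a)" by (rule norm_triangle_ineq4)
  also have "\<dots> \<le> 2" using assms by (simp add: norm_mult)
  finally show ?thesis using circle_diff_nz[of b a r] assms by (simp add: ln_le_cancel_iff)
qed

lemma nn_integral_log_regular:
  assumes M: "circle_prob M" and r: "0 \<le> r" "r < 1"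
  shows "(\<integral>\<^sup>+p. ennreal (ln 2 - ln (cmod (snd p - of_real r * fst p))) \<partial>(M \<Otimes>\<^sub>M M)) =
     ennreal (ln 2) + (\<Sum>n. ennreal (r ^ n * ((cmod (moment M n))\<^sup>2 / real n)))"
proof -
  interpret pair_prob_space M M by (rule circle_pair_prob[OF M M])
  note sp = circle_probD(3)[OF M]
  have c: "continuous_on (circle \<times> circle) (\<lambda>p. ln (cmod (snd p - of_real r * fst p)))"
    using circle_diff_nz r by (intro continuous_intros) auto
  have nn: "0 \<le> ln 2 - ln (cmod (snd p - of_real r * fst p))" if "p \<in> space (M \<Otimes>\<^sub>M M)" for p
    using that r sp by (intro log_regular_bound) (auto simp: space_pair_measure)
  have "(\<integral>\<^sup>+p. ennreal (ln 2 - ln (cmod (snd p - of_real r * fst p))) \<partial>(M \<Otimes>\<^sub>M M)) =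
     ennreal (\<integral>p. ln 2 - ln (cmod (snd p - of_real r * fst p)) \<partial>(M \<Otimes>\<^sub>M M))"
    by (intro nn_integral_eq_integral circle_pair_integrable[OF M M] continuous_intros c AE_I2 nn)
  also have "(\<integral>p. ln 2 - ln (cmod (snd p - of_real r * fst p)) \<partial>(M \<Otimes>\<^sub>M M)) =
      ln 2 - (\<integral>p. ln (cmod (snd p - of_real r * fst p)) \<partial>(M \<Otimes>\<^sub>M M))"
    using circle_pair_integrable[OF M M c] by (simp add: P.prob_space)
  also have "(\<integral>p. ln (cmod (snd p - of_real r * fst p)) \<partial>(M \<Otimes>\<^sub>M M)) = (\<integral>a. \<integral>b. ln (cmod (b - of_real r * a)) \<partial>M \<partial>M)"
    using circle_Fubini(2)[OF M M c] by simp
  also have "ln 2 - \<dots> = ln 2 + (\<Sum>n. r ^ n * ((cmod (moment M n))\<^sup>2 / real n))"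
    using log_regular_sums[OF M r] by (simp add: sums_iff)
  also have "ennreal \<dots> = ennreal (ln 2) + ennreal (\<Sum>n. r ^ n * ((cmod (moment M n))\<^sup>2 / real n))"
    using log_regular_sums[OF M r] r by (intro ennreal_plus suminf_nonneg) (auto simp: sums_iff)
  also have "ennreal (\<Sum>n. r ^ n * ((cmod (moment M n))\<^sup>2 / real n)) = (\<Sum>n. ennreal (r ^ n * ((cmod (moment M n))\<^sup>2 / real n)))"
    using log_regular_sums[OF M r] r by (intro suminf_ennreal2[symmetric]) (auto simp: sums_iff)
  finally show ?thesis .
qed

text \<open>One inequality is Fatou's lemma along r tending to 1: the regularized kernels converge
  everywhere on the torus, to infinity on the diagonal. For the other, \<open>circle_dist_le\<close>
  bounds a regularized kernel by the true one plus ln 2 - ln (1 + r); cutting the series at N allows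
  r to tend to 1 termwise before N grows.\<close>

theorem nn_integral_log_kernel:
  assumes M: "circle_prob M"
  shows "(\<integral>\<^sup>+p. log_kernel p \<partial>(M \<Otimes>\<^sub>M M)) = ennreal (ln 2) + log_energy M"
proof (rule antisym)
  interpret pair_prob_space M M by (rule circle_pair_prob[OF M M])
  note sp = circle_probD(3)[OF M]
  define r where "r k = 1 - 1 / (real k + 2)" for k
  have r: "0 \<le> r k" "r k < 1" for k by (auto simp: r_def field_simps)
  have rl: "r \<longlonglongrightarrow> 1" unfolding r_def by real_asymp
  define g where "g k p = ennreal (ln 2 - ln (cmod (snd p - of_real (r k) * fst p)))" for k and p :: "complex \<times> complex"
  have gm: "g k \<in> borel_measurable (M \<Otimes>\<^sub>M M)" for k
    unfolding g_def using circle_diff_nz r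
    by (intro borel_measurable_pair_circle[OF M M] continuous_intros continuous_on_ennreal) auto
  have lim: "(\<lambda>k. g k (a, b)) \<longlonglongrightarrow> log_kernel (a, b)" if ab: "cmod a = 1" "cmod b = 1" for a b
  proof (cases "a = b")
    case False
    have "(\<lambda>k. ln 2 - ln (cmod (b - of_real (r k) * a))) \<longlonglongrightarrow> ln 2 - ln (cmod (b - of_real 1 * a))"
      using False by (intro tendsto_intros rl) auto
    thus ?thesis using False by (auto simp: g_def log_kernel_def norm_minus_commute)
  next
    case True
    have "cmod (b - of_real (r k) * b) = 1 - r k" for k
    proof -
      have "b - of_real (r k) * b = of_real (1 - r k) * b" by (simp add: algebra_simps)
      thus ?thesis using ab r[of k] by (simp only: norm_mult norm_of_real) simp
    qed
    hence "g k (a, b) = ennreal (ln 2 - ln (1 - r k))" for k using True by (simp add: g_def)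
    moreover have "filterlim (\<lambda>k. ln 2 - ln (1 - r k)) at_top sequentially"
      unfolding r_def by real_asymp
    hence "(\<lambda>k. ennreal (ln 2 - ln (1 - r k))) \<longlonglongrightarrow> \<infinity>"
      by (simp add: ennreal_tendsto_top_eq_at_top)
    ultimately show ?thesis using True by (simp add: log_kernel_def)
  qed
  have "(\<integral>\<^sup>+p. log_kernel p \<partial>(M \<Otimes>\<^sub>M M)) = (\<integral>\<^sup>+p. liminf (\<lambda>k. g k p) \<partial>(M \<Otimes>\<^sub>M M))"
  proof (intro nn_integral_cong)
    fix p assume "p \<in> space (M \<Otimes>\<^sub>M M)"
    thus "log_kernel p = liminf (\<lambda>k. g k p)"
      using lim[of "fst p" "snd p"] sp by (auto simp: space_pair_measure lim_imp_Liminf)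
  qed
  also have "\<dots> \<le> liminf (\<lambda>k. \<integral>\<^sup>+p. g k p \<partial>(M \<Otimes>\<^sub>M M))"
    by (rule nn_integral_liminf[OF gm])
  also have "\<dots> \<le> liminf (\<lambda>k::nat. ennreal (ln 2) + log_energy M)"
  proof (intro Liminf_mono always_eventually allI)
    fix k
    have "(\<Sum>n. ennreal (r k ^ n * ((cmod (moment M n))\<^sup>2 / real n))) \<le> log_energy M"
      unfolding log_energy_def using r[of k]
      by (intro suminf_le ennreal_leI mult_left_le_one_le) (auto intro: power_le_one)
    thus "(\<integral>\<^sup>+p. g k p \<partial>(M \<Otimes>\<^sub>M M)) \<le> ennreal (ln 2) + log_energy M"
      unfolding g_def nn_integral_log_regular[OF M r] by (intro add_left_mono)
  qed
  also have "\<dots> = ennreal (ln 2) + log_energy M" by (simp add: Liminf_const)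
  finally show "(\<integral>\<^sup>+p. log_kernel p \<partial>(M \<Otimes>\<^sub>M M)) \<le> ennreal (ln 2) + log_energy M" .

  let ?I = "\<integral>\<^sup>+p. log_kernel p \<partial>(M \<Otimes>\<^sub>M M)"
  have fin: "ennreal (ln 2) + (\<Sum>n<N. ennreal ((cmod (moment M n))\<^sup>2 / real n)) \<le> ?I" for N
  proof -
    have "ennreal (ln 2 + (\<Sum>n<N. r k ^ n * ((cmod (moment M n))\<^sup>2 / real n))) \<le> ?I + ennreal (ln 2 - ln (1 + r k))" for k
    proof -
      have "ennreal (ln 2 + (\<Sum>n<N. r k ^ n * ((cmod (moment M n))\<^sup>2 / real n))) =
         ennreal (ln 2) + (\<Sum>n<N. ennreal (r k ^ n * ((cmod (moment M n))\<^sup>2 / real n)))"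
        using r[of k] by (subst ennreal_plus) (auto intro!: sum_nonneg)
      also have "\<dots> \<le> ennreal (ln 2) + (\<Sum>n. ennreal (r k ^ n * ((cmod (moment M n))\<^sup>2 / real n)))"
        by (intro add_left_mono sum_le_suminf) auto
      also have "\<dots> = (\<integral>\<^sup>+p. g k p \<partial>(M \<Otimes>\<^sub>M M))"
        unfolding g_def nn_integral_log_regular[OF M r] ..
      also have "\<dots> \<le> (\<integral>\<^sup>+p. log_kernel p + ennreal (ln 2 - ln (1 + r k)) \<partial>(M \<Otimes>\<^sub>M M))"
      proof (intro nn_integral_mono)
        fix p assume "p \<in> space (M \<Otimes>\<^sub>M M)"
        then obtain a b where p: "p = (a, b)" "cmod a = 1" "cmod b = 1" using sp by (auto simp: space_pair_measure)
        show "g k p \<le> log_kernel p + ennreal (ln 2 - ln (1 + r k))"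
        proof (cases "a = b")
          case False
          have "(1 + r k) * cmod (b - a) \<le> 2 * cmod (b - of_real (r k) * a)"
            using circle_dist_le p r by blast
          hence "ln ((1 + r k) * cmod (b - a)) \<le> ln (2 * cmod (b - of_real (r k) * a))"
            using False r[of k] circle_diff_nz[OF p(3,2) r] by (intro ln_mono mult_pos_pos) auto
          hence 1: "ln (1 + r k) + ln (cmod (b - a)) \<le> ln 2 + ln (cmod (b - of_real (r k) * a))"
            using False r[of k] circle_diff_nz[OF p(3,2) r] by (simp add: ln_mult)
          have 2: "0 \<le> ln 2 - ln (cmod (a - b))"
          proof -
            have "cmod (a - b) \<le> 2" using norm_triangle_ineq4[of a b] p by simp
            thus ?thesis using False by (simp add: ln_le_cancel_iff)
          qed
          have 3: "0 \<le> ln 2 - ln (1 + r k)" using r[of k] by (simp add: ln_le_cancel_iff)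
          show ?thesis using False 1 unfolding p g_def log_kernel_def
            by (auto simp: ennreal_plus[symmetric, OF 2 3] norm_minus_commute simp del: ennreal_plus intro!: ennreal_leI)
        qed (simp add: p log_kernel_def)
      qed
      also have "\<dots> = ?I + ennreal (ln 2 - ln (1 + r k))"
        by (subst nn_integral_add) (auto simp: log_kernel_measurable[OF M M] P.emeasure_space_1)
      finally show ?thesis .
    qed
    moreover have "(\<lambda>k. ennreal (ln 2 + (\<Sum>n<N. r k ^ n * ((cmod (moment M n))\<^sup>2 / real n)))) \<longlonglongrightarrow>
        ennreal (ln 2 + (\<Sum>n<N. 1 ^ n * ((cmod (moment M n))\<^sup>2 / real n)))"
      by (intro tendsto_intros rl tendsto_ennrealI)
    moreover have "(\<lambda>k. ?I + ennreal (ln 2 - ln (1 + r k))) \<longlonglongrightarrow> ?I + ennreal (ln 2 - ln (1 + 1))"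
      by (intro tendsto_intros rl tendsto_ennrealI) auto
    ultimately have "ennreal (ln 2 + (\<Sum>n<N. 1 ^ n * ((cmod (moment M n))\<^sup>2 / real n))) \<le> ?I + ennreal (ln 2 - ln (1 + 1))"
      by (intro LIMSEQ_le) auto
    moreover have "ennreal (ln 2 + (\<Sum>n<N. 1 ^ n * ((cmod (moment M n))\<^sup>2 / real n))) =
       ennreal (ln 2) + (\<Sum>n<N. ennreal ((cmod (moment M n))\<^sup>2 / real n))"
      by (subst ennreal_plus) (auto intro!: sum_nonneg)
    ultimately show ?thesis by simp
  qed
  have "(\<lambda>N. ennreal (ln 2) + (\<Sum>n<N. ennreal ((cmod (moment M n))\<^sup>2 / real n))) \<longlonglongrightarrow> ennreal (ln 2) + log_energy M"
    unfolding log_energy_def by (intro tendsto_intros summable_LIMSEQ) auto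
  thus "ennreal (ln 2) + log_energy M \<le> ?I"
    by (rule LIMSEQ_le_const2) (use fin in auto)
qed

lemma energy_eq:
  assumes M: "circle_prob M"
  shows "energy Q M = ereal (\<integral>x. Q x \<partial>M) + enn2ereal (log_energy M)"
proof -
  interpret pair_prob_space M M by (rule circle_pair_prob[OF M M])
  note sp = circle_probD(3)[OF M]
  let ?P = "M \<Otimes>\<^sub>M M"
  let ?f = "\<lambda>p. log_dist (fst p) (snd p)"
  have m1: "(\<lambda>p. fst p - snd p) \<in> borel_measurable ?P"
    by (intro borel_measurable_pair_circle[OF M M] continuous_intros)
  have "(\<lambda>z :: complex. if z = 0 then - \<infinity> else ereal (ln (cmod z))) \<in> borel_measurable borel"
    by measurable
  from measurable_compose[OF m1 this] have m: "?f \<in> borel_measurable ?P"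
    by (rule subst[of _ _ "\<lambda>f. f \<in> borel_measurable ?P", rotated]) (auto simp: log_dist_def fun_eq_iff)
  define p where "p = (\<integral>\<^sup>+x. e2ennreal (?f x) \<partial>?P)"
  define q where "q = (\<integral>\<^sup>+x. e2ennreal (- ?f x) \<partial>?P)"
  have le2: "ln (cmod (a - b)) \<le> ln 2" if "a \<noteq> b" "cmod a = 1" "cmod b = 1" for a b
    using norm_triangle_ineq4[of a b] that by (simp add: ln_le_cancel_iff)
  have "p \<le> (\<integral>\<^sup>+x. ennreal (ln 2) \<partial>?P)"
    unfolding p_def
  proof (intro nn_integral_mono)
    fix x assume "x \<in> space ?P"
    thus "e2ennreal (?f x) \<le> ennreal (ln 2)"
      using le2[of "fst x" "snd x"] sp
      by (auto simp: space_pair_measure log_dist_def e2ennreal_neg ennreal_leI simp flip: ennreal.abs_eq)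
  qed
  also have "\<dots> < \<infinity>" by (simp add: P.emeasure_space_1)
  finally have p: "p < \<infinity>" .
  \<comment> \<open>Pointwise, the shifted kernel plus the positive part of the logarithm equals ln
    2 plus its negative part. Integrating this identity and cancelling ln 2 avoids any subtraction
    of possibly infinite integrals.\<close>
  have "(\<integral>\<^sup>+x. log_kernel x \<partial>?P) + p = (\<integral>\<^sup>+x. log_kernel x + e2ennreal (?f x) \<partial>?P)"
    unfolding p_def using m log_kernel_measurable[OF M M] by (subst nn_integral_add) auto
  also have "\<dots> = (\<integral>\<^sup>+x. ennreal (ln 2) + e2ennreal (- ?f x) \<partial>?P)"
  proof (intro nn_integral_cong)
    fix x assume "x \<in> space ?P"
    then obtain a b where x: "x = (a, b)" "cmod a = 1" "cmod b = 1" using sp by (auto simp: space_pair_measure)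
    show "log_kernel x + e2ennreal (?f x) = ennreal (ln 2) + e2ennreal (- ?f x)"
    proof (cases "a = b")
      case False
      define t where "t = ln (cmod (a - b))"
      have "t \<le> ln 2" using le2[OF False x(2,3)] by (simp add: t_def)
      hence "ennreal (ln 2 - t) + ennreal t = ennreal (ln 2) + ennreal (- t)"
        by (cases "t \<ge> 0") (simp_all add: ennreal_neg ennreal_plus[symmetric] del: ennreal_plus)
      thus ?thesis using False by (simp add: x log_kernel_def log_dist_def t_def e2ennreal_ereal)
    qed (simp add: x log_kernel_def log_dist_def e2ennreal_neg)
  qed
  also have "\<dots> = ennreal (ln 2) + q"
    unfolding q_def using m by (subst nn_integral_add) (auto simp: P.emeasure_space_1)
  finally have "ennreal (ln 2) + (log_energy M + p) = ennreal (ln 2) + q"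
    by (simp add: nn_integral_log_kernel[OF M] add.assoc)
  hence q: "q = log_energy M + p" by simp
  have "ereal_integral ?P (\<lambda>(x, y). log_dist x y) = enn2ereal p - enn2ereal q"
    by (simp add: ereal_integral_def p_def q_def case_prod_beta)
  also have "\<dots> = - enn2ereal (log_energy M)"
    using p unfolding q by (cases p; cases "log_energy M") (auto simp: plus_ennreal.rep_eq)
  finally show ?thesis unfolding energy_def by (cases "enn2ereal (log_energy M)") auto
qed

text \<open>An atom would charge a point of the diagonal, where the kernel is infinite. Absence of
  atoms is what makes lifts with a prescribed mean unique and lets the means of two lifts be
  matched.\<close>

lemma finite_log_energy_atomless:
  assumes M: "circle_prob M" and fin: "log_energy M < \<infinity>" and z: "cmod z = 1"
  shows "emeasure M {z} = 0"
proof (rule ccontr)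
  assume nz: "emeasure M {z} \<noteq> 0"
  interpret pair_prob_space M M by (rule circle_pair_prob[OF M M])
  have zs: "{z} \<in> sets M"
    using z circle_probD(2)[OF M] by (auto simp: circle_borel_def sets_restrict_space_iff)
  have "\<infinity> = \<infinity> * (emeasure M {z} * emeasure M {z})"
    using nz by (simp add: ennreal_top_mult)
  also have "emeasure M {z} * emeasure M {z} = emeasure (M \<Otimes>\<^sub>M M) ({z} \<times> {z})"
    using zs
    by (intro sigma_finite_measure.emeasure_pair_measure_Times[symmetric] prob_space_imp_sigma_finite circle_probD(1)[OF M])
  also have "\<infinity> * \<dots> = (\<integral>\<^sup>+p. \<infinity> * indicator ({z} \<times> {z}) p \<partial>(M \<Otimes>\<^sub>M M))"
    using zs by (intro nn_integral_cmult_indicator[symmetric] pair_measureI)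
  also have "\<dots> \<le> (\<integral>\<^sup>+p. log_kernel p \<partial>(M \<Otimes>\<^sub>M M))"
    by (intro nn_integral_mono) (auto simp: log_kernel_def split: split_indicator)
  also have "\<dots> < \<infinity>" using fin by (simp add: nn_integral_log_kernel[OF M])
  finally show False by simp
qed

section \<open>Poisson smoothing of a measure\<close>

lemma circle_deriv_cong:
  assumes "\<And>w. cmod w = 1 \<Longrightarrow> f w = g w" "cmod z = 1"
  shows "circle_deriv f z = circle_deriv g z"
proof -
  have "(\<lambda>t. f (z * cis t)) = (\<lambda>t. g (z * cis t))" using assms by (auto simp: norm_mult fun_eq_iff)
  thus ?thesis by (simp add: circle_deriv_def)
qed

text \<open>The angular derivative of Re g is the real part of i w g'(w), which is holomorphic on
  the same disc. The class is therefore closed under \<open>circle_deriv\<close>, and induction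
  gives all orders.\<close>

lemma circle_smooth_Re_holomorphic:
  assumes f: "f holomorphic_on ball 0 R" and R: "R > 1"
    and eq: "\<And>w. cmod w = 1 \<Longrightarrow> \<phi> w = Re (f w)"
  shows "circle_smooth \<phi>"
proof -
  have der: "((\<lambda>t. Re (g (z * cis t))) has_real_derivative Re (\<i> * z * deriv g z)) (at 0)"
    if g: "g holomorphic_on ball 0 R" and z: "cmod z = 1" for g z
  proof -
    have c: "((\<lambda>t. z * cis t) has_vector_derivative (z * \<i>)) (at 0)"
    proof -
      have "((\<lambda>t. z * exp (\<i> * of_real t)) has_vector_derivative (z * \<i>)) (at 0)"
        by (rule has_vector_derivative_real_field) (auto intro!: derivative_eq_intros)
      thus ?thesis by (simp add: cis_conv_exp)
    qed
    have "(g has_field_derivative deriv g (z * cis 0)) (at (z * cis 0))"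
      using holomorphic_derivI[OF g open_ball, of z] z R by simp
    hence "((\<lambda>t. g (z * cis t)) has_vector_derivative (z * \<i> * deriv g (z * cis 0))) (at 0)"
      using field_vector_diff_chain_at[OF c] by (simp add: o_def)
    hence "((\<lambda>t. Re (g (z * cis t))) has_vector_derivative Re (z * \<i> * deriv g z)) (at 0)"
      using bounded_linear.has_vector_derivative[OF bounded_linear_Re] by fastforce
    thus ?thesis by (simp add: has_real_derivative_iff_has_vector_derivative mult_ac)
  qed
  have "\<exists>g. g holomorphic_on ball 0 R \<and> (\<forall>w. cmod w = 1 \<longrightarrow> (circle_deriv ^^ k) \<phi> w = Re (g w))" for k
  proof (induction k)
    case 0
    thus ?case using f eq by auto
  next
    case (Suc k)
    then obtain g where g: "g holomorphic_on ball 0 R"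
      "\<And>w. cmod w = 1 \<Longrightarrow> (circle_deriv ^^ k) \<phi> w = Re (g w)" by blast
    have "(circle_deriv ^^ Suc k) \<phi> w = Re (\<i> * w * deriv g w)" if w: "cmod w = 1" for w
    proof -
      have "(circle_deriv ^^ Suc k) \<phi> w = circle_deriv (\<lambda>w. Re (g w)) w"
        using circle_deriv_cong[OF g(2) w] by simp
      also have "\<dots> = Re (\<i> * w * deriv g w)"
        unfolding circle_deriv_def by (rule DERIV_imp_deriv[OF der[OF g(1) w]])
      finally show ?thesis .
    qed
    moreover have "(\<lambda>w. \<i> * w * deriv g w) holomorphic_on ball 0 R"
      by (intro holomorphic_intros g) auto
    ultimately show ?case by blast
  qed
  thus ?thesis unfolding circle_smooth_def circle_differentiable_def
  proof (intro allI ballI)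
    fix k and z :: complex assume z: "z \<in> circle"
    obtain g where g: "g holomorphic_on ball 0 R"
      "\<And>w. cmod w = 1 \<Longrightarrow> (circle_deriv ^^ k) \<phi> w = Re (g w)"
      using \<open>\<And>k. \<exists>g. g holomorphic_on ball 0 R \<and> (\<forall>w. cmod w = 1 \<longrightarrow> (circle_deriv ^^ k) \<phi> w = Re (g w))\<close>[of k]
      by blast
    have "(\<lambda>t. (circle_deriv ^^ k) \<phi> (z * cis t)) = (\<lambda>t. Re (g (z * cis t)))"
      using g(2) z by (auto simp: norm_mult)
    thus "(\<lambda>t. (circle_deriv ^^ k) \<phi> (z * cis t)) differentiable at 0"
      using der[OF g(1), of z] z by (auto simp: real_differentiable_def)
  qed
qed

text \<open>Moments are bounded by 1, so the power series of the Herglotz transform converges for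
  |w| < 1 / s, a disc that contains the unit circle in its interior.\<close>

lemma circle_smooth_smoothing:
  assumes M: "circle_prob M" and s: "0 < s" "s < 1"
  shows "circle_smooth (\<lambda>w. Re (smoothing M s w))"
proof -
  define c where "c n = (if n = 0 then 1 else 2 * complex_of_real s ^ n) * cnj (moment M n)" for n
  have sm: "summable (\<lambda>n. c n * z ^ n)" if z: "z \<in> ball 0 (1 / s)" for z
  proof (rule summable_comparison_test')
    have "s * cmod z < 1" using z s by (simp add: field_simps)
    thus "summable (\<lambda>n. 2 * (s * cmod z) ^ n)"
      using s by (intro summable_mult summable_geometric) simp
    show "norm (c n * z ^ n) \<le> 2 * (s * cmod z) ^ n" for n
    proof -
      have "cmod (c n) \<le> (2 * s ^ n) * 1"
        unfolding c_def norm_mult using circle_moment_le_1[OF M, of n] s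
        by (intro mult_mono) (auto simp: norm_mult norm_power)
      hence "cmod (c n) * cmod z ^ n \<le> 2 * s ^ n * cmod z ^ n" by (intro mult_right_mono) auto
      thus ?thesis by (simp add: norm_mult norm_power power_mult_distrib mult_ac)
    qed
  qed
  have "(\<lambda>z. \<Sum>n. c n * z ^ n) holomorphic_on ball 0 (1 / s)"
  proof (rule power_series_holomorphic)
    fix w :: complex assume "w \<in> ball 0 (1 / s)"
    thus "(\<lambda>n. c n * (w - 0) ^ n) sums (\<Sum>n. c n * w ^ n)" using sm[of w] by (simp add: summable_sums)
  qed
  moreover have "smoothing M s w = (\<Sum>n. c n * w ^ n)" if "cmod w = 1" for w
    using herglotz_transform_sums[OF M _ s(2) that] s
    by (simp add: smoothing_def c_def sums_iff mult_ac)
  ultimately show ?thesis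
    using s by (intro circle_smooth_Re_holomorphic[of _ "1 / s"]) auto
qed

definition smoothed :: "complex measure \<Rightarrow> real \<Rightarrow> complex measure" where
  "smoothed M s = density circle_haar (\<lambda>w. ennreal (Re (smoothing M s w)))"

lemma Re_smoothing_measurable:
  assumes M: "circle_prob M" and s: "0 \<le> s" "s < 1"
  shows "(\<lambda>w. Re (smoothing M s w)) \<in> borel_measurable circle_haar"
  by (intro borel_measurable_circle[OF circle_prob_haar] continuous_intros M s)

lemma AE_haar_circle: "AE w in circle_haar. cmod w = 1"
  using circle_probD(3)[OF circle_prob_haar] by (intro AE_I2) auto

lemma integral_smoothed:
  fixes h :: "complex \<Rightarrow> 'b::{banach,second_countable_topology}"
  assumes M: "circle_prob M" and s: "0 \<le> s" "s < 1" and h: "continuous_on circle h"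
  shows "(\<integral>w. h w \<partial>smoothed M s) = (\<integral>w. Re (smoothing M s w) *\<^sub>R h w \<partial>circle_haar)"
  unfolding smoothed_def
proof (rule integral_density)
  show "AE w in circle_haar. 0 \<le> Re (smoothing M s w)"
    using AE_haar_circle by eventually_elim (auto intro: Re_smoothing_nonneg M s)
qed (intro Re_smoothing_measurable borel_measurable_circle[OF circle_prob_haar] M s h)+

lemma integral_smoothed_real:
  fixes h :: "complex \<Rightarrow> real"
  assumes M: "circle_prob M" and s: "0 \<le> s" "s < 1" and h: "continuous_on circle h"
  shows "(\<integral>w. h w \<partial>smoothed M s) = (\<integral>w. h w * Re (smoothing M s w) \<partial>circle_haar)"
  using integral_smoothed[OF assms] by (simp add: mult.commute)

lemma circle_prob_smoothed:
  assumes M: "circle_prob M" and s: "0 \<le> s" "s < 1"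
  shows "circle_prob (smoothed M s)"
  unfolding circle_prob_def
proof
  show "sets (smoothed M s) = sets circle_borel"
    using circle_probD(2)[OF circle_prob_haar] by (simp add: smoothed_def)
  interpret prob_space M using circle_probD(1)[OF M] .
  show "prob_space (smoothed M s)"
  proof
    have "emeasure (smoothed M s) (space (smoothed M s)) = (\<integral>\<^sup>+w. ennreal (Re (smoothing M s w)) \<partial>circle_haar)"
      using Re_smoothing_measurable[OF M s]
      by (auto simp: smoothed_def emeasure_density intro!: nn_integral_cong)
    also have "\<dots> = ennreal (\<integral>w. Re (smoothing M s w) \<partial>circle_haar)"
    proof (rule nn_integral_eq_integral)
      show "AE w in circle_haar. 0 \<le> Re (smoothing M s w)"
        using AE_haar_circle by eventually_elim (auto intro: Re_smoothing_nonneg M s)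
    qed (intro circle_integrable[OF circle_prob_haar] continuous_intros M s)
    also have "(\<integral>w. Re (smoothing M s w) \<partial>circle_haar) = (\<integral>a. \<integral>w. poisson s w a \<partial>circle_haar \<partial>M)"
      using poisson_duality[OF M s, of "\<lambda>_. 1"] by simp
    also have "\<dots> = (\<integral>a. 1 \<partial>M)"
      by (rule circle_integral_cong[OF M]) (simp add: haar_poisson s)
    finally show "emeasure (smoothed M s) (space (smoothed M s)) = 1" by (simp add: prob_space)
  qed
qed

lemma smooth_density_smoothed:
  assumes "circle_prob M" "0 < s" "s < 1"
  shows "smooth_density (smoothed M s) (\<lambda>w. Re (smoothing M s w))"
  using assms unfolding smooth_density_def
  by (auto simp: smoothed_def intro!: circle_smooth_smoothing Re_smoothing_nonneg)

lemma smooth_circle_prob_smoothed: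
  assumes "circle_prob M" "0 < s" "s < 1"
  shows "smooth_circle_prob (smoothed M s)"
  unfolding smooth_circle_prob_def using assms smooth_density_smoothed circle_prob_smoothed by force

lemma moment_smoothed:
  assumes M: "circle_prob M" and s: "0 \<le> s" "s < 1"
  shows "moment (smoothed M s) n = of_real s ^ n * moment M n"
proof -
  have c: "continuous_on (circle \<times> circle) (\<lambda>(w, a). w ^ n * of_real (poisson s w a))"
    unfolding case_prod_beta by (intro continuous_intros s) auto
  have "moment (smoothed M s) n = (\<integral>w. Re (smoothing M s w) *\<^sub>R w ^ n \<partial>circle_haar)"
    unfolding moment_def by (intro integral_smoothed M s continuous_intros)
  also have "\<dots> = (\<integral>w. \<integral>a. w ^ n * of_real (poisson s w a) \<partial>M \<partial>circle_haar)"
    using circle_probD(3)[OF circle_prob_haar]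
    by (intro Bochner_Integration.integral_cong)
       (auto simp: Re_smoothing[OF M s] scaleR_conv_of_real mult.commute)
  also have "\<dots> = (\<integral>a. \<integral>w. w ^ n * of_real (poisson s w a) \<partial>circle_haar \<partial>M)"
    using circle_Fubini(1)[OF circle_prob_haar M c] by simp
  also have "\<dots> = (\<integral>a. of_real s ^ n * a ^ n \<partial>M)"
    by (rule circle_integral_cong[OF M]) (simp add: haar_poisson_moment s)
  finally show ?thesis by (simp add: moment_def)
qed

section \<open>The Hilbert transform of a smoothed measure\<close>

text \<open>The ratio of the sum to the difference of two points of the circle is -i times the
  cotangent of half the angle between them. This is how the kernel of the Hilbert transform enters
  the algebra of Herglotz kernels.\<close>

lemma cis_cot:
  assumes "sin ((x - y) / 2) \<noteq> 0"
  shows "(cis x + cis y) = - \<i> * of_real (cot ((x - y) / 2)) * (cis x - cis y)"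
proof -
  define u v where "u = (x + y) / 2" and "v = (x - y) / 2"
  have xy: "x = u + v" "y = u - v" by (simp_all add: u_def v_def field_simps)
  have "sin v \<noteq> 0" using assms by (simp add: v_def)
  thus ?thesis unfolding v_def[symmetric] unfolding xy
    by (simp add: complex_eq_iff cos_add sin_add cos_diff sin_diff cot_def field_simps)
qed

text \<open>Over a common denominator, the product of the two kernels minus 1 has numerator 2 s a
  (cis x + cis y), and their difference has numerator 2 s a (cis x - cis y). The quotient of the two
  is given by \<open>cis_cot\<close>.\<close>

lemma herglotz_product_left:
  assumes a: "cmod a = 1" and s: "0 \<le> s" "s < 1" and nz: "sin ((x - y) / 2) \<noteq> 0"
  shows "Im (herglotz s (cis x) a * herglotz s (cis y) a) =
           cot ((x - y) / 2) * (poisson s (cis y) a - poisson s (cis x) a)"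
proof -
  define C where "C = cot ((x - y) / 2)"
  have n: "a - s * cis x \<noteq> 0" "a - s * cis y \<noteq> 0" using circle_diff_nz a s by auto
  have "herglotz s (cis x) a * herglotz s (cis y) a - 1 = 2 * s * a * (cis x + cis y) / ((a - s * cis x) * (a - s * cis y))"
    using n unfolding herglotz_def by (simp add: divide_simps) (simp add: algebra_simps)
  also have "\<dots> = - \<i> * of_real C * (2 * s * a * (cis x - cis y) / ((a - s * cis x) * (a - s * cis y)))"
    unfolding cis_cot[OF nz] C_def by (simp add: mult_ac)
  also have "2 * s * a * (cis x - cis y) / ((a - s * cis x) * (a - s * cis y)) = herglotz s (cis x) a - herglotz s (cis y) a"
    using n unfolding herglotz_def by (simp add: divide_simps) (simp add: algebra_simps)
  finally have "Im (herglotz s (cis x) a * herglotz s (cis y) a - 1) = Im (- \<i> * of_real C * (herglotz s (cis x) a - herglotz s (cis y) a))"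
    by simp
  thus ?thesis by (simp add: C_def algebra_simps)
qed

text \<open>Conjugating with \<open>herglotz_commute\<close> moves the formula to the second
  variable and flips the sign. The first version serves the Hilbert transform of the smoothed
  density, this one the variation of the energy.\<close>

lemma herglotz_product_right:
  assumes w: "cmod w = 1" and s: "0 \<le> s" "s < 1" and nz: "sin ((x - y) / 2) \<noteq> 0"
  shows "Im (herglotz s w (cis x) * herglotz s w (cis y)) =
           cot ((x - y) / 2) * (poisson s w (cis x) - poisson s w (cis y))"
proof -
  have "herglotz s w (cis x) * herglotz s w (cis y) = cnj (herglotz s (cis x) w * herglotz s (cis y) w)"
    using herglotz_commute[of w "cis x" s] herglotz_commute[of w "cis y" s] w s by simp
  hence "Im (herglotz s w (cis x) * herglotz s w (cis y)) = - Im (herglotz s (cis x) w * herglotz s (cis y) w)"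
    by simp
  also have "\<dots> = cot ((x - y) / 2) * (poisson s (cis x) w - poisson s (cis y) w)"
    unfolding herglotz_product_left[OF assms] by (simp add: algebra_simps)
  also have "\<dots> = cot ((x - y) / 2) * (poisson s w (cis x) - poisson s w (cis y))"
    using herglotz_commute[of w "cis x" s] herglotz_commute[of w "cis y" s] w s by simp
  finally show ?thesis .
qed

text \<open>A smooth density is only assumed differentiable along the circle. It is continuous as a
  function of the angle, and measurability follows by composing with a measurable branch of the
  argument.\<close>

lemma circle_smooth_measurable:
  assumes "circle_smooth m" "circle_prob M"
  shows "m \<in> borel_measurable M"
proof -
  have d: "circle_differentiable m" using assms(1) unfolding circle_smooth_def by (metis funpow_0)
  have "isCont (\<lambda>t. m (cis t)) x" for x
  proof -
    have "(\<lambda>t. m (cis x * cis t)) differentiable at 0"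
      using d by (auto simp: circle_differentiable_def)
    hence "isCont (\<lambda>t. m (cis x * cis t)) 0" by (rule differentiable_imp_continuous_within)
    hence "isCont (\<lambda>t. m (cis (t + x))) 0" by (simp add: cis_mult add.commute)
    hence "isCont (\<lambda>u. m (cis (u - x + x))) x"
      by (intro isCont_o2[where f="\<lambda>u. u - x" and g="\<lambda>t. m (cis (t + x))"]) (auto intro!: continuous_intros)
    thus ?thesis by simp
  qed
  hence "continuous_on UNIV (\<lambda>t. m (cis t))" by (simp add: continuous_at_imp_continuous_on)
  hence 1: "(\<lambda>t. m (cis t)) \<in> borel_measurable borel" by (rule borel_measurable_continuous_onI)
  have 2: "(\<lambda>z. z) \<in> borel_measurable M" using assms by (intro borel_measurable_circle continuous_intros)
  have "(\<lambda>z. m (cis (Arg2pi z))) \<in> borel_measurable M"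
    using measurable_compose[OF measurable_compose[OF 2 measurable_Arg2pi] 1] .
  moreover have "m (cis (Arg2pi z)) = m z" if "z \<in> space M" for z
    using Arg2pi_eq[of z] that circle_probD(3)[OF assms(2)] by (simp add: cis_conv_exp)
  ultimately show ?thesis by (simp cong: measurable_cong)
qed

text \<open>The Hilbert transform is defined through an arbitrarily chosen density; agreement almost
  everywhere lets the Poisson density replace it under the integral.\<close>

lemma smooth_density_AE_unique:
  assumes "smooth_density M m" "smooth_density M m'"
  shows "AE w in circle_haar. m w = m' w"
proof -
  have "density circle_haar (\<lambda>z. ennreal (m z)) = density circle_haar (\<lambda>z. ennreal (m' z))"
    using assms by (simp add: smooth_density_def)
  moreover have "(\<lambda>z. ennreal (m z)) \<in> borel_measurable circle_haar" "(\<lambda>z. ennreal (m' z)) \<in> borel_measurable circle_haar"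
    using assms circle_smooth_measurable[OF _ circle_prob_haar] by (auto simp: smooth_density_def)
  ultimately have "AE w in circle_haar. ennreal (m w) = ennreal (m' w)"
    using sigma_finite_measure.density_unique_iff[OF prob_space_imp_sigma_finite[OF circle_probD(1)[OF circle_prob_haar]]]
    by blast
  thus ?thesis using AE_haar_circle
    by eventually_elim (use assms in \<open>auto simp: smooth_density_def\<close>)
qed

lemma AE_haar_arc:
  assumes "AE w in circle_haar. P w"
  shows "AE y in lborel. t \<le> y \<and> y < t + 2 * pi \<longrightarrow> P (cis y)"
proof -
  have "AE w in arc_measure t. P w" by (subst arc_eq_haar) (rule assms)
  hence "AE y in uniform_measure lborel {t..<t + 2 * pi}. P (cis y)"
    unfolding arc_measure_def by (rule AE_distrD[rotated]) simp
  thus ?thesis by (subst (asm) AE_uniform_measure) auto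
qed

text \<open>The product formula, averaged over M, shows that cot ((x - y) / 2) (p(cis y) - p(z))
  extends to a continuous function of \<open>cis y\<close>. The remaining multiple of the cotangent
  integrates to 0 over each truncated symmetric period, so the principal value is the Haar mean of
  that function. Since the Herglotz kernel has Haar mean 1 in w, this mean is the imaginary part of
  the Herglotz transform at z.\<close>

lemma hilbert_smoothed:
  assumes M: "circle_prob M" and s: "0 < s" "s < 1" and z: "cmod z = 1"
  shows "hilbert (smoothed M s) z = Im (smoothing M s z)"
proof -
  define x where "x = Arg z"
  have zx: "z = cis x" using z cis_Arg[of z] by (cases "z = 0") (simp_all add: x_def sgn_div_norm)
  define m where "m = density_of (smoothed M s)"
  define p where "p w = Re (smoothing M s w)" for w
  have s0: "0 \<le> s" using s by simp
  define \<Psi> where "\<Psi> w = (\<integral>a. Im (herglotz s z a * herglotz s w a) \<partial>M)" for w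
  have c2: "continuous_on (circle \<times> circle) (\<lambda>(w, a). Im (herglotz s z a * herglotz s w a))"
    unfolding case_prod_beta using s0 s z by (intro continuous_intros) auto
  have c\<Psi>: "continuous_on circle \<Psi>"
    using continuous_on_circle_integral[OF M c2] by (simp add: \<Psi>_def)
  have cp: "continuous_on circle p" unfolding p_def by (intro continuous_intros M s0 s)
  have comp: "continuous_on S (\<lambda>y. f (cis y))" if "continuous_on circle f" for f :: "complex \<Rightarrow> real" and S :: "real set"
    by (rule continuous_on_compose2[OF that]) (auto intro!: continuous_intros)
  have \<Psi>: "cot ((x - y) / 2) * (p (cis y) - p z) = \<Psi> (cis y)" if "sin ((x - y) / 2) \<noteq> 0" for y
  proof -
    have i: "integrable M (\<lambda>a. poisson s (cis y) a)" "integrable M (\<lambda>a. poisson s z a)"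
      using s0 s z by (intro circle_integrable[OF M] continuous_intros; simp)+
    have "\<Psi> (cis y) = (\<integral>a. cot ((x - y) / 2) * (poisson s (cis y) a - poisson s z a) \<partial>M)"
      unfolding \<Psi>_def zx using circle_probD(3)[OF M] s0 s that
      by (intro Bochner_Integration.integral_cong refl herglotz_product_left) auto
    also have "\<dots> = cot ((x - y) / 2) * (p (cis y) - p z)"
      using i z by (simp add: p_def Re_smoothing[OF M s0 s(2)])
    finally show ?thesis by simp
  qed
  have sin0: "sin ((x - y) / 2) \<noteq> 0" if "y \<noteq> x" "\<bar>x - y\<bar> \<le> pi" for y
  proof (cases "x > y")
    case True
    hence "sin ((x - y) / 2) > 0" using that pi_gt_zero by (intro sin_gt_zero) auto
    thus ?thesis by simp
  next
    case False
    hence "sin ((y - x) / 2) > 0" using that pi_gt_zero by (intro sin_gt_zero) auto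
    moreover have "sin ((x - y) / 2) = - sin ((y - x) / 2)" by (simp add: sin_minus[symmetric] minus_divide_left del: sin_minus)
    ultimately show ?thesis by simp
  qed
  define S where "S e = {y. e \<le> \<bar>x - y\<bar> \<and> \<bar>x - y\<bar> \<le> pi}" for e
  have Scl: "compact (S e)" for e
  proof -
    have "S e = {y. e \<le> \<bar>x - y\<bar>} \<inter> cball x pi" by (auto simp: S_def dist_real_def)
    moreover have "closed {y. e \<le> \<bar>x - y\<bar>}" by (intro closed_Collect_le continuous_intros)
    ultimately show ?thesis by (simp add: closed_Int_compact)
  qed
  have Sm: "S e \<in> sets borel" for e using Scl by (simp add: borel_compact)
  have mp: "AE y in lborel. y \<in> S e \<longrightarrow> m (cis y) = p (cis y)" for e
  proof -
    have "smooth_density (smoothed M s) m"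
      unfolding m_def density_of_def using smooth_density_smoothed[OF M s] by (rule someI[where P="smooth_density (smoothed M s)"])
    hence "AE w in circle_haar. m w = p w"
      using smooth_density_smoothed[OF M s] smooth_density_AE_unique unfolding p_def by blast
    from AE_haar_arc[OF this, of "x - pi"] AE_lborel_singleton[of "x + pi"] show ?thesis
      by eventually_elim (auto simp: S_def abs_le_iff)
  qed
  have key: "(LBINT y:{y. e \<le> \<bar>x - y\<bar> \<and> \<bar>x - y\<bar> \<le> pi}. cot ((x - y) / 2) * m (cis y) / (2 * pi)) =
     (LBINT y:S e. \<Psi> (cis y) / (2 * pi))" if e: "e > 0" for e
  proof -
    have nz: "sin ((x - y) / 2) \<noteq> 0" if "y \<in> S e" for y
      using sin0[of y] that e by (cases "y = x") (auto simp: S_def)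
    have cc: "continuous_on (S e) (\<lambda>y. cot ((x - y) / 2))"
      unfolding cot_def using nz by (intro continuous_intros) auto
    have "(LBINT y:S e. cot ((x - y) / 2) * m (cis y) / (2 * pi)) = (LBINT y:S e. cot ((x - y) / 2) * p (cis y) / (2 * pi))"
    proof (rule set_lebesgue_integral_cong_AE)
      have sm: "circle_smooth m"
      proof -
        have "smooth_density (smoothed M s) m"
          unfolding m_def density_of_def using smooth_density_smoothed[OF M s] by (rule someI[where P="smooth_density (smoothed M s)"])
        thus ?thesis by (simp add: smooth_density_def)
      qed
      have "m \<in> borel_measurable circle_borel" "p \<in> borel_measurable circle_borel"
        using circle_smooth_measurable[OF sm circle_prob_haar] borel_measurable_circle[OF circle_prob_haar cp]
          circle_prob_measurable[OF circle_prob_haar] by blast+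
      from this[THEN measurable_compose[OF measurable_cis_circle]]
      have [measurable]: "(\<lambda>y. m (cis y)) \<in> borel_measurable borel" "(\<lambda>y. p (cis y)) \<in> borel_measurable borel" .
      have [measurable]: "(\<lambda>y. cot ((x - y) / 2)) \<in> borel_measurable borel"
        unfolding cot_def by measurable
      show "(\<lambda>y. cot ((x - y) / 2) * m (cis y) / (2 * pi)) \<in> borel_measurable lborel"
        "(\<lambda>y. cot ((x - y) / 2) * p (cis y) / (2 * pi)) \<in> borel_measurable lborel" by simp_all
      show "AE y\<in>S e in lborel. cot ((x - y) / 2) * m (cis y) / (2 * pi) = cot ((x - y) / 2) * p (cis y) / (2 * pi)"
        using mp[of e] by eventually_elim auto
    qed (use Sm in auto)
    also have "\<dots> = (LBINT y:S e. \<Psi> (cis y) / (2 * pi) + p z / (2 * pi) * cot ((x - y) / 2))"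
    proof (rule set_lebesgue_integral_cong)
      show "\<forall>y. y \<in> S e \<longrightarrow> cot ((x - y) / 2) * p (cis y) / (2 * pi) = \<Psi> (cis y) / (2 * pi) + p z / (2 * pi) * cot ((x - y) / 2)"
        using \<Psi>[OF nz] by (simp flip: \<Psi>[OF nz] add: field_simps)
    qed (use Sm in auto)
    also have "\<dots> = (LBINT y:S e. \<Psi> (cis y) / (2 * pi)) + (LBINT y:S e. p z / (2 * pi) * cot ((x - y) / 2))"
      unfolding set_integrable_def
      by (intro set_integral_add; unfold set_integrable_def; intro borel_integrable_compact Scl continuous_intros cc comp c\<Psi>) auto
    also have "(LBINT y:S e. p z / (2 * pi) * cot ((x - y) / 2)) = p z / (2 * pi) * (LBINT y:S e. cot ((x - y) / 2))"
      by simp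
    \<comment> \<open>The reflection of y in x preserves the truncated period and changes the sign
      of the cotangent.\<close>
    also have "(LBINT y:S e. cot ((x - y) / 2)) = 0"
    proof -
      have "(LBINT y:S e. cot ((x - y) / 2)) = (\<integral>y. indicator (S e) (2 * x + (-1) * y) *\<^sub>R cot ((x - (2 * x + (-1) * y)) / 2) \<partial>lborel)"
        unfolding set_lebesgue_integral_def
        by (subst lborel_integral_real_affine[of "-1" _ "2 * x"]) simp_all
      also have "\<dots> = (\<integral>y. - (indicator (S e) y *\<^sub>R cot ((x - y) / 2)) \<partial>lborel)"
      proof (intro Bochner_Integration.integral_cong refl)
        fix y
        have "cot ((x - (2 * x + (-1) * y)) / 2) = - cot ((x - y) / 2)"
        proof -
          have "(x - (2 * x + (-1) * y)) / 2 = - ((x - y) / 2)" by (simp add: field_simps)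
          thus ?thesis by (simp only: cot_def cos_minus sin_minus divide_minus_right)
        qed
        moreover have "indicator (S e) (2 * x + (-1) * y) = (indicator (S e) y :: real)"
          by (auto simp: S_def indicator_def)
        ultimately show "indicator (S e) (2 * x + (-1) * y) *\<^sub>R cot ((x - (2 * x + (-1) * y)) / 2) = - (indicator (S e) y *\<^sub>R cot ((x - y) / 2))"
          by simp
      qed
      also have "\<dots> = - (LBINT y:S e. cot ((x - y) / 2))" by (simp add: set_lebesgue_integral_def)
      finally show ?thesis by simp
    qed
    finally show ?thesis by (simp add: S_def)
  qed
  have lim: "((\<lambda>e. LBINT y:S e. \<Psi> (cis y) / (2 * pi)) \<longlongrightarrow> (LBINT y:S 0. \<Psi> (cis y) / (2 * pi))) (at_right 0)"
    unfolding tendsto_at_iff_sequentially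
  proof (intro allI impI)
    fix X :: "nat \<Rightarrow> real" assume X: "\<forall>i. X i \<in> {0<..} - {0}" "X \<longlonglongrightarrow> 0"
    have "(\<lambda>i. LBINT y:S (X i). \<Psi> (cis y) / (2 * pi)) \<longlonglongrightarrow> (LBINT y:S 0. \<Psi> (cis y) / (2 * pi))"
      unfolding set_lebesgue_integral_def
    proof (rule integral_dominated_convergence[where w="\<lambda>y. norm (indicator (S 0) y *\<^sub>R (\<Psi> (cis y) / (2 * pi)))"])
      have [measurable]: "(\<lambda>y. \<Psi> (cis y)) \<in> borel_measurable borel"
        by (intro borel_measurable_continuous_onI comp c\<Psi>)
      show "(\<lambda>y. indicator (S 0) y *\<^sub>R (\<Psi> (cis y) / (2 * pi))) \<in> borel_measurable lborel"
        "\<And>i. (\<lambda>y. indicator (S (X i)) y *\<^sub>R (\<Psi> (cis y) / (2 * pi))) \<in> borel_measurable lborel"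
        using Sm by simp_all
      show "integrable lborel (\<lambda>y. norm (indicator (S 0) y *\<^sub>R (\<Psi> (cis y) / (2 * pi))))"
        by (intro integrable_norm borel_integrable_compact Scl continuous_intros comp c\<Psi>) auto
      show "AE y in lborel. (\<lambda>i. indicator (S (X i)) y *\<^sub>R (\<Psi> (cis y) / (2 * pi))) \<longlonglongrightarrow> indicator (S 0) y *\<^sub>R (\<Psi> (cis y) / (2 * pi))"
        using AE_lborel_singleton[of x]
      proof eventually_elim
        case (elim y)
        have "\<forall>\<^sub>F i in sequentially. X i < \<bar>x - y\<bar>"
          using X(2) elim by (auto intro!: order_tendstoD(2)[of X 0])
        hence "\<forall>\<^sub>F i in sequentially. indicator (S (X i)) y *\<^sub>R (\<Psi> (cis y) / (2 * pi)) = indicator (S 0) y *\<^sub>R (\<Psi> (cis y) / (2 * pi))"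
          by eventually_elim (auto simp: S_def indicator_def)
        thus ?case by (rule tendsto_eventually)
      qed
      show "AE y in lborel. norm (indicator (S (X i)) y *\<^sub>R (\<Psi> (cis y) / (2 * pi))) \<le> norm (indicator (S 0) y *\<^sub>R (\<Psi> (cis y) / (2 * pi)))" for i
        using X(1) by (intro AE_I2) (auto simp: S_def indicator_def)
    qed
    thus "((\<lambda>e. LBINT y:S e. \<Psi> (cis y) / (2 * pi)) \<circ> X) \<longlonglongrightarrow> (LBINT y:S 0. \<Psi> (cis y) / (2 * pi))"
      by (simp add: o_def)
  qed
  have "hilbert (smoothed M s) z = Lim (at_right 0) (\<lambda>e. LBINT y:{y. e \<le> \<bar>x - y\<bar> \<and> \<bar>x - y\<bar> \<le> pi}. cot ((x - y) / 2) * m (cis y) / (2 * pi))"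
    by (simp add: hilbert_def x_def m_def Let_def)
  also have "\<dots> = (LBINT y:S 0. \<Psi> (cis y) / (2 * pi))"
  proof (rule tendsto_Lim[OF trivial_limit_at_right_real])
    show "((\<lambda>e. LBINT y:{y. e \<le> \<bar>x - y\<bar> \<and> \<bar>x - y\<bar> \<le> pi}. cot ((x - y) / 2) * m (cis y) / (2 * pi)) \<longlongrightarrow> (LBINT y:S 0. \<Psi> (cis y) / (2 * pi))) (at_right 0)"
      by (rule Lim_transform_eventually[OF lim])
         (use key in \<open>auto simp: eventually_at_right_less intro!: eventually_mono[OF eventually_at_right_less]\<close>)
  qed
  also have "\<dots> = (LBINT y:{x - pi..<x - pi + 2 * pi}. \<Psi> (cis y)) /\<^sub>R (2 * pi)"
  proof -
    have [measurable]: "(\<lambda>y. \<Psi> (cis y)) \<in> borel_measurable borel"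
      by (intro borel_measurable_continuous_onI comp c\<Psi>)
    have "(LBINT y:S 0. \<Psi> (cis y) / (2 * pi)) = (LBINT y:S 0. \<Psi> (cis y)) / (2 * pi)" by simp
    moreover have "(LBINT y:S 0. \<Psi> (cis y)) = (LBINT y:{x - pi..<x - pi + 2 * pi}. \<Psi> (cis y))"
      unfolding set_lebesgue_integral_def
    proof (rule integral_cong_AE)
      show "AE y in lborel. indicator (S 0) y *\<^sub>R \<Psi> (cis y) = indicator {x - pi..<x - pi + 2 * pi} y *\<^sub>R \<Psi> (cis y)"
        using AE_lborel_singleton[of "x + pi"] by eventually_elim (auto simp: S_def indicator_def)
    qed (use Sm in simp_all)
    moreover have "X /\<^sub>R (2 * pi) = X / (2 * pi)" for X :: real by (simp add: field_simps)
    ultimately show ?thesis by (simp only:)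
  qed
  also have "\<dots> = (\<integral>w. \<Psi> w \<partial>circle_haar)"
    using integral_arc[OF c\<Psi>, of "x - pi"] by (simp add: arc_eq_haar)
  also have "\<dots> = (\<integral>a. \<integral>w. Im (herglotz s z a * herglotz s w a) \<partial>circle_haar \<partial>M)"
    unfolding \<Psi>_def using circle_Fubini(1)[OF circle_prob_haar M c2] by simp
  also have "\<dots> = (\<integral>a. Im (herglotz s z a) \<partial>M)"
  proof (rule circle_integral_cong[OF M])
    fix a :: complex assume a: "cmod a = 1"
    have "(\<integral>w. Im (herglotz s z a * herglotz s w a) \<partial>circle_haar) = Im (\<integral>w. herglotz s z a * herglotz s w a \<partial>circle_haar)"
      by (intro integral_Im circle_integrable[OF circle_prob_haar] continuous_intros s0 s a)
    thus "(\<integral>w. Im (herglotz s z a * herglotz s w a) \<partial>circle_haar) = Im (herglotz s z a)"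
      using haar_herglotz[OF s0 s(2) a] by simp
  qed
  also have "\<dots> = Im (smoothing M s z)"
    unfolding smoothing_def
    by (intro integral_Im circle_integrable[OF M] continuous_intros s0 s z)
  finally show ?thesis .
qed

section \<open>First variation of the logarithmic energy\<close>

text \<open>The transpose of Poisson smoothing, by \<open>poisson_duality\<close>: a field that is
  natural for the smoothed measure becomes a field along which the original measure can be
  displaced.\<close>

definition poisson_mean :: "(complex \<Rightarrow> real) \<Rightarrow> real \<Rightarrow> complex \<Rightarrow> real" where
  "poisson_mean h s a = (\<integral>w. h w * poisson s w a \<partial>circle_haar)"

text \<open>By the product formula for the Herglotz kernel, off the diagonal this is
  \<open>cot ((x - y) / 2) * (g a - g b) / 2\<close> for \<open>g = poisson_mean h s\<close>, \<open>a = cis x\<close>, \<open>b = cis y\<close>.\<close>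

definition variation_kernel :: "(complex \<Rightarrow> real) \<Rightarrow> real \<Rightarrow> complex \<times> complex \<Rightarrow> real" where
  "variation_kernel h s = (\<lambda>(a, b). (\<integral>w. h w * Im (herglotz s w a * herglotz s w b) \<partial>circle_haar) / 2)"

lemma continuous_on_poisson_mean:
  assumes s: "0 \<le> s" "s < 1" and h: "continuous_on circle h"
  shows "continuous_on circle (poisson_mean h s)"
proof -
  have "continuous_on (circle \<times> circle) (\<lambda>(a, w). h w * poisson s w a)"
    unfolding case_prod_beta by (intro continuous_intros s continuous_on_compose2[OF h]) auto
  from continuous_on_circle_integral[OF circle_prob_haar this] show ?thesis
    by (simp add: poisson_mean_def[abs_def])
qed

lemma continuous_on_triple_integral:
  fixes f :: "complex \<Rightarrow> complex \<times> complex \<Rightarrow> real"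
  assumes N: "circle_prob N" and f: "continuous_on (circle \<times> (circle \<times> circle)) (\<lambda>p. f (fst p) (snd p))"
  shows "continuous_on (circle \<times> circle) (\<lambda>q. \<integral>w. f w q \<partial>N)"
proof (unfold continuous_on_sequentially, intro allI ballI impI, elim conjE)
  fix x q assume q: "q \<in> circle \<times> circle" and x: "\<forall>n. x n \<in> circle \<times> circle" "x \<longlonglongrightarrow> q"
  have "bounded ((\<lambda>p. f (fst p) (snd p)) ` (circle \<times> (circle \<times> circle)))"
    by (intro compact_imp_bounded compact_continuous_image f compact_Times compact_sphere)
  then obtain B where B: "\<forall>y\<in>(\<lambda>p. f (fst p) (snd p)) ` (circle \<times> (circle \<times> circle)). norm y \<le> B"
    by (auto simp: bounded_iff)
  have B': "norm (f w (a, b)) \<le> B" if "cmod w = 1" "cmod a = 1" "cmod b = 1" for w a b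
    using B that by force
  have sec: "continuous_on circle (\<lambda>w. f w r)" if "r \<in> circle \<times> circle" for r
    using that by (intro continuous_on_compose2[OF f, of circle "\<lambda>w. (w, r)", simplified]) (auto intro!: continuous_intros)
  interpret prob_space N using circle_probD(1)[OF N] .
  have "(\<lambda>n. \<integral>w. f w (x n) \<partial>N) \<longlonglongrightarrow> (\<integral>w. f w q \<partial>N)"
  proof (rule integral_dominated_convergence[where w="\<lambda>_. B"])
    show "(\<lambda>w. f w q) \<in> borel_measurable N" "\<And>n. (\<lambda>w. f w (x n)) \<in> borel_measurable N"
      using x q by (auto intro!: borel_measurable_circle[OF N] sec)
    show "AE w in N. (\<lambda>n. f w (x n)) \<longlonglongrightarrow> f w q"
    proof (rule AE_I2)
      fix w assume "w \<in> space N"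
      hence w: "cmod w = 1" using circle_probD(3)[OF N] by simp
      have "continuous_on (circle \<times> circle) (\<lambda>r. f w r)"
        using w by (intro continuous_on_compose2[OF f, of "circle \<times> circle" "\<lambda>r. (w, r)", simplified]) (auto intro!: continuous_intros)
      thus "(\<lambda>n. f w (x n)) \<longlonglongrightarrow> f w q"
        using q x by (auto simp: continuous_on_sequentially o_def)
    qed
    show "AE w in N. norm (f w (x n)) \<le> B" for n
    proof (rule AE_I2)
      fix w assume "w \<in> space N"
      thus "norm (f w (x n)) \<le> B"
        using x(1) B'[of w "fst (x n)" "snd (x n)"] circle_probD(3)[OF N] by (auto simp: mem_Times_iff)
    qed
  qed simp
  thus "((\<lambda>q. \<integral>w. f w q \<partial>N) \<circ> x) \<longlonglongrightarrow> (\<integral>w. f w q \<partial>N)" by (simp add: o_def)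
qed

lemma continuous_on_variation_kernel:
  assumes s: "0 \<le> s" "s < 1" and h: "continuous_on circle h"
  shows "continuous_on (circle \<times> circle) (variation_kernel h s)"
proof -
  have "continuous_on (circle \<times> circle) (\<lambda>q. \<integral>w. h w * Im (herglotz s w (fst q) * herglotz s w (snd q)) \<partial>circle_haar)"
    by (intro continuous_on_triple_integral circle_prob_haar continuous_intros s continuous_on_compose2[OF h]) auto
  thus ?thesis unfolding variation_kernel_def case_prod_beta by (intro continuous_intros) auto
qed

lemma variation_kernel_eq:
  assumes s: "0 \<le> s" "s < 1" and h: "continuous_on circle h" and nz: "sin ((x - y) / 2) \<noteq> 0"
  shows "variation_kernel h s (cis x, cis y) =
           cot ((x - y) / 2) * (poisson_mean h s (cis x) - poisson_mean h s (cis y)) / 2"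
proof -
  have i: "integrable circle_haar (\<lambda>w. h w * poisson s w (cis x))" for x
    by (intro circle_integrable[OF circle_prob_haar] continuous_intros h s) simp
  have "(\<integral>w. h w * Im (herglotz s w (cis x) * herglotz s w (cis y)) \<partial>circle_haar) =
     (\<integral>w. cot ((x - y) / 2) * (h w * poisson s w (cis x) - h w * poisson s w (cis y)) \<partial>circle_haar)"
  proof (rule circle_integral_cong[OF circle_prob_haar])
    fix w :: complex assume w: "cmod w = 1"
    show "h w * Im (herglotz s w (cis x) * herglotz s w (cis y)) = cot ((x - y) / 2) * (h w * poisson s w (cis x) - h w * poisson s w (cis y))"
      unfolding herglotz_product_right[OF w s nz] by (simp add: algebra_simps)
  qed
  also have "\<dots> = cot ((x - y) / 2) * (poisson_mean h s (cis x) - poisson_mean h s (cis y))"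
    using i by (simp add: poisson_mean_def)
  finally show ?thesis by (simp add: variation_kernel_def)
qed

text \<open>Integrating in both variables turns the product of two kernels into the square of the
  Herglotz transform. The imaginary part of a square is twice Im times Re: the 2 cancels the half in
  the kernel, and Re is the density of the smoothed measure.\<close>

lemma integral_variation_kernel:
  assumes M: "circle_prob M" and s: "0 \<le> s" "s < 1" and h: "continuous_on circle h"
  shows "integral\<^sup>L (M \<Otimes>\<^sub>M M) (variation_kernel h s) = (\<integral>w. h w * Im (smoothing M s w) \<partial>smoothed M s)"
proof -
  have Gw: "continuous_on circle (\<lambda>w. h w * Im (herglotz s w a * herglotz s w b))" if "cmod a = 1" "cmod b = 1" for a b
    by (intro continuous_intros h s that)
  have G: "continuous_on circle (\<lambda>w. h w * Im (smoothing M s w))"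
    by (intro continuous_intros h s M)
  have c1: "continuous_on (circle \<times> circle) (\<lambda>(w, b). h w * Im (herglotz s w a * herglotz s w b))" if "cmod a = 1" for a
    unfolding case_prod_beta using that by (intro continuous_intros s continuous_on_compose2[OF h]) auto
  have c2: "continuous_on (circle \<times> circle) (\<lambda>(w, a). h w * Im (herglotz s w a * smoothing M s w))"
    unfolding case_prod_beta by (intro continuous_intros s continuous_on_compose2[OF h] continuous_on_compose2[OF continuous_on_smoothing[OF M s]]) auto
  have ih: "integrable M (\<lambda>a. herglotz s w a)" if "cmod w = 1" for w
    by (intro circle_integrable[OF M] continuous_intros s that)
  have "integral\<^sup>L (M \<Otimes>\<^sub>M M) (variation_kernel h s) = (\<integral>a. \<integral>b. variation_kernel h s (a, b) \<partial>M \<partial>M)"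
    by (rule circle_Fubini(2)[OF M M continuous_on_variation_kernel[OF s h]])
  also have "\<dots> = (\<integral>a. (\<integral>w. h w * Im (herglotz s w a * smoothing M s w) \<partial>circle_haar) / 2 \<partial>M)"
  proof (rule circle_integral_cong[OF M])
    fix a :: complex assume a: "cmod a = 1"
    have "(\<integral>b. \<integral>w. h w * Im (herglotz s w a * herglotz s w b) \<partial>circle_haar \<partial>M) =
        (\<integral>w. \<integral>b. h w * Im (herglotz s w a * herglotz s w b) \<partial>M \<partial>circle_haar)"
      using circle_Fubini(1)[OF circle_prob_haar M c1[OF a]] by simp
    also have "\<dots> = (\<integral>w. h w * Im (herglotz s w a * smoothing M s w) \<partial>circle_haar)"
    proof (rule circle_integral_cong[OF circle_prob_haar])
      fix w :: complex assume w: "cmod w = 1"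
      have "(\<integral>b. Im (herglotz s w a * herglotz s w b) \<partial>M) = Im (\<integral>b. herglotz s w a * herglotz s w b \<partial>M)"
        using ih[OF w] by (intro integral_Im) simp
      thus "(\<integral>b. h w * Im (herglotz s w a * herglotz s w b) \<partial>M) = h w * Im (herglotz s w a * smoothing M s w)"
        by (simp only: integral_mult_right_zero smoothing_def)
    qed
    finally show "(\<integral>b. variation_kernel h s (a, b) \<partial>M) = (\<integral>w. h w * Im (herglotz s w a * smoothing M s w) \<partial>circle_haar) / 2"
      by (simp add: variation_kernel_def)
  qed
  also have "\<dots> = (\<integral>a. \<integral>w. h w * Im (herglotz s w a * smoothing M s w) \<partial>circle_haar \<partial>M) / 2" by simp
  also have "(\<integral>a. \<integral>w. h w * Im (herglotz s w a * smoothing M s w) \<partial>circle_haar \<partial>M) =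
     (\<integral>w. \<integral>a. h w * Im (herglotz s w a * smoothing M s w) \<partial>M \<partial>circle_haar)"
    using circle_Fubini(1)[OF circle_prob_haar M c2] by simp
  also have "\<dots> = (\<integral>w. 2 * (h w * Im (smoothing M s w) * Re (smoothing M s w)) \<partial>circle_haar)"
  proof (rule circle_integral_cong[OF circle_prob_haar])
    fix w :: complex assume w: "cmod w = 1"
    have "(\<integral>a. Im (herglotz s w a * smoothing M s w) \<partial>M) = Im (\<integral>a. herglotz s w a * smoothing M s w \<partial>M)"
      using ih[OF w] by (intro integral_Im) simp
    also have "\<dots> = Im (smoothing M s w * smoothing M s w)"
      by (simp only: integral_mult_left_zero) (simp only: smoothing_def)
    finally show "(\<integral>a. h w * Im (herglotz s w a * smoothing M s w) \<partial>M) = 2 * (h w * Im (smoothing M s w) * Re (smoothing M s w))"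
      by (simp only: integral_mult_right_zero) simp
  qed
  also have "\<dots> = 2 * (\<integral>w. h w * Im (smoothing M s w) \<partial>smoothed M s)"
    unfolding integral_smoothed_real[OF M s G] by simp
  finally show ?thesis by simp
qed

section \<open>Chords under a small displacement\<close>

lemma cmod_cis_diff: "cmod (cis u - cis v) = 2 * \<bar>sin ((u - v) / 2)\<bar>"
proof -
  define p q where "p = (u + v) / 2" and "q = (u - v) / 2"
  have uv: "u = p + q" "v = p - q" by (simp_all add: p_def q_def field_simps)
  have "(cmod (cis u - cis v))\<^sup>2 = 4 * (sin q)\<^sup>2 * (sin p)\<^sup>2 + 4 * (sin q)\<^sup>2 * (cos p)\<^sup>2"
    unfolding uv by (simp add: cmod_power2 cos_add cos_diff sin_add sin_diff power_mult_distrib)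
  also have "\<dots> = 4 * (sin q)\<^sup>2 * ((sin p)\<^sup>2 + (cos p)\<^sup>2)" by (simp only: distrib_left)
  also have "\<dots> = (2 * \<bar>sin q\<bar>)\<^sup>2" by (simp add: power_mult_distrib)
  finally show ?thesis unfolding q_def by (rule power2_eq_imp_eq) auto
qed

text \<open>The chord is multiplied by R = cos \<tau> + cot (\<theta> / 2) sin \<tau> with \<tau> =
  \<epsilon> \<delta> / 2. The cotangent alone is unbounded near the diagonal, but its product with
  \<delta> is bounded, so the second order remainder depends on \<epsilon>, G and B only and is
  uniform in \<theta>.\<close>

lemma log_dist_variation:
  fixes \<epsilon> \<delta> \<theta> G B :: real
  assumes \<epsilon>: "0 < \<epsilon>" "\<epsilon> \<le> 1" and G: "\<bar>\<delta>\<bar> \<le> 2 * G" "1 \<le> G" and B: "\<bar>cot (\<theta> / 2) * \<delta> / 2\<bar> \<le> B"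
    and nz: "sin (\<theta> / 2) \<noteq> 0" and small: "\<epsilon> * (B + G\<^sup>2 * (1 + B)) \<le> 1 / 2"
  shows "sin ((\<theta> + \<epsilon> * \<delta>) / 2) \<noteq> 0"
    and "ln (2 * \<bar>sin ((\<theta> + \<epsilon> * \<delta>) / 2)\<bar>) \<ge> ln (2 * \<bar>sin (\<theta> / 2)\<bar>) + \<epsilon> * (cot (\<theta> / 2) * \<delta> / 2)
             - \<epsilon>\<^sup>2 * (G\<^sup>2 * (1 + B) + 2 * (B + G\<^sup>2 * (1 + B))\<^sup>2)"
proof -
  define \<tau> where "\<tau> = \<epsilon> * \<delta> / 2"
  define c where "c = cot (\<theta> / 2)"
  define D where "D = c * \<delta> / 2"
  define C where "C = G\<^sup>2 * (1 + B)"
  have B0: "B \<ge> 0" using B by linarith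
  have G0: "G \<ge> 0" using G by linarith
  have C0: "C \<ge> 0" using B0 by (simp add: C_def)
  have DB: "\<bar>D\<bar> \<le> B" using B by (simp add: D_def c_def)
  have c\<tau>: "c * \<tau> = \<epsilon> * D" by (simp add: \<tau>_def D_def)
  have \<tau>: "\<bar>\<tau>\<bar> \<le> \<epsilon> * G" using \<epsilon> G by (simp add: \<tau>_def abs_mult mult_left_mono)
  hence \<tau>2: "\<tau>\<^sup>2 \<le> \<epsilon>\<^sup>2 * G\<^sup>2" using power_mono[OF \<tau>, of 2] by (simp add: power_mult_distrib)
  have cos: "cos \<tau> \<ge> 1 - \<tau>\<^sup>2 / 2"
  proof -
    have "\<bar>sin (\<tau> / 2)\<bar> \<le> \<bar>\<tau> / 2\<bar>" by (rule abs_sin_x_le_abs_x)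
    hence "(sin (\<tau> / 2))\<^sup>2 \<le> (\<tau> / 2)\<^sup>2" by (simp only: abs_le_square_iff)
    moreover have "cos \<tau> = 1 - 2 * (sin (\<tau> / 2))\<^sup>2" using cos_double_sin[of "\<tau> / 2"] by simp
    ultimately show ?thesis by (simp add: power_divide)
  qed
  have sin: "\<bar>sin \<tau> - \<tau>\<bar> \<le> \<tau>\<^sup>2 / 2"
    using Maclaurin_sin_bound[of \<tau> 2] by (simp add: numeral_2_eq_2 sin_coeff_def power2_eq_square)
  have GG: "G \<le> G\<^sup>2" using G(2) by (simp add: power2_eq_square)
  \<comment> \<open>One of the two factors \<tau> is spent on the unbounded c, since c \<tau> =
    \<epsilon> D is bounded by \<epsilon> B; the other one provides the second power of
    \<epsilon>.\<close>
  have cs: "\<bar>c * (sin \<tau> - \<tau>)\<bar> \<le> \<epsilon>\<^sup>2 * (B * G\<^sup>2) / 2"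
  proof -
    have "\<bar>c * (sin \<tau> - \<tau>)\<bar> \<le> \<bar>c\<bar> * (\<tau>\<^sup>2 / 2)"
      unfolding abs_mult using sin by (intro mult_left_mono) auto
    also have "\<dots> = \<bar>c * \<tau>\<bar> * \<bar>\<tau>\<bar> / 2" by (simp add: abs_mult power2_eq_square)
    also have "\<dots> \<le> (\<epsilon> * B) * (\<epsilon> * G) / 2"
      unfolding c\<tau> using DB \<tau> \<epsilon> B0 by (intro divide_right_mono mult_mono) (auto simp: abs_mult mult_left_mono)
    also have "\<dots> \<le> \<epsilon>\<^sup>2 * (B * G\<^sup>2) / 2"
      using mult_left_mono[OF GG, of "\<epsilon>\<^sup>2 * B"] B0 by (simp add: power2_eq_square mult_ac)
    finally show ?thesis .
  qed
  define R where "R = cos \<tau> + c * sin \<tau>"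
  define u where "u = \<epsilon> * D - \<epsilon>\<^sup>2 * C"
  have R: "R \<ge> 1 + u"
  proof -
    have "c * sin \<tau> = \<epsilon> * D + c * (sin \<tau> - \<tau>)" using c\<tau> by (simp add: algebra_simps)
    moreover have "\<epsilon>\<^sup>2 * C = \<epsilon>\<^sup>2 * G\<^sup>2 + \<epsilon>\<^sup>2 * (B * G\<^sup>2)" by (simp add: C_def algebra_simps)
    moreover have "0 \<le> \<epsilon>\<^sup>2 * G\<^sup>2" "0 \<le> \<epsilon>\<^sup>2 * (B * G\<^sup>2)" using B0 by auto
    ultimately show ?thesis unfolding R_def u_def using cos \<tau>2 cs by linarith
  qed
  have ub: "\<bar>u\<bar> \<le> \<epsilon> * (B + C)"
  proof -
    have "\<bar>\<epsilon> * D\<bar> \<le> \<epsilon> * B" using \<epsilon> DB by (simp add: abs_mult)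
    moreover have "\<epsilon>\<^sup>2 * C \<le> \<epsilon> * C" "0 \<le> \<epsilon>\<^sup>2 * C"
      using \<epsilon> C0 by (auto simp: power2_eq_square mult.assoc mult_left_le_one_le intro!: mult_left_mono)
    ultimately show ?thesis unfolding u_def by (simp add: algebra_simps)
  qed
  \<comment> \<open>This range gives ln (1 + u) \<ge> u - 2 u^2 and keeps R positive, so distinct
    points remain distinct.\<close>
  have uh: "\<bar>u\<bar> \<le> 1 / 2" using ub small by (simp add: C_def)
  have Rpos: "R > 0" using R uh by linarith
  have eq: "sin ((\<theta> + \<epsilon> * \<delta>) / 2) = sin (\<theta> / 2) * R"
  proof -
    have 1: "(\<theta> + \<epsilon> * \<delta>) / 2 = \<theta> / 2 + \<tau>" by (simp add: \<tau>_def add_divide_distrib)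
    show ?thesis unfolding 1 sin_add R_def c_def cot_def using nz by (simp add: distrib_left mult_ac)
  qed
  show "sin ((\<theta> + \<epsilon> * \<delta>) / 2) \<noteq> 0" using eq nz Rpos by simp
  have "u\<^sup>2 \<le> (\<epsilon> * (B + C))\<^sup>2" using power_mono[OF ub, of 2] by simp
  hence u2: "u\<^sup>2 \<le> \<epsilon>\<^sup>2 * (B + C)\<^sup>2" by (simp add: power_mult_distrib)
  have "u - 2 * u\<^sup>2 \<le> ln (1 + u)" using abs_ln_one_plus_x_minus_x_bound[OF uh] by (simp add: abs_le_iff)
  also have "\<dots> \<le> ln R" using R uh by (intro ln_mono) auto
  finally have lnR: "\<epsilon> * D - \<epsilon>\<^sup>2 * (C + 2 * (B + C)\<^sup>2) \<le> ln R"
    using u2 by (simp add: u_def algebra_simps)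
  have "ln (2 * \<bar>sin ((\<theta> + \<epsilon> * \<delta>) / 2)\<bar>) = ln (2 * \<bar>sin (\<theta> / 2)\<bar> * R)"
    unfolding eq using Rpos by (simp add: abs_mult mult.assoc)
  also have "\<dots> = ln (2 * \<bar>sin (\<theta> / 2)\<bar>) + ln R" using nz Rpos by (simp add: ln_mult)
  finally show "ln (2 * \<bar>sin ((\<theta> + \<epsilon> * \<delta>) / 2)\<bar>) \<ge> ln (2 * \<bar>sin (\<theta> / 2)\<bar>) + \<epsilon> * (cot (\<theta> / 2) * \<delta> / 2)
             - \<epsilon>\<^sup>2 * (G\<^sup>2 * (1 + B) + 2 * (B + G\<^sup>2 * (1 + B))\<^sup>2)"
    using lnR by (simp add: D_def c_def C_def)
qed

definition transport :: "(complex \<Rightarrow> real) \<Rightarrow> real \<Rightarrow> complex \<Rightarrow> complex" where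
  "transport g \<epsilon> a = a * cis (\<epsilon> * g a)"

lemma transport_measurable:
  assumes M: "circle_prob M" and g: "continuous_on circle g"
  shows "transport g \<epsilon> \<in> measurable M circle_borel"
  unfolding circle_borel_def
proof (rule measurable_restrict_space2)
  show "transport g \<epsilon> \<in> borel_measurable M"
    unfolding transport_def[abs_def] by (intro borel_measurable_circle[OF M] continuous_intros g)
qed (auto simp: transport_def norm_mult circle_probD(3)[OF M])

text \<open>Only an upper bound is needed, because the slope inequality bounds the energy of the
  displaced measure from below. The pointwise bound for one chord is uniform over pairs of distinct
  points and trivial on the diagonal, so it can be integrated although M has no density.\<close>

lemma log_energy_variation:
  assumes M: "circle_prob M" and fin: "log_energy M < \<infinity>"
    and s: "0 \<le> s" "s < 1" and h: "continuous_on circle h"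
  obtains C \<epsilon>0 where "\<epsilon>0 > 0" "C \<ge> 0"
    "\<And>\<epsilon>. 0 < \<epsilon> \<Longrightarrow> \<epsilon> \<le> \<epsilon>0 \<Longrightarrow>
       log_energy (distr M circle_borel (transport (poisson_mean h s) \<epsilon>)) < \<infinity> \<and>
       enn2real (log_energy (distr M circle_borel (transport (poisson_mean h s) \<epsilon>))) \<le>
         enn2real (log_energy M) - \<epsilon> * (\<integral>w. h w * Im (smoothing M s w) \<partial>smoothed M s) + C * \<epsilon>\<^sup>2"
proof -
  interpret pair_prob_space M M by (rule circle_pair_prob[OF M M])
  let ?g = "poisson_mean h s"
  let ?D = "variation_kernel h s"
  note cg = continuous_on_poisson_mean[OF s h] and cD = continuous_on_variation_kernel[OF s h]
  obtain G' where G': "G' > 0" "\<And>a. cmod a = 1 \<Longrightarrow> norm (?g a) \<le> G'" using circle_bounded[OF cg] by blast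
  \<comment> \<open>The maximum with 1 ensures \<open>G \<le> G\<^sup>2\<close>, which lets the
    remainder be expressed through the square of G.\<close>
  define G where "G = max 1 G'"
  have G: "G \<ge> 1" "\<And>a. cmod a = 1 \<Longrightarrow> \<bar>?g a\<bar> \<le> G" using G' unfolding G_def by (auto, fastforce)
  obtain B where B: "B > 0" "\<And>a b. cmod a = 1 \<Longrightarrow> cmod b = 1 \<Longrightarrow> norm (?D (a, b)) \<le> B"
    using circle2_bounded[OF cD] by blast
  define C where "C = G\<^sup>2 * (1 + B) + 2 * (B + G\<^sup>2 * (1 + B))\<^sup>2"
  define A where "A = B + G\<^sup>2 * (1 + B)"
  have A: "A > 0" using B G by (simp add: A_def add_pos_nonneg)
  have C: "C \<ge> 0" using B by (simp add: C_def)
  define \<epsilon>0 where "\<epsilon>0 = min 1 (1 / (2 * A))"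
  have \<epsilon>0: "\<epsilon>0 > 0" using A by (simp add: \<epsilon>0_def)
  show ?thesis
  proof (rule that[OF \<epsilon>0 C])
    fix \<epsilon> :: real assume \<epsilon>: "0 < \<epsilon>" "\<epsilon> \<le> \<epsilon>0"
    hence \<epsilon>1: "\<epsilon> \<le> 1" and small: "\<epsilon> * A \<le> 1 / 2" using A by (auto simp: \<epsilon>0_def field_simps)
    let ?\<phi> = "transport ?g \<epsilon>"
    let ?N = "distr M circle_borel ?\<phi>"
    have \<phi>m [measurable]: "?\<phi> \<in> measurable M circle_borel" by (rule transport_measurable[OF M cg])
    have N: "circle_prob ?N" using circle_probD(1)[OF M] \<phi>m by (rule circle_prob_distr)
    \<comment> \<open>Adding K makes every term nonnegative, as |\<epsilon> D| \<le> B and C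
      \<epsilon>^2 \<le> C. The inequality can then be integrated as one between extended
      nonnegative functions.\<close>
    define K where "K = B + C"
    have pt: "log_kernel (?\<phi> a, ?\<phi> b) + ennreal (K + (\<epsilon> * ?D (a, b) - C * \<epsilon>\<^sup>2)) \<le> log_kernel (a, b) + ennreal K"
      and K0: "0 \<le> K + (\<epsilon> * ?D (a, b) - C * \<epsilon>\<^sup>2)"
      if ab: "cmod a = 1" "cmod b = 1" for a b
    proof -
      have "\<bar>\<epsilon> * ?D (a, b)\<bar> \<le> 1 * B"
        unfolding abs_mult using \<epsilon> \<epsilon>1 B ab by (intro mult_mono) auto
      moreover have "C * \<epsilon>\<^sup>2 \<le> C * 1" using C \<epsilon> \<epsilon>1 by (intro mult_left_mono) (auto simp: power_le_one)
      ultimately show K0: "0 \<le> K + (\<epsilon> * ?D (a, b) - C * \<epsilon>\<^sup>2)" unfolding K_def by linarith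
      have K0': "0 \<le> K" using B C by (simp add: K_def)
      show "log_kernel (?\<phi> a, ?\<phi> b) + ennreal (K + (\<epsilon> * ?D (a, b) - C * \<epsilon>\<^sup>2)) \<le> log_kernel (a, b) + ennreal K"
      proof (cases "a = b")
        case False
        define x y where "x = Arg a" and "y = Arg b"
        have xy: "a = cis x" "b = cis y" using ab cis_Arg[of a] cis_Arg[of b]
          by (cases "a = 0"; cases "b = 0"; simp add: x_def y_def sgn_div_norm)+
        have nz: "sin ((x - y) / 2) \<noteq> 0"
          using False cmod_cis_diff[of x y] unfolding xy by auto
        define \<delta> where "\<delta> = ?g a - ?g b"
        have \<delta>: "\<bar>\<delta>\<bar> \<le> 2 * G" using G(2)[OF ab(1)] G(2)[OF ab(2)] by (simp add: \<delta>_def)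
        have Deq: "?D (a, b) = cot ((x - y) / 2) * \<delta> / 2"
          unfolding xy \<delta>_def by (rule variation_kernel_eq[OF s h nz])
        have DB: "\<bar>cot ((x - y) / 2) * \<delta> / 2\<bar> \<le> B" using B(2)[OF ab] by (simp add: Deq)
        note v = log_dist_variation[OF \<epsilon>(1) \<epsilon>1 \<delta> G(1) DB nz small[unfolded A_def]]
        have phi: "?\<phi> a = cis (x + \<epsilon> * ?g a)" "?\<phi> b = cis (y + \<epsilon> * ?g b)"
          by (simp_all add: transport_def xy cis_mult)
        have arg: "(x + \<epsilon> * ?g a) - (y + \<epsilon> * ?g b) = (x - y) + \<epsilon> * \<delta>" by (simp add: \<delta>_def algebra_simps)
        have d1: "cmod (?\<phi> a - ?\<phi> b) = 2 * \<bar>sin (((x - y) + \<epsilon> * \<delta>) / 2)\<bar>"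
          unfolding phi cmod_cis_diff arg ..
        have d2: "cmod (a - b) = 2 * \<bar>sin ((x - y) / 2)\<bar>" unfolding xy cmod_cis_diff ..
        have ne: "?\<phi> a \<noteq> ?\<phi> b" using d1 v(1) by auto
        have l: "ln (cmod (?\<phi> a - ?\<phi> b)) \<ge> ln (cmod (a - b)) + \<epsilon> * ?D (a, b) - C * \<epsilon>\<^sup>2"
          using v(2) unfolding d1 d2 Deq C_def by (simp add: mult.commute)
        have p1: "0 \<le> ln 2 - ln (cmod (a - b))"
          using norm_triangle_ineq4[of a b] ab False by (simp add: ln_le_cancel_iff)
        have p2: "0 \<le> ln 2 - ln (cmod (?\<phi> a - ?\<phi> b))"
          using norm_triangle_ineq4[of "?\<phi> a" "?\<phi> b"] ab ne by (simp add: ln_le_cancel_iff transport_def norm_mult)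
        show ?thesis using False ne l unfolding log_kernel_def
          by (auto simp: ennreal_plus[symmetric, OF p1 K0'] ennreal_plus[symmetric, OF p2 K0] simp del: ennreal_plus intro!: ennreal_leI)
      qed (simp add: log_kernel_def)
    qed
    have meas: "(\<lambda>p. (?\<phi> (fst p), ?\<phi> (snd p))) \<in> measurable (M \<Otimes>\<^sub>M M) (circle_borel \<Otimes>\<^sub>M circle_borel)"
      by measurable
    have NN: "?N \<Otimes>\<^sub>M ?N = distr (M \<Otimes>\<^sub>M M) (circle_borel \<Otimes>\<^sub>M circle_borel) (\<lambda>p. (?\<phi> (fst p), ?\<phi> (snd p)))"
      using pair_measure_distr[OF \<phi>m \<phi>m] prob_space_imp_sigma_finite[OF circle_probD(1)[OF N]]
      by (simp add: split_beta')
    have lm: "log_kernel \<in> borel_measurable (circle_borel \<Otimes>\<^sub>M circle_borel)"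
      using log_kernel_measurable[OF N N] by (simp add: NN)
    have iD: "integrable (M \<Otimes>\<^sub>M M) ?D" by (rule circle_pair_integrable[OF M M cD])
    let ?I = "integral\<^sup>L (M \<Otimes>\<^sub>M M) ?D"
    have int: "(\<integral>\<^sup>+p. ennreal (K + (\<epsilon> * ?D p - C * \<epsilon>\<^sup>2)) \<partial>(M \<Otimes>\<^sub>M M)) = ennreal (K + (\<epsilon> * ?I - C * \<epsilon>\<^sup>2))"
    proof -
      have "(\<integral>\<^sup>+p. ennreal (K + (\<epsilon> * ?D p - C * \<epsilon>\<^sup>2)) \<partial>(M \<Otimes>\<^sub>M M)) = ennreal (\<integral>p. K + (\<epsilon> * ?D p - C * \<epsilon>\<^sup>2) \<partial>(M \<Otimes>\<^sub>M M))"
        using iD K0 circle_probD(3)[OF M]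
        by (intro nn_integral_eq_integral) (auto intro!: AE_I2 simp: space_pair_measure)
      thus ?thesis using iD by (simp add: P.prob_space)
    qed
    have "(ennreal (ln 2) + log_energy ?N) + ennreal (K + (\<epsilon> * ?I - C * \<epsilon>\<^sup>2)) =
       (\<integral>\<^sup>+p. log_kernel (?\<phi> (fst p), ?\<phi> (snd p)) + ennreal (K + (\<epsilon> * ?D p - C * \<epsilon>\<^sup>2)) \<partial>(M \<Otimes>\<^sub>M M))"
    proof (subst nn_integral_add)
      show "(\<lambda>p. log_kernel (?\<phi> (fst p), ?\<phi> (snd p))) \<in> borel_measurable (M \<Otimes>\<^sub>M M)"
        by (rule measurable_compose[OF meas lm])
      show "(\<lambda>p. ennreal (K + (\<epsilon> * ?D p - C * \<epsilon>\<^sup>2))) \<in> borel_measurable (M \<Otimes>\<^sub>M M)"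
        using iD by measurable
      show "(ennreal (ln 2) + log_energy ?N) + ennreal (K + (\<epsilon> * ?I - C * \<epsilon>\<^sup>2)) =
         (\<integral>\<^sup>+p. log_kernel (?\<phi> (fst p), ?\<phi> (snd p)) \<partial>(M \<Otimes>\<^sub>M M)) + (\<integral>\<^sup>+p. ennreal (K + (\<epsilon> * ?D p - C * \<epsilon>\<^sup>2)) \<partial>(M \<Otimes>\<^sub>M M))"
        unfolding int nn_integral_log_kernel[OF N, symmetric] NN
        by (subst nn_integral_distr[OF meas log_kernel_measurable[OF N N, unfolded NN]]) simp
    qed
    also have "\<dots> \<le> (\<integral>\<^sup>+p. log_kernel p + ennreal K \<partial>(M \<Otimes>\<^sub>M M))"
      using pt circle_probD(3)[OF M] by (intro nn_integral_mono) (auto simp: space_pair_measure)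
    also have "\<dots> = (ennreal (ln 2) + log_energy M) + ennreal K"
      using log_kernel_measurable[OF M M] by (subst nn_integral_add) (auto simp: nn_integral_log_kernel[OF M] P.emeasure_space_1)
    finally have main: "(ennreal (ln 2) + log_energy ?N) + ennreal (K + (\<epsilon> * ?I - C * \<epsilon>\<^sup>2)) \<le> (ennreal (ln 2) + log_energy M) + ennreal K" .
    have finN: "log_energy ?N < \<infinity>"
    proof (rule ccontr)
      assume "\<not> log_energy ?N < \<infinity>"
      hence "log_energy ?N = \<infinity>" by (simp add: less_top[symmetric])
      thus False using main fin by (simp add: top_unique)
    qed
    have KI: "0 \<le> K + (\<epsilon> * ?I - C * \<epsilon>\<^sup>2)"
    proof -
      have "0 \<le> (\<integral>p. K + (\<epsilon> * ?D p - C * \<epsilon>\<^sup>2) \<partial>(M \<Otimes>\<^sub>M M))"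
        using K0 circle_probD(3)[OF M] by (intro integral_nonneg_AE AE_I2) (auto simp: space_pair_measure)
      thus ?thesis using iD by (simp add: P.prob_space)
    qed
    obtain eN where eN: "log_energy ?N = ennreal eN" "eN \<ge> 0" using finN by (cases "log_energy ?N") auto
    obtain eM where eM: "log_energy M = ennreal eM" "eM \<ge> 0" using fin by (cases "log_energy M") auto
    have K0': "0 \<le> K" using B C by (simp add: K_def)
    have "ennreal (ln 2 + eN + (K + (\<epsilon> * ?I - C * \<epsilon>\<^sup>2))) \<le> ennreal (ln 2 + eM + K)"
      using main eN eM KI K0' by (simp add: ennreal_plus)
    moreover have "0 \<le> ln 2 + eM + K" using eM K0' by simp
    ultimately have "ln 2 + eN + (K + (\<epsilon> * ?I - C * \<epsilon>\<^sup>2)) \<le> ln 2 + eM + K"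
      by (simp only: ennreal_le_iff)
    hence "eN \<le> eM - \<epsilon> * ?I + C * \<epsilon>\<^sup>2" by simp
    thus "log_energy ?N < \<infinity> \<and> enn2real (log_energy ?N) \<le>
         enn2real (log_energy M) - \<epsilon> * (\<integral>w. h w * Im (smoothing M s w) \<partial>smoothed M s) + C * \<epsilon>\<^sup>2"
      using finN eN eM by (simp add: integral_variation_kernel[OF M s h])
  qed
qed

section \<open>Monotone lifts\<close>

abbreviation unit_leb :: "real measure" where
  "unit_leb \<equiv> restrict_space lborel {0<..<1}"

lemma prob_space_unit_leb: "prob_space unit_leb"
  by (rule prob_space_restrict_space) auto

interpretation unit_leb: prob_space unit_leb by (rule prob_space_unit_leb)

lemma measure_unit_leb [simp]: "measure unit_leb {0<..<1} = 1"
  using unit_leb.prob_space by (simp add: space_restrict_space)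

lemma AE_unit_lebI: "AE s in lborel. P s \<Longrightarrow> AE s in unit_leb. P s"
  by (subst AE_restrict_space_iff) auto

lemma unit_leb_measurableI [measurable (raw)]:
  "f \<in> borel_measurable borel \<Longrightarrow> f \<in> borel_measurable unit_leb"
  by (rule measurable_restrict_space1) simp

definition circle_law :: "(real \<Rightarrow> real) \<Rightarrow> complex measure" where
  "circle_law X = distr unit_leb circle_borel (\<lambda>s. cis (X s))"

text \<open>Up to null sets, an admissible function is a quantile function, on \<open>(0, 1)\<close>, of a probability
  measure on the line that is carried by an interval of length \<open>2\<pi>\<close> and has mean \<open>m\<close>. On these
  functions the modified Wasserstein distance becomes the distance of \<open>L\<^sup>2(0, 1)\<close>.\<close>

definition admissible :: "real \<Rightarrow> (real \<Rightarrow> real) \<Rightarrow> bool" where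
  "admissible m X \<longleftrightarrow> mono X \<and> (\<forall>x. continuous (at_right x) X) \<and>
     (\<exists>u. \<forall>s. u \<le> X s \<and> X s \<le> u + 2 * pi) \<and> (\<integral>s. X s \<partial>unit_leb) = m"

lemma admissible_measurable [measurable_dest]:
  "admissible m X \<Longrightarrow> X \<in> borel_measurable borel"
  by (auto simp: admissible_def intro: borel_measurable_mono)

lemma admissible_measurable_cis:
  assumes "admissible m X" shows "(\<lambda>s. cis (X s)) \<in> measurable unit_leb circle_borel"
  using measurable_compose[OF unit_leb_measurableI[OF admissible_measurable[OF assms]] measurable_cis_circle] .

lemma circle_prob_law: "admissible m X \<Longrightarrow> circle_prob (circle_law X)"
  unfolding circle_law_def by (intro circle_prob_distr prob_space_unit_leb admissible_measurable_cis)

lemma circle_continuous_measurable_borel: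
  "continuous_on circle f \<Longrightarrow> f \<in> borel_measurable circle_borel"
  using borel_measurable_circle[OF circle_prob_haar] circle_prob_measurable[OF circle_prob_haar] by blast

lemma integral_circle_law:
  fixes f :: "complex \<Rightarrow> 'b::{banach,second_countable_topology}"
  assumes "admissible m X" "continuous_on circle f"
  shows "(\<integral>a. f a \<partial>circle_law X) = (\<integral>s. f (cis (X s)) \<partial>unit_leb)"
  unfolding circle_law_def
  by (intro integral_distr admissible_measurable_cis[OF assms(1)] circle_continuous_measurable_borel assms)

lemma integrable_bounded_unit_leb:
  fixes X :: "real \<Rightarrow> real"
  assumes "X \<in> borel_measurable borel" "\<And>s. \<bar>X s\<bar> \<le> B"
  shows "integrable unit_leb X"
  using assms by (intro unit_leb.integrable_const_bound[of _ B] AE_I2) auto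

text \<open>The mean lies in the window [u, u + 2 pi], which confines u to a compact range. Without
  a prescribed mean, translations by multiples of 2 pi would destroy compactness.\<close>

lemma admissible_bounds:
  assumes X: "admissible m X"
  obtains u where "m - 2 * pi \<le> u" "u \<le> m" "\<And>s. u \<le> X s" "\<And>s. X s \<le> u + 2 * pi"
    "\<And>s. \<bar>X s\<bar> \<le> \<bar>m\<bar> + 2 * pi"
proof -
  obtain u where u: "\<And>s. u \<le> X s" "\<And>s. X s \<le> u + 2 * pi" using X by (auto simp: admissible_def)
  have i: "integrable unit_leb X"
  proof (rule integrable_bounded_unit_leb)
    show "\<bar>X s\<bar> \<le> \<bar>u\<bar> + 2 * pi" for s using u[of s] pi_gt_zero by linarith
  qed (use X in measurable)
  have m: "(\<integral>s. X s \<partial>unit_leb) = m" using X by (simp add: admissible_def)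
  have "(\<integral>s. u \<partial>unit_leb) \<le> (\<integral>s. X s \<partial>unit_leb)" using u i by (intro integral_mono) auto
  hence 1: "u \<le> m" by (simp add: m unit_leb.prob_space)
  have "(\<integral>s. X s \<partial>unit_leb) \<le> (\<integral>s. u + 2 * pi \<partial>unit_leb)" using u i by (intro integral_mono) auto
  hence 2: "m \<le> u + 2 * pi" by (simp add: m unit_leb.prob_space)
  show ?thesis
  proof (rule that[of u])
    show "\<bar>X s\<bar> \<le> \<bar>m\<bar> + 2 * pi" for s using u[of s] 1 2 pi_gt_zero by linarith
  qed (use u 1 2 in auto)
qed

lemma admissible_integrable: "admissible m X \<Longrightarrow> integrable unit_leb X"
  by (rule admissible_bounds, assumption, rule integrable_bounded_unit_leb) (auto intro: admissible_measurable)

text \<open>The left ends of the windows converge along a further extraction together with the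
  functions. Convergence fails at most at the countably many discontinuities of the limit, and
  bounded convergence preserves the mean.\<close>

lemma admissible_compact:
  fixes X :: "nat \<Rightarrow> real \<Rightarrow> real"
  assumes X: "\<And>n. admissible m (X n)"
  obtains r Y where "strict_mono (r :: nat \<Rightarrow> nat)" "admissible m Y" "AE s in unit_leb. (\<lambda>n. X (r n) s) \<longlonglongrightarrow> Y s"
proof -
  have "\<exists>u. m - 2 * pi \<le> u \<and> u \<le> m \<and> (\<forall>s. u \<le> X n s \<and> X n s \<le> u + 2 * pi \<and> \<bar>X n s\<bar> \<le> \<bar>m\<bar> + 2 * pi)" for n
    by (rule admissible_bounds[OF X[of n]]) blast
  hence "\<exists>u. \<forall>n. m - 2 * pi \<le> u n \<and> u n \<le> m \<and> (\<forall>s. u n \<le> X n s \<and> X n s \<le> u n + 2 * pi \<and> \<bar>X n s\<bar> \<le> \<bar>m\<bar> + 2 * pi)"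
    by (intro choice allI)
  then obtain u where u: "\<And>n. u n \<in> {m - 2 * pi..m}" "\<And>n s. u n \<le> X n s" "\<And>n s. X n s \<le> u n + 2 * pi"
     "\<And>n s. \<bar>X n s\<bar> \<le> \<bar>m\<bar> + 2 * pi"
    by auto
  obtain l r1 where r1: "strict_mono (r1 :: nat \<Rightarrow> nat)" "(u \<circ> r1) \<longlonglongrightarrow> l"
    using compact_Icc[of "m - 2 * pi" m, unfolded compact_def] u(1) by metis
  obtain r2 F where r2: "strict_mono (r2 :: nat \<Rightarrow> nat)" and F: "\<And>x. continuous (at_right x) F" "mono F"
    "\<And>x. continuous (at x) F \<Longrightarrow> (\<lambda>n. X (r1 (r2 n)) x) \<longlonglongrightarrow> F x"
    using Helly_selection[of "\<lambda>n. X (r1 n)" "\<bar>m\<bar> + 2 * pi"] X u(4) by (auto simp: admissible_def)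
  define D where "D = {x. \<not> isCont F x}"
  have D: "countable D" unfolding D_def by (rule mono_ctble_discont[OF F(2)])
  have conv: "(\<lambda>n. X (r1 (r2 n)) x) \<longlonglongrightarrow> F x" if "x \<notin> D" for x using F(3)[of x] that by (auto simp: D_def)
  have "(u \<circ> r1 \<circ> r2) \<longlonglongrightarrow> l" by (rule LIMSEQ_subseq_LIMSEQ[OF r1(2) r2])
  hence ul: "(\<lambda>n. u (r1 (r2 n))) \<longlonglongrightarrow> l" by (simp add: o_def)
  have bd: "l \<le> F x" "F x \<le> l + 2 * pi" if "x \<notin> D" for x
  proof -
    show "l \<le> F x" by (rule LIMSEQ_le[OF ul conv[OF that]]) (use u(2) in auto)
    show "F x \<le> l + 2 * pi"
      by (rule LIMSEQ_le[OF conv[OF that] tendsto_add[OF ul tendsto_const]]) (use u(3) in auto)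
  qed
  \<comment> \<open>The bounds come from points of convergence only; monotonicity carries them to
    the exceptional points, using a good point on each side.\<close>
  have bd': "l \<le> F x \<and> F x \<le> l + 2 * pi" for x
  proof
    obtain y where "y \<in> {x - 1<..<x}" "y \<notin> D" using real_interval_avoid_countable_set[of "x - 1" x D] D by auto
    thus "l \<le> F x" using bd(1)[of y] monoD[OF F(2), of y x] by auto
    obtain y where "y \<in> {x<..<x + 1}" "y \<notin> D" using real_interval_avoid_countable_set[of x "x + 1" D] D by auto
    thus "F x \<le> l + 2 * pi" using bd(2)[of y] monoD[OF F(2), of x y] by auto
  qed
  have ae: "AE s in unit_leb. (\<lambda>n. X ((r1 \<circ> r2) n) s) \<longlonglongrightarrow> F s"
  proof (rule AE_unit_lebI)
    have "AE s in lborel. s \<notin> D" by (rule AE_not_in) (rule countable_imp_null_set_lborel[OF D])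
    thus "AE s in lborel. (\<lambda>n. X ((r1 \<circ> r2) n) s) \<longlonglongrightarrow> F s"
      by eventually_elim (use conv in simp)
  qed
  have Fm: "F \<in> borel_measurable borel" using F(2) by (rule borel_measurable_mono)
  have "(\<lambda>n. \<integral>s. X ((r1 \<circ> r2) n) s \<partial>unit_leb) \<longlonglongrightarrow> (\<integral>s. F s \<partial>unit_leb)"
  proof (rule integral_dominated_convergence[where w="\<lambda>_. \<bar>m\<bar> + 2 * pi"])
    show "F \<in> borel_measurable unit_leb" "\<And>n. X ((r1 \<circ> r2) n) \<in> borel_measurable unit_leb"
      using Fm admissible_measurable[OF X] by (auto intro: unit_leb_measurableI)
  qed (use ae u(4) in auto)
  moreover have "(\<lambda>n. \<integral>s. X ((r1 \<circ> r2) n) s \<partial>unit_leb) = (\<lambda>_. m)" using X by (simp add: admissible_def)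
  ultimately have "(\<lambda>_::nat. m) \<longlonglongrightarrow> (\<integral>s. F s \<partial>unit_leb)" by (simp only:)
  hence "(\<integral>s. F s \<partial>unit_leb) = m" by (simp add: LIMSEQ_const_iff)
  hence "admissible m F" using F bd' by (auto simp: admissible_def)
  thus ?thesis using that[of "r1 \<circ> r2" F] strict_mono_o[OF r1(1) r2] ae by simp
qed

lemma cis_eq_cisE:
  assumes "cis x = cis y" obtains k :: int where "x = y + 2 * pi * k"
proof -
  have "exp (\<i> * x) = exp (\<i> * y)" using assms by (simp add: cis_conv_exp)
  then obtain n :: int where "\<i> * x = \<i> * y + of_int (2 * n) * of_real pi * \<i>" by (auto simp: exp_eq)
  hence "\<i> * (complex_of_real x) = \<i> * (of_real (y + 2 * pi * n))" by (simp add: algebra_simps)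
  hence "complex_of_real x = of_real (y + 2 * pi * n)" by (simp only: mult_cancel_left) auto
  hence "x = y + 2 * pi * n" by (simp only: of_real_eq_iff)
  thus ?thesis by (rule that)
qed

section \<open>Uniqueness of the lift with a given mean\<close>

text \<open>Let X have the lower window, starting at u. If Y s \<le> t < u + 2 pi, then
  \<open>cis (Y s)\<close> lies in the arc from u to t, and for X lying in that arc means X s \<le>
  t. Equality of the laws thus makes the sublevel sets of X at least as large as those of Y, whence
  X \<le> Y almost everywhere, and equal means force equality.\<close>

lemma admissible_unique:
  assumes X: "admissible m X" and Y: "admissible m Y" and eq: "circle_law X = circle_law Y"
    and atomless: "\<And>z. cmod z = 1 \<Longrightarrow> emeasure (circle_law X) {z} = 0"
  shows "AE s in unit_leb. X s = Y s"
proof -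
  have key: "AE s in unit_leb. X s = Y s"
    if X: "admissible m X" and Y: "admissible m Y" and eq: "circle_law X = circle_law Y"
      and at: "\<And>z. cmod z = 1 \<Longrightarrow> emeasure (circle_law X) {z} = 0"
      and u: "\<And>s. u \<le> X s" "\<And>s. X s \<le> u + 2 * pi" and v: "\<And>s. v \<le> Y s" and uv: "u \<le> v"
    for X Y u v
  proof -
    note mX [measurable] = admissible_measurable[OF X] and mY [measurable] = admissible_measurable[OF Y]
    have sp: "space unit_leb = {0<..<1}" by (simp add: space_restrict_space)
    \<comment> \<open>The right end of the window has the same image on the circle as the left end
      u, so it would spoil the arc argument. It is reached with probability 0 since the law has no
      atoms.\<close>
    have nullX: "AE s in unit_leb. X s \<noteq> u + 2 * pi"
    proof (rule AE_I')
      let ?S = "{s \<in> space unit_leb. cis (X s) \<in> {cis u}}"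
      have "emeasure unit_leb ?S = emeasure (circle_law X) {cis u}"
        unfolding circle_law_def
        by (subst emeasure_distr[OF admissible_measurable_cis[OF X]])
           (auto simp: circle_borel_def sets_restrict_space_iff vimage_def intro!: arg_cong[where f="emeasure unit_leb"])
      hence "emeasure unit_leb ?S = 0" using at[of "cis u"] by simp
      moreover have "?S \<in> sets unit_leb"
        using measurable_sets[OF admissible_measurable_cis[OF X], of "{cis u}"]
        by (auto simp: circle_borel_def sets_restrict_space_iff vimage_def Int_def conj_commute)
      ultimately show "?S \<in> null_sets unit_leb" by auto
      show "{s \<in> space unit_leb. \<not> X s \<noteq> u + 2 * pi} \<subseteq> ?S" by (auto simp flip: cis_mult)
    qed
    have le: "emeasure unit_leb {s \<in> space unit_leb. Y s \<le> t} \<le> emeasure unit_leb {s \<in> space unit_leb. X s \<le> t}" for t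
    proof (cases "t < u + 2 * pi")
      case False
      have "X s \<le> t" for s using u(2)[of s] False by linarith
      hence "{s \<in> space unit_leb. X s \<le> t} = space unit_leb" by blast
      thus ?thesis by (simp only: emeasure_space)
    next
      case True
      define A where "A = cis ` {u..t}"
      have Ac: "compact A" unfolding A_def by (intro compact_continuous_image continuous_intros compact_Icc)
      have As: "A \<in> sets circle_borel"
        using Ac by (auto simp: circle_borel_def sets_restrict_space_iff borel_compact A_def)
      have law: "emeasure (circle_law Z) A = emeasure unit_leb {s \<in> space unit_leb. cis (Z s) \<in> A}"
        if "admissible m Z" for Z
        unfolding circle_law_def
        by (subst emeasure_distr[OF admissible_measurable_cis[OF that] As])
           (auto simp: vimage_def intro!: arg_cong[where f="emeasure unit_leb"])
      have meas: "{s \<in> space unit_leb. cis (Z s) \<in> A} \<in> sets unit_leb" if "admissible m Z" for Z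
        using measurable_sets[OF admissible_measurable_cis[OF that] As] by (simp add: vimage_def Int_def conj_commute)
      have "emeasure unit_leb {s \<in> space unit_leb. Y s \<le> t} \<le> emeasure unit_leb {s \<in> space unit_leb. cis (Y s) \<in> A}"
      proof (rule emeasure_mono[OF _ meas[OF Y]])
        show "{s \<in> space unit_leb. Y s \<le> t} \<subseteq> {s \<in> space unit_leb. cis (Y s) \<in> A}"
          unfolding A_def using order_trans[OF uv v] by (auto intro!: imageI)
      qed
      also have "\<dots> = emeasure unit_leb {s \<in> space unit_leb. cis (X s) \<in> A}"
        using law[OF X] law[OF Y] eq by simp
      also have "\<dots> \<le> emeasure unit_leb {s \<in> space unit_leb. X s \<le> t}"
      proof (rule emeasure_mono_AE)
        show "AE s in unit_leb. s \<in> {s \<in> space unit_leb. cis (X s) \<in> A} \<longrightarrow> s \<in> {s \<in> space unit_leb. X s \<le> t}"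
          using nullX
        proof eventually_elim
          case (elim s)
          show ?case
          proof safe
            assume "cis (X s) \<in> A"
            then obtain y where y: "u \<le> y" "y \<le> t" "cis (X s) = cis y" by (auto simp: A_def)
            obtain k :: int where k: "X s = y + 2 * pi * k" using cis_eq_cisE[OF y(3)] .
            have "X s < u + 2 * pi" using u(2)[of s] elim by simp
            hence "2 * pi * k < 2 * pi * 1" using k y(1) by linarith
            hence "k < 1" using pi_gt_zero by simp
            hence "2 * pi * real_of_int k \<le> 2 * pi * 0" by (intro mult_left_mono) auto
            thus "X s \<le> t" using k y by simp
          qed
        qed
        show "{s \<in> space unit_leb. X s \<le> t} \<in> sets unit_leb" by measurable
      qed
      finally show ?thesis .
    qed
    \<comment> \<open>Sublevel sets of monotone functions are initial segments, hence nested, so the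
      comparison of their measures becomes an inclusion up to a null set.\<close>
    have "AE s in unit_leb. Y s \<le> t \<longrightarrow> X s \<le> t" for t
    proof -
      let ?A = "{s \<in> space unit_leb. Y s \<le> t}" and ?B = "{s \<in> space unit_leb. X s \<le> t}"
      have ms: "?A \<in> sets unit_leb" "?B \<in> sets unit_leb" by measurable
      show ?thesis
      proof (cases "?A \<subseteq> ?B")
        case True
        thus ?thesis by (intro AE_I2) auto
      next
        case False
        then obtain s0 where s0: "s0 \<in> space unit_leb" "Y s0 \<le> t" "\<not> X s0 \<le> t" by auto
        have "?B \<subseteq> ?A"
        proof safe
          fix s assume "X s \<le> t"
          hence "\<not> s0 \<le> s" using s0 X monoD[of X s0 s] by (auto simp: admissible_def)
          thus "Y s \<le> t" using s0 Y monoD[of Y s s0] by (auto simp: admissible_def)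
        qed
        hence "emeasure unit_leb (?A - ?B) = emeasure unit_leb ?A - emeasure unit_leb ?B"
          using ms by (intro emeasure_Diff) auto
        also have "\<dots> = 0" using le[of t] by (simp add: diff_eq_0_iff_ennreal unit_leb.emeasure_eq_measure)
        finally have "?A - ?B \<in> null_sets unit_leb" using ms by auto
        thus ?thesis by (rule AE_I') auto
      qed
    qed
    hence "AE s in unit_leb. \<forall>t\<in>\<rat>. Y s \<le> t \<longrightarrow> X s \<le> t" by (intro AE_ball_countable') (auto simp: countable_rat)
    hence "AE s in unit_leb. X s \<le> Y s"
    proof eventually_elim
      case (elim s)
      show ?case
      proof (rule ccontr)
        assume "\<not> X s \<le> Y s"
        then obtain q where "q \<in> \<rat>" "Y s < q" "q < X s" using Rats_dense_in_real[of "Y s" "X s"] by auto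
        thus False using elim by fastforce
      qed
    qed
    hence nn: "AE s in unit_leb. 0 \<le> Y s - X s" by simp
    have i: "integrable unit_leb X" "integrable unit_leb Y" using X Y admissible_integrable by auto
    have "(\<integral>s. Y s - X s \<partial>unit_leb) = 0" using X Y i by (simp add: admissible_def)
    hence "AE s in unit_leb. Y s - X s = 0"
      using integral_nonneg_eq_0_iff_AE[OF Bochner_Integration.integrable_diff[OF i(2,1)] nn] by simp
    thus ?thesis by eventually_elim simp
  qed
  obtain u where u: "\<And>s. u \<le> X s" "\<And>s. X s \<le> u + 2 * pi" using X by (auto simp: admissible_def)
  obtain v where v: "\<And>s. v \<le> Y s" "\<And>s. Y s \<le> v + 2 * pi" using Y by (auto simp: admissible_def)
  show ?thesis
  proof (cases "u \<le> v")
    case True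
    show ?thesis by (rule key[OF X Y eq atomless u v(1) True])
  next
    case False
    have "AE s in unit_leb. Y s = X s"
      by (rule key[OF Y X eq[symmetric] atomless[unfolded eq] v u(1)]) (use False in auto)
    thus ?thesis by eventually_elim simp
  qed
qed

lemma cis_add_2pi: "cis (x + 2 * pi) = cis x"
  by (simp add: complex_eq_iff)

text \<open>For \<epsilon> L \<le> 1 the map x + \<epsilon> g(cis x) is nondecreasing, and it
  commutes with translation by 2 pi, so the window keeps its length. The mean is kept because g has
  mean 0 under the law.\<close>

lemma admissible_transport:
  assumes X: "admissible m X" and g: "continuous_on circle g"
    and L: "\<And>x y. \<bar>g (cis x) - g (cis y)\<bar> \<le> L * \<bar>x - y\<bar>"
    and mean: "(\<integral>a. g a \<partial>circle_law X) = 0" and \<epsilon>: "0 \<le> \<epsilon>" "\<epsilon> * L \<le> 1"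
  shows "admissible m (\<lambda>s. X s + \<epsilon> * g (cis (X s)))"
    and "circle_law (\<lambda>s. X s + \<epsilon> * g (cis (X s))) = distr (circle_law X) circle_borel (transport g \<epsilon>)"
proof -
  define \<phi> where "\<phi> x = x + \<epsilon> * g (cis x)" for x
  have c\<phi>: "continuous_on UNIV \<phi>"
    unfolding \<phi>_def by (intro continuous_intros continuous_on_compose2[OF g]) auto
  have mono: "mono \<phi>"
  proof (rule monoI)
    fix x y :: real assume xy: "x \<le> y"
    have "\<epsilon> * (g (cis x) - g (cis y)) \<le> \<epsilon> * (L * \<bar>x - y\<bar>)"
      using L[of x y] \<epsilon> by (intro mult_left_mono) auto
    also have "\<dots> = (\<epsilon> * L) * (y - x)" using xy by simp
    also have "\<dots> \<le> 1 * (y - x)" using \<epsilon> xy by (intro mult_right_mono) auto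
    finally show "\<phi> x \<le> \<phi> y" by (simp add: \<phi>_def algebra_simps)
  qed
  have per: "\<phi> (x + 2 * pi) = \<phi> x + 2 * pi" for x unfolding \<phi>_def cis_add_2pi by simp
  obtain u where u: "\<And>s. u \<le> X s" "\<And>s. X s \<le> u + 2 * pi" using X by (auto simp: admissible_def)
  have gm: "(\<lambda>s. g (cis (X s))) \<in> borel_measurable unit_leb"
    using measurable_compose[OF admissible_measurable_cis[OF X] circle_continuous_measurable_borel[OF g]] .
  obtain B where B: "B > 0" "\<And>x. cmod x = 1 \<Longrightarrow> norm (g x) \<le> B" using circle_bounded[OF g] by blast
  have gi: "integrable unit_leb (\<lambda>s. g (cis (X s)))"
    by (rule unit_leb.integrable_const_bound[of _ B]) (use B gm in auto)
  show "admissible m (\<lambda>s. X s + \<epsilon> * g (cis (X s)))"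
    unfolding admissible_def
  proof (intro conjI allI)
    show "mono (\<lambda>s. X s + \<epsilon> * g (cis (X s)))"
      using X mono by (auto simp: admissible_def mono_def \<phi>_def)
    show "continuous (at_right x) (\<lambda>s. X s + \<epsilon> * g (cis (X s)))" for x
    proof -
      have "continuous (at_right x) (\<lambda>s. \<phi> (X s))"
        using X c\<phi> unfolding continuous_within
        by (intro isCont_tendsto_compose[of _ \<phi>]) (auto simp: admissible_def continuous_on_eq_continuous_at continuous_within)
      thus ?thesis by (simp add: \<phi>_def)
    qed
    show "\<exists>u. \<forall>s. u \<le> X s + \<epsilon> * g (cis (X s)) \<and> X s + \<epsilon> * g (cis (X s)) \<le> u + 2 * pi"
    proof (intro exI[of _ "\<phi> u"] allI conjI)
      fix s
      show "\<phi> u \<le> X s + \<epsilon> * g (cis (X s))" using monoD[OF mono u(1)[of s]] by (simp add: \<phi>_def)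
      show "X s + \<epsilon> * g (cis (X s)) \<le> \<phi> u + 2 * pi"
        using monoD[OF mono u(2)[of s]] unfolding per by (simp add: \<phi>_def)
    qed
    have "(\<integral>s. g (cis (X s)) \<partial>unit_leb) = 0" using mean integral_circle_law[OF X g] by simp
    thus "(\<integral>s. X s + \<epsilon> * g (cis (X s)) \<partial>unit_leb) = m"
      using admissible_integrable[OF X] gi X by (simp add: admissible_def)
  qed
  have "transport g \<epsilon> \<in> measurable circle_borel circle_borel"
    using transport_measurable[OF circle_prob_haar g] circle_prob_measurable[OF circle_prob_haar] by blast
  hence "distr (circle_law X) circle_borel (transport g \<epsilon>) = distr unit_leb circle_borel (transport g \<epsilon> \<circ> (\<lambda>s. cis (X s)))"
    unfolding circle_law_def by (intro distr_distr admissible_measurable_cis[OF X])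
  also have "transport g \<epsilon> \<circ> (\<lambda>s. cis (X s)) = (\<lambda>s. cis (X s + \<epsilon> * g (cis (X s))))"
    by (auto simp: transport_def cis_mult fun_eq_iff)
  finally show "circle_law (\<lambda>s. X s + \<epsilon> * g (cis (X s))) = distr (circle_law X) circle_borel (transport g \<epsilon>)"
    by (simp add: circle_law_def)
qed

section \<open>Lifts of circle measures and their quantile functions\<close>

text \<open>For u between 0 and 2 pi this is the branch of the argument with values in [u, u + 2
  pi), so the restricted lift becomes a push-forward.\<close>

definition arg_from :: "real \<Rightarrow> complex \<Rightarrow> real" where
  "arg_from u z = (if Arg2pi z < u then Arg2pi z + 2 * pi else Arg2pi z)"

lemma measurable_Arg2pi_circle: "circle_prob M \<Longrightarrow> Arg2pi \<in> borel_measurable M"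
  using measurable_compose[OF borel_measurable_circle[of M "\<lambda>z. z"] measurable_Arg2pi]
  by (auto intro: continuous_intros)

lemma arg_from_measurable: "circle_prob M \<Longrightarrow> arg_from u \<in> borel_measurable M"
  unfolding arg_from_def[abs_def] using measurable_Arg2pi_circle by measurable

lemma arg_from_bounds:
  assumes "u \<in> {0..2 * pi}" shows "u \<le> arg_from u z" "arg_from u z \<le> u + 2 * pi"
  using Arg2pi[of z] assms by (auto simp: arg_from_def)

lemma cis_arg_from: "cmod z = 1 \<Longrightarrow> cis (arg_from u z) = z"
  using Arg2pi_eq[of z] by (auto simp: arg_from_def cis_add_2pi cis_conv_exp[of "Arg2pi z"])

lemma sets_circle_lift: "sets (circle_lift M) = sets borel"
  using sets.sigma_sets_eq[of "borel :: real measure"] by (simp add: circle_lift_def sets_measure_of)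

lemma lift_from_eq:
  assumes M: "circle_prob M" and u: "u \<in> {0..2 * pi}"
  shows "lift_from M u = distr M borel (arg_from u)"
proof (rule measure_eqI)
  show "sets (lift_from M u) = sets (distr M borel (arg_from u))"
    by (simp add: lift_from_def sets_circle_lift)
  fix A assume "A \<in> sets (lift_from M u)"
  hence A: "A \<in> sets borel" by (simp add: lift_from_def sets_circle_lift)
  note sp = circle_probD(3)[OF M]
  note [measurable] = measurable_Arg2pi_circle[OF M]
  let ?B = "{u..<u + 2 * pi} \<inter> A"
  let ?f = "\<lambda>n::int. emeasure M {z \<in> circle. Arg2pi z + 2 * of_int n * pi \<in> ?B}"
  have "emeasure (lift_from M u) A = emeasure (circle_lift M) ?B"
    unfolding lift_from_def using A by (intro emeasure_restricted) (auto simp: sets_circle_lift)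
  also have "\<dots> = (\<integral>\<^sup>+ n. ?f n \<partial>count_space UNIV)"
    using A unfolding cis_lift_image[symmetric] by (intro emeasure_circle_lift[OF M]) auto
  \<comment> \<open>For u in [0, 2 pi] the window [u, u + 2 pi) meets only the copies 0 and 1 of the
    fundamental domain.\<close>
  also have "\<dots> = (\<Sum>n\<in>{0, 1}. ?f n)"
  proof (rule nn_integral_count_space')
    fix n :: int assume n: "n \<notin> {0, 1}"
    have "Arg2pi z + 2 * of_int n * pi \<notin> ?B" for z
    proof
      assume "Arg2pi z + 2 * of_int n * pi \<in> ?B"
      hence b: "u \<le> Arg2pi z + 2 * of_int n * pi" "Arg2pi z + 2 * of_int n * pi < u + 2 * pi" by auto
      have z: "0 \<le> Arg2pi z" "Arg2pi z < 2 * pi" "0 \<le> u" "u \<le> 2 * pi" using Arg2pi[of z] u by auto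
      have "n \<ge> 2 \<or> n \<le> - 1" using n by auto
      thus False
      proof
        assume "n \<ge> 2"
        hence "2 * 2 * pi \<le> 2 * of_int n * pi" by (intro mult_right_mono) auto
        thus False using b z by linarith
      next
        assume "n \<le> - 1"
        hence "of_int n \<le> (- 1 :: real)" by linarith
        hence "2 * of_int n * pi \<le> 2 * (- 1) * pi" by (intro mult_right_mono) auto
        thus False using b z by linarith
      qed
    qed
    hence "{z \<in> circle. Arg2pi z + 2 * of_int n * pi \<in> ?B} = {}" by blast
    thus "?f n = 0" by (simp only: emeasure_empty)
  qed auto
  also have "\<dots> = ?f 0 + ?f 1" by simp
  also have "\<dots> = emeasure M ({z \<in> circle. Arg2pi z + 2 * of_int 0 * pi \<in> ?B} \<union> {z \<in> circle. Arg2pi z + 2 * of_int 1 * pi \<in> ?B})"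
  proof (rule plus_emeasure)
    have "{z \<in> space M. Arg2pi z + 2 * of_int n * pi \<in> ?B} \<in> sets M" for n
      using A by measurable
    thus "{z \<in> circle. Arg2pi z + 2 * of_int 0 * pi \<in> ?B} \<in> sets M"
      "{z \<in> circle. Arg2pi z + 2 * of_int 1 * pi \<in> ?B} \<in> sets M" unfolding sp by blast+
  qed auto
  also have "\<dots> = emeasure M (arg_from u -` A \<inter> space M)"
  proof (rule arg_cong[where f="emeasure M"])
    show "{z \<in> circle. Arg2pi z + 2 * of_int 0 * pi \<in> ?B} \<union> {z \<in> circle. Arg2pi z + 2 * of_int 1 * pi \<in> ?B} = arg_from u -` A \<inter> space M"
    proof (rule set_eqI)
      fix z
      show "z \<in> {z \<in> circle. Arg2pi z + 2 * of_int 0 * pi \<in> ?B} \<union> {z \<in> circle. Arg2pi z + 2 * of_int 1 * pi \<in> ?B} \<longleftrightarrow>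
          z \<in> arg_from u -` A \<inter> space M"
        using Arg2pi[of z] u unfolding sp by (auto simp: arg_from_def)
    qed
  qed
  also have "\<dots> = emeasure (distr M borel (arg_from u)) A"
    using A by (intro emeasure_distr[symmetric] arg_from_measurable[OF M])
  finally show "emeasure (lift_from M u) A = emeasure (distr M borel (arg_from u)) A" .
qed

text \<open>Moving the cut from 0 to u adds 2 pi to the arguments below u and leaves the others
  alone.\<close>

lemma lift_from_mean:
  assumes M: "circle_prob M" and u: "u \<in> {0..2 * pi}"
  shows "(\<integral>x. x \<partial>lift_from M u) = (\<integral>z. Arg2pi z \<partial>M) + 2 * pi * measure M {z \<in> circle. Arg2pi z < u}"
proof -
  interpret prob_space M using circle_probD(1)[OF M] .
  note sp = circle_probD(3)[OF M]
  note [measurable] = measurable_Arg2pi_circle[OF M]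
  have S: "{z \<in> circle. Arg2pi z < u} \<in> sets M"
  proof -
    have "{z \<in> space M. Arg2pi z < u} \<in> sets M" by measurable
    thus ?thesis by (simp add: sp)
  qed
  have i: "integrable M Arg2pi"
    by (rule integrable_const_bound[of _ "2 * pi"]) (use Arg2pi in \<open>auto intro!: AE_I2 less_imp_le\<close>)
  have "(\<integral>x. x \<partial>lift_from M u) = (\<integral>z. arg_from u z \<partial>M)"
    unfolding lift_from_eq[OF assms] by (intro integral_distr arg_from_measurable[OF M]) auto
  also have "\<dots> = (\<integral>z. Arg2pi z + 2 * pi * indicator {z \<in> circle. Arg2pi z < u} z \<partial>M)"
    using sp by (intro Bochner_Integration.integral_cong) (auto simp: arg_from_def indicator_def)
  also have "\<dots> = (\<integral>z. Arg2pi z \<partial>M) + 2 * pi * measure M {z \<in> circle. Arg2pi z < u}"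
    using i S by (subst Bochner_Integration.integral_add) (auto simp: less_top[symmetric])
  finally show ?thesis .
qed

text \<open>Without atoms the mean of the lift of M moves continuously from a to a + 2 pi as u
  crosses one period. As a and b both lie in [0, 2 pi], this range contains b or b + 2 pi, the means
  of the lift of N cut at 0 and at 2 pi. Hence the supremum defining the distance is not over the
  empty set.\<close>

lemma equal_means_exist:
  assumes M: "circle_prob M" and N: "circle_prob N"
    and atomless: "\<And>z. cmod z = 1 \<Longrightarrow> emeasure M {z} = 0"
  obtains u v where "u \<in> {0..2 * pi}" "v \<in> {0..2 * pi}"
    "(\<integral>x. x \<partial>lift_from M u) = (\<integral>x. x \<partial>lift_from N v)"
proof -
  interpret M: prob_space M using circle_probD(1)[OF M] .
  interpret N: prob_space N using circle_probD(1)[OF N] .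
  note sp = circle_probD(3)[OF M] circle_probD(3)[OF N]
  note mM [measurable] = measurable_Arg2pi_circle[OF M] and mN [measurable] = measurable_Arg2pi_circle[OF N]
  define \<nu> where "\<nu> = distr M borel Arg2pi"
  interpret \<nu>: real_distribution \<nu> unfolding \<nu>_def by (rule M.real_distribution_distr) simp
  have single: "measure M {z \<in> circle. Arg2pi z = u} = 0" for u
  proof -
    have "{z \<in> circle. Arg2pi z = u} \<subseteq> {cis u}" 
    proof
      fix z assume "z \<in> {z \<in> circle. Arg2pi z = u}"
      thus "z \<in> {cis u}" using Arg2pi_eq[of z] by (simp add: cis_conv_exp)
    qed
    moreover have "{cis u} \<in> sets M" using circle_probD(2)[OF M] by (auto simp: circle_borel_def sets_restrict_space_iff)
    ultimately have "measure M {z \<in> circle. Arg2pi z = u} \<le> measure M {cis u}" by (intro M.finite_measure_mono)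
    also have "\<dots> = 0" using atomless[of "cis u"] by (simp add: measure_def)
    finally show ?thesis using measure_nonneg[of M] by (simp add: order_antisym)
  qed
  have cdf_eq: "cdf \<nu> u = measure M {z \<in> circle. Arg2pi z < u}" for u
  proof -
    have m: "{z \<in> space M. Arg2pi z < u} \<in> sets M" "{z \<in> space M. Arg2pi z = u} \<in> sets M" by measurable
    have "cdf \<nu> u = measure M {z \<in> circle. Arg2pi z \<le> u}"
      unfolding cdf_def \<nu>_def by (subst measure_distr) (auto simp: sp vimage_def intro!: arg_cong[where f="measure M"])
    also have "{z \<in> circle. Arg2pi z \<le> u} = {z \<in> circle. Arg2pi z < u} \<union> {z \<in> circle. Arg2pi z = u}" by auto
    also have "measure M \<dots> = measure M {z \<in> circle. Arg2pi z < u} + measure M {z \<in> circle. Arg2pi z = u}"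
      using m unfolding sp by (intro M.finite_measure_Union) auto
    finally show ?thesis using single by simp
  qed
  have cont: "isCont (cdf \<nu>) u" for u
  proof -
    have "measure \<nu> {u} = measure M {z \<in> circle. Arg2pi z = u}"
      unfolding \<nu>_def by (subst measure_distr) (auto simp: sp vimage_def intro!: arg_cong[where f="measure M"])
    thus ?thesis using single by (simp add: \<nu>.isCont_cdf)
  qed
  define a b where "a = (\<integral>z. Arg2pi z \<partial>M)" and "b = (\<integral>z. Arg2pi z \<partial>N)"
  have FM: "(\<integral>x. x \<partial>lift_from M u) = a + 2 * pi * cdf \<nu> u" if "u \<in> {0..2 * pi}" for u
    using lift_from_mean[OF M that] by (simp add: a_def cdf_eq)
  have 0: "{z \<in> circle. Arg2pi z < 0} = {}" using Arg2pi(1) by (auto simp: not_less[symmetric])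
  have 1: "{z \<in> circle. Arg2pi z < 2 * pi} = circle" using Arg2pi by auto
  have c0: "cdf \<nu> 0 = 0" and c1: "cdf \<nu> (2 * pi) = 1"
    using M.prob_space unfolding cdf_eq 0 1 sp by auto
  have FN0: "(\<integral>x. x \<partial>lift_from N 0) = b" using lift_from_mean[OF N, of 0] unfolding 0 by (simp add: b_def)
  have FN1: "(\<integral>x. x \<partial>lift_from N (2 * pi)) = b + 2 * pi"
    using lift_from_mean[OF N, of "2 * pi"] N.prob_space unfolding 1 sp by (simp add: b_def)
  have bnd: "0 \<le> c \<and> c \<le> 2 * pi" if "circle_prob P" "c = (\<integral>z. Arg2pi z \<partial>P)" for P c
  proof -
    interpret P: prob_space P using circle_probD(1)[OF that(1)] .
    note [measurable] = measurable_Arg2pi_circle[OF that(1)]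
    have i: "integrable P Arg2pi"
      by (rule P.integrable_const_bound[of _ "2 * pi"]) (use Arg2pi in \<open>auto intro!: AE_I2 less_imp_le\<close>)
    have "(\<integral>z. 0 \<partial>P) \<le> (\<integral>z. Arg2pi z \<partial>P)" using i Arg2pi by (intro integral_mono) auto
    moreover have "(\<integral>z. Arg2pi z \<partial>P) \<le> (\<integral>z. 2 * pi \<partial>P)" using i Arg2pi by (intro integral_mono) (auto intro: less_imp_le)
    ultimately show ?thesis by (simp add: that(2) P.prob_space)
  qed
  note ab = bnd[OF M a_def] bnd[OF N b_def]
  have ivt: "\<exists>u\<in>{0..2 * pi}. a + 2 * pi * cdf \<nu> u = y" if "a \<le> y" "y \<le> a + 2 * pi" for y
  proof -
    have "\<exists>u. 0 \<le> u \<and> u \<le> 2 * pi \<and> a + 2 * pi * cdf \<nu> u = y"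
      by (rule IVT) (use that c0 c1 cont in \<open>auto intro!: continuous_intros\<close>)
    thus ?thesis by auto
  qed
  show ?thesis
  proof (cases "a \<le> b")
    case True
    then obtain u where "u \<in> {0..2 * pi}" "a + 2 * pi * cdf \<nu> u = b" using ivt[of b] ab by auto
    thus ?thesis using that[of u 0] FM FN0 by auto
  next
    case False
    then obtain u where "u \<in> {0..2 * pi}" "a + 2 * pi * cdf \<nu> u = b + 2 * pi" using ivt[of "b + 2 * pi"] ab by auto
    thus ?thesis using that[of u "2 * pi"] FM FN1 by auto
  qed
qed

text \<open>Helly's selection theorem is stated for right continuous functions, which is why
  admissibility asks for it. Taking right limits changes a monotone function only at its countably
  many discontinuities.\<close>

lemma right_continuous_version:
  fixes f :: "real \<Rightarrow> real"
  assumes f: "mono f" and b: "\<And>x. l \<le> f x" "\<And>x. f x \<le> r"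
  obtains g where "mono g" "\<And>x. continuous (at_right x) g" "\<And>x. l \<le> g x \<and> g x \<le> r"
    "AE x in lborel. g x = f x"
proof -
  define g where "g x = (INF t\<in>{x<..}. f t)" for x
  have bb: "bdd_below (f ` S)" for S using b(1) by (auto simp: bdd_below_def)
  have le: "g x \<le> f t" if "x < t" for x t unfolding g_def using that bb by (intro cINF_lower) auto
  have ge: "c \<le> g x" if "\<And>t. x < t \<Longrightarrow> c \<le> f t" for x c
    unfolding g_def using that by (intro cINF_greatest) (auto simp: gt_ex)
  have gm: "g x \<le> g y" if "x \<le> y" for x y by (intro ge le) (use that in auto)
  show ?thesis
  proof (rule that)
    show "mono g" using gm by (rule monoI)
    show "continuous (at_right x) g" for x
    proof (subst continuous_at_right_real_increasing[OF gm], safe)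
      fix e :: real assume e: "e > 0"
      have "\<exists>t>x. f t < g x + e"
      proof (rule ccontr)
        assume "\<not> (\<exists>t>x. f t < g x + e)"
        hence "g x + e \<le> g x" by (intro ge) auto
        thus False using e by simp
      qed
      then obtain t where t: "t > x" "f t < g x + e" by blast
      have "g (x + (t - x) / 2) \<le> f t" using t by (intro le) (auto simp: field_simps)
      thus "\<exists>d>0. g (x + d) - g x < e" using t by (intro exI[of _ "(t - x) / 2"]) auto
    qed
    show "l \<le> g x \<and> g x \<le> r" for x using le[of x "x + 1"] b(2)[of "x + 1"] ge b(1) by auto
    have D: "countable {x. \<not> isCont f x}" by (rule mono_ctble_discont[OF f])
    have "AE x in lborel. x \<notin> {x. \<not> isCont f x}" by (rule AE_not_in) (rule countable_imp_null_set_lborel[OF D])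
    thus "AE x in lborel. g x = f x"
    proof eventually_elim
      case (elim x)
      have "f x \<le> g x" by (intro ge monoD[OF f]) auto
      moreover have "g x \<le> f x"
      proof (rule tendsto_lowerbound)
        show "(f \<longlongrightarrow> f x) (at_right x)" using elim by (auto simp: isCont_def intro: tendsto_within_subset filterlim_at_split[THEN iffD1, THEN conjunct2])
        show "\<forall>\<^sub>F t in at_right x. g x \<le> f t"
          using eventually_at_right_less[of x] by eventually_elim (rule le)
      qed simp
      ultimately show ?case by simp
    qed
  qed
qed

lemma lift_quantile:
  assumes M: "circle_prob M" and u: "u \<in> {0..2 * pi}"
  obtains X where "admissible (\<integral>x. x \<partial>lift_from M u) X" "distr unit_leb borel X = lift_from M u"
    "circle_law X = M"
proof -
  interpret M: prob_space M using circle_probD(1)[OF M] .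
  note [measurable] = arg_from_measurable[OF M]
  have leq: "lift_from M u = distr M borel (arg_from u)" by (rule lift_from_eq[OF M u])
  interpret R: real_distribution "lift_from M u" unfolding leq by (rule M.real_distribution_distr) simp
  interpret C: cdf_distribution "lift_from M u" by unfold_locales
  define q where "q s = C.I s" for s
  have q: "distr unit_leb borel q = lift_from M u" unfolding q_def[abs_def] by (rule C.distr_I_eq_M)
  have qm [measurable]: "q \<in> borel_measurable unit_leb"
    using C.measurable_CI unfolding q_def[abs_def] by (simp cong: measurable_cong_sets add: sets_restrict_space)
  have qmono: "q s \<le> q t" if "0 < s" "s \<le> t" "t < 1" for s t
    using C.mono_I that by (auto simp: mono_on_def q_def)
  have "AE x in lift_from M u. u \<le> x \<and> x \<le> u + 2 * pi"
    unfolding leq by (subst AE_distr_iff) (use arg_from_bounds[OF u] in auto)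
  hence qb: "AE s in unit_leb. u \<le> q s \<and> q s \<le> u + 2 * pi"
    unfolding q[symmetric] by (rule AE_distrD[rotated]) simp
  \<comment> \<open>The quantile function is controlled only on (0, 1), and lies in the window only
    almost everywhere; it is clamped there and extended by the two ends of the window to a monotone
    function on the whole line.\<close>
  define f where "f s = (if s \<le> 0 then u else if s \<ge> 1 then u + 2 * pi else max u (min (u + 2 * pi) (q s)))" for s
  have fb: "u \<le> f s" "f s \<le> u + 2 * pi" for s by (auto simp: f_def)
  have "mono f"
  proof (rule monoI)
    fix s t :: real assume st: "s \<le> t"
    consider "s \<le> 0" | "t \<ge> 1" | "0 < s" "t < 1" by linarith
    thus "f s \<le> f t"
    proof cases
      case 3
      thus ?thesis using qmono[OF _ st] st by (simp add: f_def min_def max_def)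
    qed (use fb[of s] fb[of t] in \<open>auto simp: f_def\<close>)
  qed
  from right_continuous_version[OF this, of u "u + 2 * pi"] fb obtain X where X: "mono X" "\<And>x. continuous (at_right x) X"
     "\<And>x. u \<le> X x \<and> X x \<le> u + 2 * pi" "AE x in lborel. X x = f x" by auto
  have Xm [measurable]: "X \<in> borel_measurable borel" using X(1) by (rule borel_measurable_mono)
  have "AE s in unit_leb. X s = f s" using X(4) by (rule AE_unit_lebI)
  moreover have "AE s in unit_leb. s \<in> space unit_leb" by (rule AE_space)
  ultimately have Xq: "AE s in unit_leb. X s = q s" using qb
    by eventually_elim (auto simp: f_def space_restrict_space)
  have law: "distr unit_leb borel X = lift_from M u"
    unfolding q[symmetric] using Xq by (intro distr_cong_AE) auto
  have mean: "(\<integral>s. X s \<partial>unit_leb) = (\<integral>x. x \<partial>lift_from M u)"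
    unfolding law[symmetric] by (rule integral_distr[symmetric]) simp_all
  have adm: "admissible (\<integral>x. x \<partial>lift_from M u) X" using X mean by (auto simp: admissible_def)
  have "circle_law X = distr (distr unit_leb borel X) circle_borel cis"
    unfolding circle_law_def by (subst distr_distr) (auto simp: o_def)
  also have "\<dots> = distr M circle_borel (cis \<circ> arg_from u)"
    unfolding law leq by (rule distr_distr) simp_all
  also have "\<dots> = distr M M (\<lambda>z. z)"
    using circle_probD(2,3)[OF M] by (intro distr_cong) (auto simp: cis_arg_from)
  also have "\<dots> = M" by (rule distr_id)
  finally show ?thesis using that adm law by blast
qed

text \<open>The joint law of X and Y over the same parameter is a competitor in the infimum over
  couplings.\<close>

lemma wasserstein_le:
  assumes X: "admissible m X" and Y: "admissible m' Y"
    and law: "distr unit_leb borel X = \<mu>" "distr unit_leb borel Y = \<nu>"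
  shows "(wasserstein 2 \<mu> \<nu>)\<^sup>2 \<le> ennreal (\<integral>s. (X s - Y s)\<^sup>2 \<partial>unit_leb)"
proof -
  note [measurable] = admissible_measurable[OF X] admissible_measurable[OF Y]
  have "\<exists>B. \<forall>s. \<bar>X s\<bar> \<le> B" "\<exists>B. \<forall>s. \<bar>Y s\<bar> \<le> B"
    by (rule admissible_bounds[OF X], blast) (rule admissible_bounds[OF Y], blast)
  then obtain B B' where B: "\<And>s. \<bar>X s\<bar> \<le> B" and B': "\<And>s. \<bar>Y s\<bar> \<le> B'" by blast
  have i: "integrable unit_leb (\<lambda>s. (X s - Y s)\<^sup>2)"
  proof (rule integrable_bounded_unit_leb)
    show "\<bar>(X s - Y s)\<^sup>2\<bar> \<le> (B + B')\<^sup>2" for s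
      using B[of s] B'[of s] power_mono[of "\<bar>X s - Y s\<bar>" "B + B'" 2] by simp
  qed measurable
  define I where "I = (INF \<pi>\<in>couplings \<mu> \<nu>. \<integral>\<^sup>+ (x, y). ennreal (\<bar>x - y\<bar> powr 2) \<partial>\<pi>)"
  define \<pi> where "\<pi> = distr unit_leb borel (\<lambda>s. (X s, Y s))"
  have pm: "(\<lambda>s. (X s, Y s)) \<in> measurable unit_leb (borel :: (real \<times> real) measure)"
    by (intro unit_leb_measurableI borel_measurable_Pair) measurable
  have "\<pi> \<in> couplings \<mu> \<nu>"
  proof -
    have "fst \<in> borel_measurable (borel :: (real \<times> real) measure)" "snd \<in> borel_measurable (borel :: (real \<times> real) measure)"
      by (intro borel_measurable_continuous_onI continuous_intros)+
    thus ?thesis unfolding couplings_def \<pi>_def law[symmetric] using pm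
      by (simp add: distr_distr o_def)
  qed
  hence "I \<le> (\<integral>\<^sup>+ (x, y). ennreal (\<bar>x - y\<bar> powr 2) \<partial>\<pi>)" unfolding I_def by (rule INF_lower)
  also have "\<dots> = (\<integral>\<^sup>+ s. ennreal ((X s - Y s)\<^sup>2) \<partial>unit_leb)"
  proof -
    have "(\<lambda>p :: real \<times> real. (fst p - snd p)\<^sup>2) \<in> borel_measurable borel"
      by (intro borel_measurable_continuous_onI continuous_intros)
    thus ?thesis
      unfolding \<pi>_def case_prod_beta by (subst nn_integral_distr[OF pm]) (auto simp: powr_numeral)
  qed
  also have "\<dots> = ennreal (\<integral>s. (X s - Y s)\<^sup>2 \<partial>unit_leb)"
    using i by (intro nn_integral_eq_integral) auto
  finally have le: "I \<le> ennreal (\<integral>s. (X s - Y s)\<^sup>2 \<partial>unit_leb)" .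
  then obtain r where r: "I = ennreal r" "r \<ge> 0" by (cases I) (auto simp: top_unique)
  have "(wasserstein 2 \<mu> \<nu>)\<^sup>2 = (ennreal (r powr (1 / 2)))\<^sup>2"
    unfolding wasserstein_def I_def[symmetric] by (simp add: ennreal_powr_def r)
  also have "\<dots> = ennreal r" using r by (simp add: ennreal_power powr_half_sqrt)
  finally show ?thesis using le r by simp
qed

section \<open>The potential\<close>

lemma cis_Arg_unit: "cmod z = 1 \<Longrightarrow> cis (Arg z) = z"
  using cis_Arg[of z] by (cases "z = 0") (simp_all add: sgn_div_norm)

text \<open>Near w0 the angle Arg w0 + Arg (w / w0) is a continuous branch of the argument, even at
  the cut of the principal one.\<close>

lemma continuous_on_circle_lift:
  fixes f :: "complex \<Rightarrow> 'b::topological_space"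
  assumes "\<And>x. isCont (\<lambda>t. f (cis t)) x"
  shows "continuous_on circle f"
  unfolding continuous_on_eq_continuous_within
proof
  fix w0 :: complex assume "w0 \<in> circle"
  hence w0: "cmod w0 = 1" by simp
  let ?t = "Arg w0"
  have nz: "w0 \<noteq> 0" using w0 by auto
  have "isCont (\<lambda>w. Arg (w / w0)) w0"
  proof (rule isCont_o2[where f="\<lambda>w. w / w0" and g=Arg])
    show "isCont (\<lambda>w. w / w0) w0" using nz by (intro continuous_intros)
    show "isCont Arg (w0 / w0)" using nz by (intro continuous_at_Arg) (auto simp: complex_nonpos_Reals_iff)
  qed
  hence "isCont (\<lambda>w. ?t + Arg (w / w0)) w0" by (intro continuous_add continuous_const)
  hence "isCont (\<lambda>w. f (cis (?t + Arg (w / w0)))) w0"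
    by (rule isCont_o2[where g="\<lambda>t. f (cis t)"]) (rule assms)
  hence 1: "continuous (at w0 within circle) (\<lambda>w. f (cis (?t + Arg (w / w0))))"
    by (rule continuous_at_imp_continuous_at_within)
  have 2: "f (cis (?t + Arg (w / w0))) = f w" if "cmod w = 1" for w
  proof -
    have "cis (?t + Arg (w / w0)) = cis ?t * cis (Arg (w / w0))" by (rule cis_mult[symmetric])
    also have "\<dots> = w0 * (w / w0)" using that w0 by (simp add: cis_Arg_unit norm_divide)
    also have "\<dots> = w" using nz by simp
    finally show ?thesis by simp
  qed
  show "continuous (at w0 within circle) f"
    by (rule continuous_transform_within[OF 1 zero_less_one]) (use w0 2 in simp_all)
qed

lemma circle_C1_derivative:
  assumes "circle_C1 Q"
  shows "((\<lambda>t. Q (cis t)) has_real_derivative circle_deriv Q (cis x)) (at x)"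
proof -
  have "(\<lambda>t. Q (cis x * cis t)) differentiable at 0"
    using assms by (auto simp: circle_C1_def circle_differentiable_def)
  then obtain D where D: "((\<lambda>t. Q (cis x * cis t)) has_real_derivative D) (at 0)"
    by (auto simp: real_differentiable_def)
  hence "circle_deriv Q (cis x) = D" unfolding circle_deriv_def by (rule DERIV_imp_deriv)
  moreover have "((\<lambda>t. Q (cis (t + x))) has_real_derivative D) (at 0)"
    using D by (simp add: cis_mult add.commute)
  hence "((\<lambda>t. Q (cis t)) has_real_derivative D) (at (0 + x))" by (subst DERIV_shift)
  ultimately show ?thesis by simp
qed

lemma circle_C1_continuous:
  assumes "circle_C1 Q" shows "continuous_on circle Q" "continuous_on circle (circle_deriv Q)"
  using assms DERIV_isCont[OF circle_C1_derivative[OF assms]]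
  by (auto simp: circle_C1_def intro: continuous_on_circle_lift)

lemma cmod_cis_diff_le: "cmod (cis x - cis y) \<le> \<bar>x - y\<bar>"
  unfolding cmod_cis_diff using abs_sin_x_le_abs_x[of "(x - y) / 2"] by simp

text \<open>With only one continuous derivative the remainder is small relative to \<tau> rather
  than quadratic; uniform continuity of the derivative and the mean value theorem make it uniform in
  x.\<close>

lemma circle_C1_increment:
  assumes Q: "circle_C1 Q" and e: "e > 0"
  obtains d where "d > 0"
    "\<And>x \<tau>. \<bar>\<tau>\<bar> \<le> d \<Longrightarrow> Q (cis (x + \<tau>)) \<le> Q (cis x) + \<tau> * circle_deriv Q (cis x) + e * \<bar>\<tau>\<bar>"
proof -
  have "uniformly_continuous_on circle (circle_deriv Q)"
    using circle_C1_continuous[OF Q] compact_sphere compact_uniformly_continuous by blast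
  then obtain d where d: "d > 0" "\<And>x y. cmod x = 1 \<Longrightarrow> cmod y = 1 \<Longrightarrow> dist y x < d \<Longrightarrow> dist (circle_deriv Q y) (circle_deriv Q x) < e"
    using e unfolding uniformly_continuous_on_def by (metis mem_sphere_0)
  show ?thesis
  proof (rule that[of "d / 2"])
    fix x \<tau> :: real assume \<tau>: "\<bar>\<tau>\<bar> \<le> d / 2"
    have close: "\<bar>circle_deriv Q (cis z) - circle_deriv Q (cis x)\<bar> \<le> e" if "\<bar>z - x\<bar> \<le> \<bar>\<tau>\<bar>" for z
      using d(2)[of "cis x" "cis z"] cmod_cis_diff_le[of z x] that \<tau> d(1)
      by (auto simp: dist_norm intro!: less_imp_le)
    have "\<exists>z. \<bar>z - x\<bar> \<le> \<bar>\<tau>\<bar> \<and> Q (cis (x + \<tau>)) - Q (cis x) = \<tau> * circle_deriv Q (cis z)"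
    proof (cases "\<tau> = 0")
      case False
      show ?thesis
      proof (cases "\<tau> > 0")
        case True
        then obtain z where "x < z" "z < x + \<tau>" "Q (cis (x + \<tau>)) - Q (cis x) = (x + \<tau> - x) * circle_deriv Q (cis z)"
          using MVT2[of x "x + \<tau>" "\<lambda>t. Q (cis t)" "\<lambda>t. circle_deriv Q (cis t)"] circle_C1_derivative[OF Q] by auto
        thus ?thesis by (intro exI[of _ z]) auto
      next
        case n: False
        then obtain z where "x + \<tau> < z" "z < x" "Q (cis x) - Q (cis (x + \<tau>)) = (x - (x + \<tau>)) * circle_deriv Q (cis z)"
          using False MVT2[of "x + \<tau>" x "\<lambda>t. Q (cis t)" "\<lambda>t. circle_deriv Q (cis t)"] circle_C1_derivative[OF Q] by auto
        thus ?thesis by (intro exI[of _ z]) (auto simp: algebra_simps)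
      qed
    qed auto
    then obtain z where z: "\<bar>z - x\<bar> \<le> \<bar>\<tau>\<bar>" "Q (cis (x + \<tau>)) - Q (cis x) = \<tau> * circle_deriv Q (cis z)" by blast
    have "\<tau> * (circle_deriv Q (cis z) - circle_deriv Q (cis x)) \<le> \<bar>\<tau>\<bar> * e"
    proof -
      have "\<tau> * (circle_deriv Q (cis z) - circle_deriv Q (cis x)) \<le> \<bar>\<tau> * (circle_deriv Q (cis z) - circle_deriv Q (cis x))\<bar>" by simp
      also have "\<dots> \<le> \<bar>\<tau>\<bar> * e" unfolding abs_mult using close[OF z(1)] by (intro mult_left_mono) auto
      finally show ?thesis .
    qed
    thus "Q (cis (x + \<tau>)) \<le> Q (cis x) + \<tau> * circle_deriv Q (cis x) + e * \<bar>\<tau>\<bar>"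
      using z(2) by (simp add: algebra_simps)
  qed (use d in auto)
qed

lemma herglotz_Lipschitz:
  assumes "cmod a = 1" "cmod b = 1" "cmod w = 1" "0 \<le> s" "s < 1"
  shows "cmod (herglotz s w a - herglotz s w b) \<le> 2 / (1 - s)\<^sup>2 * cmod (a - b)"
proof -
  have nz: "a - s * w \<noteq> 0" "b - s * w \<noteq> 0" using circle_diff_nz assms by blast+
  have lb: "1 - s \<le> cmod (c - s * w)" if "cmod c = 1" for c
    using norm_triangle_ineq2[of c "s * w"] that assms by (simp add: norm_mult)
  have "herglotz s w a - herglotz s w b = (2 * s * w * (b - a)) / ((a - s * w) * (b - s * w))"
    using nz unfolding herglotz_def by (simp add: divide_simps) (simp add: algebra_simps)
  hence "cmod (herglotz s w a - herglotz s w b) = (2 * s * cmod (a - b)) / (cmod (a - s * w) * cmod (b - s * w))"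
    using assms by (simp add: norm_mult norm_divide norm_minus_commute)
  also have "\<dots> \<le> (2 * 1 * cmod (a - b)) / ((1 - s) * (1 - s))"
    using assms lb by (intro frac_le mult_mono) auto
  finally show ?thesis by (simp add: power2_eq_square)
qed

text \<open>Needed for \<open>admissible_transport\<close>. The constant degenerates as s tends to
  1, which is harmless because s stays fixed while the displacement tends to 0.\<close>

lemma poisson_mean_Lipschitz:
  assumes s: "0 \<le> s" "s < 1" and h: "continuous_on circle h"
  obtains L where "L > 0" "\<And>x y. \<bar>poisson_mean h s (cis x) - poisson_mean h s (cis y)\<bar> \<le> L * \<bar>x - y\<bar>"
proof -
  obtain B where B: "B > 0" "\<And>x. cmod x = 1 \<Longrightarrow> norm (h x) \<le> B" using circle_bounded[OF h] by blast
  interpret H: prob_space circle_haar using circle_probD(1)[OF circle_prob_haar] .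
  define L where "L = B * (2 / (1 - s)\<^sup>2)"
  have L: "L > 0" using B s by (simp add: L_def)
  show ?thesis
  proof (rule that[OF L])
    fix x y :: real
    have i: "integrable circle_haar (\<lambda>w. h w * poisson s w (cis x))" for x
      by (intro circle_integrable[OF circle_prob_haar] continuous_intros h s) simp
    have "poisson_mean h s (cis x) - poisson_mean h s (cis y) = (\<integral>w. h w * poisson s w (cis x) - h w * poisson s w (cis y) \<partial>circle_haar)"
      unfolding poisson_mean_def by (rule Bochner_Integration.integral_diff[symmetric, OF i i])
    also have "\<bar>\<dots>\<bar> \<le> (\<integral>w. L * \<bar>x - y\<bar> \<partial>circle_haar)"
    proof (rule integral_abs_bound_integral)
      fix w assume "w \<in> space circle_haar"
      hence w: "cmod w = 1" using circle_probD(3)[OF circle_prob_haar] by simp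
      have "\<bar>h w * poisson s w (cis x) - h w * poisson s w (cis y)\<bar> = \<bar>h w\<bar> * \<bar>Re (herglotz s w (cis x) - herglotz s w (cis y))\<bar>"
        by (simp add: abs_mult flip: right_diff_distrib)
      also have "\<dots> \<le> B * (2 / (1 - s)\<^sup>2 * \<bar>x - y\<bar>)"
      proof (intro mult_mono)
        have "\<bar>Re (herglotz s w (cis x) - herglotz s w (cis y))\<bar> \<le> cmod (herglotz s w (cis x) - herglotz s w (cis y))"
          by (rule abs_Re_le_cmod)
        also have "\<dots> \<le> 2 / (1 - s)\<^sup>2 * cmod (cis x - cis y)" by (rule herglotz_Lipschitz) (use w s in auto)
        also have "\<dots> \<le> 2 / (1 - s)\<^sup>2 * \<bar>x - y\<bar>" by (intro mult_left_mono cmod_cis_diff_le) auto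
        finally show "\<bar>Re (herglotz s w (cis x) - herglotz s w (cis y))\<bar> \<le> 2 / (1 - s)\<^sup>2 * \<bar>x - y\<bar>" .
      qed (use B w in auto)
      finally show "\<bar>h w * poisson s w (cis x) - h w * poisson s w (cis y)\<bar> \<le> L * \<bar>x - y\<bar>" by (simp add: L_def)
    qed (use i in auto)
    finally show "\<bar>poisson_mean h s (cis x) - poisson_mean h s (cis y)\<bar> \<le> L * \<bar>x - y\<bar>"
      using H.prob_space by simp
  qed
qed

section \<open>Square integrable functions\<close>

lemma integral_Cauchy_Schwarz:
  fixes f g :: "'a \<Rightarrow> real"
  assumes f: "integrable M (\<lambda>x. (f x)\<^sup>2)" and g: "integrable M (\<lambda>x. (g x)\<^sup>2)"
    and fg: "integrable M (\<lambda>x. f x * g x)"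
  shows "(\<integral>x. f x * g x \<partial>M) \<le> sqrt (\<integral>x. (f x)\<^sup>2 \<partial>M) * sqrt (\<integral>x. (g x)\<^sup>2 \<partial>M)"
proof -
  define a b c where "a = (\<integral>x. (f x)\<^sup>2 \<partial>M)" and "b = (\<integral>x. (g x)\<^sup>2 \<partial>M)" and "c = (\<integral>x. f x * g x \<partial>M)"
  have q: "0 \<le> t\<^sup>2 * a - 2 * t * c + b" for t
  proof -
    have "0 \<le> (\<integral>x. (t * f x - g x)\<^sup>2 \<partial>M)" by simp
    also have "(\<integral>x. (t * f x - g x)\<^sup>2 \<partial>M) = (\<integral>x. (t\<^sup>2 * (f x)\<^sup>2 - (2 * t) * (f x * g x)) + (g x)\<^sup>2 \<partial>M)"
      by (intro Bochner_Integration.integral_cong) (auto simp: power2_eq_square algebra_simps)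
    also have "\<dots> = t\<^sup>2 * a - 2 * t * c + b"
      using f g fg by (subst Bochner_Integration.integral_add) (auto simp: a_def b_def c_def)
    finally show ?thesis .
  qed
  have a: "a \<ge> 0" and b: "b \<ge> 0" by (auto simp: a_def b_def)
  have "c\<^sup>2 \<le> a * b"
  proof (cases "a = 0")
    case False
    have "0 \<le> (c / a)\<^sup>2 * a - 2 * (c / a) * c + b" by (rule q)
    also have "\<dots> = b - c\<^sup>2 / a" using False by (simp add: field_simps power2_eq_square)
    finally show ?thesis using False a by (simp add: field_simps)
  next
    case True
    have "c = 0"
    proof (rule ccontr)
      assume "c \<noteq> 0"
      \<comment> \<open>When a = 0 the quadratic form is affine in t, and this t gives it the value
        -1.\<close>
      thus False using q[of "(b + 1) / (2 * c)"] True b by (simp add: field_simps)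
    qed
    thus ?thesis using True by simp
  qed
  hence "sqrt (c\<^sup>2) \<le> sqrt (a * b)" by (rule real_sqrt_le_mono)
  thus ?thesis by (simp add: a_def[symmetric] b_def[symmetric] c_def[symmetric] real_sqrt_mult abs_le_iff)
qed

definition L2_dist :: "(real \<Rightarrow> real) \<Rightarrow> (real \<Rightarrow> real) \<Rightarrow> real" where
  "L2_dist X Y = sqrt (\<integral>s. (X s - Y s)\<^sup>2 \<partial>unit_leb)"

lemma integrable_product_bounded:
  fixes f g :: "real \<Rightarrow> real"
  assumes "f \<in> borel_measurable unit_leb" "g \<in> borel_measurable unit_leb" "\<And>s. \<bar>f s\<bar> \<le> A" "\<And>s. \<bar>g s\<bar> \<le> B"
  shows "integrable unit_leb (\<lambda>s. f s * g s)"
proof (rule unit_leb.integrable_const_bound[of _ "A * B"])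
  have "0 \<le> A" using assms(3)[of 0] by linarith
  thus "AE s in unit_leb. norm (f s * g s) \<le> A * B"
    using assms(3,4) by (intro AE_I2) (auto simp: abs_mult intro!: mult_mono)
qed (use assms in measurable)

lemma admissible_bounded: "admissible m X \<Longrightarrow> \<bar>X s\<bar> \<le> \<bar>m\<bar> + 2 * pi"
  by (erule admissible_bounds) blast

lemma L2_dist_triangle:
  assumes X: "admissible m X" and Y: "admissible m Y" and Z: "admissible m Z"
  shows "L2_dist X Z \<le> L2_dist X Y + L2_dist Y Z"
proof -
  note [measurable] = unit_leb_measurableI[OF admissible_measurable[OF X]] unit_leb_measurableI[OF admissible_measurable[OF Y]]
    unit_leb_measurableI[OF admissible_measurable[OF Z]]
  define f g where "f s = X s - Y s" and "g s = Y s - Z s" for s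
  let ?B = "2 * (\<bar>m\<bar> + 2 * pi)"
  have fg: "\<bar>f s\<bar> \<le> ?B" "\<bar>g s\<bar> \<le> ?B" for s
    using admissible_bounded[OF X, of s] admissible_bounded[OF Y, of s] admissible_bounded[OF Z, of s] by (auto simp: f_def g_def)
  have m: "f \<in> borel_measurable unit_leb" "g \<in> borel_measurable unit_leb" unfolding f_def g_def by measurable
  have i: "integrable unit_leb (\<lambda>s. f s * g s)" "integrable unit_leb (\<lambda>s. (f s)\<^sup>2)" "integrable unit_leb (\<lambda>s. (g s)\<^sup>2)"
    unfolding power2_eq_square using m fg by (auto intro!: integrable_product_bounded)
  define a b c where "a = (\<integral>x. (f x)\<^sup>2 \<partial>unit_leb)" and "b = (\<integral>x. (g x)\<^sup>2 \<partial>unit_leb)" and "c = (\<integral>x. f x * g x \<partial>unit_leb)"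
  have cs: "c \<le> sqrt a * sqrt b" unfolding a_def b_def c_def by (intro integral_Cauchy_Schwarz i)
  have ab: "0 \<le> a" "0 \<le> b" by (auto simp: a_def b_def)
  have "(\<integral>s. (X s - Z s)\<^sup>2 \<partial>unit_leb) = (\<integral>s. ((f s)\<^sup>2 + 2 * (f s * g s)) + (g s)\<^sup>2 \<partial>unit_leb)"
    by (intro Bochner_Integration.integral_cong) (auto simp: f_def g_def power2_eq_square algebra_simps)
  also have "\<dots> = a + 2 * c + b"
    using i by (subst Bochner_Integration.integral_add) (auto simp: a_def b_def c_def)
  also have "\<dots> \<le> (sqrt a + sqrt b)\<^sup>2" using cs ab by (simp add: power2_sum)
  finally have "sqrt (\<integral>s. (X s - Z s)\<^sup>2 \<partial>unit_leb) \<le> sqrt ((sqrt a + sqrt b)\<^sup>2)" by (rule real_sqrt_le_mono)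
  thus ?thesis using ab by (simp add: L2_dist_def a_def b_def f_def g_def)
qed

section \<open>Uniqueness of the equilibrium measure\<close>

text \<open>Since \<open>enn2real\<close> sends infinity to 0, this is the energy only where
  \<open>log_energy\<close> is finite, and every comparison of free energies carries that side
  condition.\<close>

definition free_energy :: "(complex \<Rightarrow> real) \<Rightarrow> complex measure \<Rightarrow> real" where
  "free_energy Q M = (\<integral>a. Q a \<partial>M) + enn2real (log_energy M)"

lemma energy_eq_free_energy:
  assumes "circle_prob M" "log_energy M < \<infinity>"
  shows "energy Q M = ereal (free_energy Q M)"
  using assms by (cases "log_energy M") (auto simp: energy_eq free_energy_def)

lemma log_energy_haar: "log_energy circle_haar = 0"
proof -
  have "(cmod (moment circle_haar n))\<^sup>2 / real n = 0" for n by (cases n) (auto simp: haar_moment)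
  thus ?thesis unfolding log_energy_def by (simp only:) simp
qed

lemma equilibriumD:
  assumes "equilibrium_measure Q \<mu>"
  shows "circle_prob \<mu>" "log_energy \<mu> < \<infinity>"
    "\<And>M. circle_prob M \<Longrightarrow> log_energy M < \<infinity> \<Longrightarrow> free_energy Q \<mu> \<le> free_energy Q M"
proof -
  show \<mu>: "circle_prob \<mu>" using assms by (auto simp: equilibrium_measure_def is_arg_min_def)
  have le: "\<not> energy Q M < energy Q \<mu>" if "circle_prob M" for M
    using assms that by (auto simp: equilibrium_measure_def is_arg_min_def)
  show fin: "log_energy \<mu> < \<infinity>"
  proof (rule ccontr)
    assume "\<not> log_energy \<mu> < \<infinity>"
    hence "log_energy \<mu> = \<infinity>" by (simp add: less_top[symmetric])
    hence "energy Q \<mu> = \<infinity>" by (simp add: energy_eq[OF \<mu>])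
    \<comment> \<open>Haar measure has zero logarithmic energy, since its moments of positive order
      vanish; it is the competitor that rules out infinite energy.\<close>
    moreover have "energy Q circle_haar < \<infinity>"
      by (subst energy_eq_free_energy) (auto simp: circle_prob_haar log_energy_haar)
    ultimately show False using le[OF circle_prob_haar] by simp
  qed
  show "free_energy Q \<mu> \<le> free_energy Q M" if "circle_prob M" "log_energy M < \<infinity>" for M
    using le[OF that(1)] energy_eq_free_energy[OF that] energy_eq_free_energy[OF \<mu> fin] by simp
qed

text \<open>The average of M and N is realized as the law obtained by letting a fair coin choose a
  coordinate of a point distributed by the product measure.\<close>

lemma circle_midpoint:
  assumes M: "circle_prob M" and N: "circle_prob N"
  obtains P where "circle_prob P"
    "\<And>f :: complex \<Rightarrow> complex. continuous_on circle f \<Longrightarrow> (\<integral>a. f a \<partial>P) = ((\<integral>a. f a \<partial>M) + (\<integral>a. f a \<partial>N)) / 2"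
proof -
  let ?b = "measure_pmf (bernoulli_pmf (1 / 2))"
  interpret MN: pair_prob_space M N by (rule circle_pair_prob[OF M N])
  interpret B: pair_prob_space ?b "M \<Otimes>\<^sub>M N" by unfold_locales
  define \<phi> where "\<phi> = (\<lambda>(b, p :: complex \<times> complex). if b then fst p else snd p)"
  have m1: "fst \<in> measurable (M \<Otimes>\<^sub>M N) circle_borel" "snd \<in> measurable (M \<Otimes>\<^sub>M N) circle_borel"
    using measurable_fst[of M N] measurable_snd[of M N] circle_probD(2)[OF M] circle_probD(2)[OF N]
    by (simp_all cong: measurable_cong_sets)
  have \<phi>m: "\<phi> \<in> measurable (?b \<Otimes>\<^sub>M (M \<Otimes>\<^sub>M N)) circle_borel"
    unfolding \<phi>_def case_prod_beta
    by (intro measurable_If measurable_compose[OF measurable_snd] m1) (auto simp: pred_def)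
  define P where "P = distr (?b \<Otimes>\<^sub>M (M \<Otimes>\<^sub>M N)) circle_borel \<phi>"
  have P: "circle_prob P" unfolding P_def by (intro circle_prob_distr \<phi>m B.P.prob_space_axioms)
  show ?thesis
  proof (rule that[OF P])
    fix f :: "complex \<Rightarrow> complex" assume f: "continuous_on circle f"
    have fm: "f \<in> borel_measurable circle_borel" by (rule circle_continuous_measurable_borel[OF f])
    obtain K where K: "K > 0" "\<And>x. cmod x = 1 \<Longrightarrow> norm (f x) \<le> K" using circle_bounded[OF f] by blast
    have int: "integrable (?b \<Otimes>\<^sub>M (M \<Otimes>\<^sub>M N)) (\<lambda>x. f (\<phi> x))"
    proof (rule B.P.integrable_const_bound[of _ K])
      show "AE x in ?b \<Otimes>\<^sub>M (M \<Otimes>\<^sub>M N). norm (f (\<phi> x)) \<le> K"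
        using K circle_probD(3)[OF M] circle_probD(3)[OF N] by (intro AE_I2) (auto simp: space_pair_measure \<phi>_def)
    qed (rule measurable_compose[OF \<phi>m fm])
    have "(\<integral>a. f a \<partial>P) = (\<integral>x. f (\<phi> x) \<partial>(?b \<Otimes>\<^sub>M (M \<Otimes>\<^sub>M N)))"
      unfolding P_def by (rule integral_distr[OF \<phi>m fm])
    also have "\<dots> = (\<integral>b. \<integral>p. f (\<phi> (b, p)) \<partial>(M \<Otimes>\<^sub>M N) \<partial>?b)"
      using B.integral_fst'[OF int] by simp
    also have "\<dots> = (\<Sum>b\<in>UNIV. pmf (bernoulli_pmf (1 / 2)) b *\<^sub>R (\<integral>p. f (\<phi> (b, p)) \<partial>(M \<Otimes>\<^sub>M N)))"
      by (rule integral_measure_pmf) auto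
    also have "\<dots> = ((\<integral>p. f (fst p) \<partial>(M \<Otimes>\<^sub>M N)) + (\<integral>p. f (snd p) \<partial>(M \<Otimes>\<^sub>M N))) / 2"
      by (simp add: UNIV_bool \<phi>_def scaleR_conv_of_real field_simps)
    also have "(\<integral>p. f (fst p) \<partial>(M \<Otimes>\<^sub>M N)) = (\<integral>a. f a \<partial>M)"
    proof -
      have "(\<integral>p. f (fst p) \<partial>(M \<Otimes>\<^sub>M N)) = (\<integral>a. \<integral>b. f (fst (a, b)) \<partial>N \<partial>M)"
        by (rule circle_Fubini(2)[OF M N]) (auto intro!: continuous_on_compose2[OF f] continuous_intros)
      thus ?thesis by (simp add: MN.M2.prob_space)
    qed
    also have "(\<integral>p. f (snd p) \<partial>(M \<Otimes>\<^sub>M N)) = (\<integral>a. f a \<partial>N)"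
    proof -
      have "(\<integral>p. f (snd p) \<partial>(M \<Otimes>\<^sub>M N)) = (\<integral>a. \<integral>b. f (snd (a, b)) \<partial>N \<partial>M)"
        by (rule circle_Fubini(2)[OF M N]) (auto intro!: continuous_on_compose2[OF f] continuous_intros)
      thus ?thesis by (simp add: MN.M1.prob_space)
    qed
    finally show "(\<integral>a. f a \<partial>P) = ((\<integral>a. f a \<partial>M) + (\<integral>a. f a \<partial>N)) / 2" .
  qed
qed

text \<open>Strict convexity: two different minimizers differ in some moment of positive order, and
  the parallelogram identity for that moment puts the energy of their average strictly below the
  minimum.\<close>

lemma equilibrium_unique:
  assumes eq: "equilibrium_measure Q \<mu>" and Q: "continuous_on circle Q"
    and M: "circle_prob M" "log_energy M < \<infinity>" and le: "free_energy Q M \<le> free_energy Q \<mu>"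
  shows "M = \<mu>"
proof (rule ccontr)
  assume ne: "M \<noteq> \<mu>"
  note \<mu> = equilibriumD[OF eq]
  obtain k where k: "k > 0" "moment M k \<noteq> moment \<mu> k"
    using circle_moments_eqI[OF M(1) \<mu>(1)] ne by blast
  obtain P where P: "circle_prob P"
    "\<And>f :: complex \<Rightarrow> complex. continuous_on circle f \<Longrightarrow> (\<integral>a. f a \<partial>P) = ((\<integral>a. f a \<partial>M) + (\<integral>a. f a \<partial>\<mu>)) / 2"
    using circle_midpoint[OF M(1) \<mu>(1)] by blast
  have QP: "(\<integral>a. Q a \<partial>P) = ((\<integral>a. Q a \<partial>M) + (\<integral>a. Q a \<partial>\<mu>)) / 2"
  proof -
    have "complex_of_real (\<integral>a. Q a \<partial>P) = of_real (((\<integral>a. Q a \<partial>M) + (\<integral>a. Q a \<partial>\<mu>)) / 2)"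
      using P(2)[of "\<lambda>a. of_real (Q a)"] Q by (simp add: continuous_intros)
    thus ?thesis by (simp only: of_real_eq_iff)
  qed
  have mP: "moment P n = (moment M n + moment \<mu> n) / 2" for n
    unfolding moment_def by (intro P(2) continuous_intros)
  \<comment> \<open>The gain in the k-th term of the series at the midpoint; the gains in all other
    terms are discarded.\<close>
  define d where "d = (cmod (moment M k - moment \<mu> k))\<^sup>2 / (4 * real k)"
  have d: "d > 0" using k by (simp add: d_def)
  have pw: "ennreal ((cmod (moment P n))\<^sup>2 / real n) + (if n = k then ennreal d else 0) \<le>
     ennreal (1 / 2) * ennreal ((cmod (moment M n))\<^sup>2 / real n) + ennreal (1 / 2) * ennreal ((cmod (moment \<mu> n))\<^sup>2 / real n)" for n
  proof -
    define x y where "x = moment M n" and "y = moment \<mu> n"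
    have "(cmod ((x + y) / 2))\<^sup>2 + (cmod (x - y))\<^sup>2 / 4 = ((cmod x)\<^sup>2 + (cmod y)\<^sup>2) / 2"
    proof -
      have "(cmod (x + y))\<^sup>2 + (cmod (x - y))\<^sup>2 = 2 * (cmod x)\<^sup>2 + 2 * (cmod y)\<^sup>2"
        by (simp add: cmod_power2) (simp add: power2_eq_square algebra_simps)
      thus ?thesis by (simp add: norm_divide power_divide)
    qed
    hence "((cmod ((x + y) / 2))\<^sup>2 + (cmod (x - y))\<^sup>2 / 4) / real n = (((cmod x)\<^sup>2 + (cmod y)\<^sup>2) / 2) / real n"
      by (rule arg_cong[where f="\<lambda>t. t / real n"])
    hence id: "(cmod ((x + y) / 2))\<^sup>2 / real n + (cmod (x - y))\<^sup>2 / (4 * real n) = 1 / 2 * ((cmod x)\<^sup>2 / real n) + 1 / 2 * ((cmod y)\<^sup>2 / real n)"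
      by (simp add: add_divide_distrib)
    have "(if n = k then ennreal d else 0) \<le> ennreal ((cmod (x - y))\<^sup>2 / (4 * real n))"
      by (auto simp: d_def x_def y_def)
    hence "ennreal ((cmod ((x + y) / 2))\<^sup>2 / real n) + (if n = k then ennreal d else 0) \<le>
      ennreal ((cmod ((x + y) / 2))\<^sup>2 / real n) + ennreal ((cmod (x - y))\<^sup>2 / (4 * real n))" by (rule add_left_mono)
    also have "\<dots> = ennreal (1 / 2 * ((cmod x)\<^sup>2 / real n) + 1 / 2 * ((cmod y)\<^sup>2 / real n))"
      unfolding id[symmetric] by (rule ennreal_plus[symmetric]) auto
    also have "\<dots> = ennreal (1 / 2) * ennreal ((cmod x)\<^sup>2 / real n) + ennreal (1 / 2) * ennreal ((cmod y)\<^sup>2 / real n)"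
    proof -
      have em: "ennreal (1 / 2 * t) = ennreal (1 / 2) * ennreal t" if "t \<ge> 0" for t
        using that by (intro ennreal_mult) auto
      have "ennreal (1 / 2 * ((cmod x)\<^sup>2 / real n) + 1 / 2 * ((cmod y)\<^sup>2 / real n)) =
          ennreal (1 / 2 * ((cmod x)\<^sup>2 / real n)) + ennreal (1 / 2 * ((cmod y)\<^sup>2 / real n))"
        by (rule ennreal_plus) auto
      also have "\<dots> = ennreal (1 / 2) * ennreal ((cmod x)\<^sup>2 / real n) + ennreal (1 / 2) * ennreal ((cmod y)\<^sup>2 / real n)"
        by (intro arg_cong2[where f="(+)"] em) auto
      finally show ?thesis .
    qed
    finally show ?thesis unfolding mP x_def y_def .
  qed
  have "log_energy P + ennreal d = (\<Sum>n. ennreal ((cmod (moment P n))\<^sup>2 / real n)) + (\<Sum>n. if n = k then ennreal d else 0)"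
    using sums_unique[OF sums_single[of k "\<lambda>_. ennreal d"]] by (simp add: log_energy_def)
  also have "\<dots> = (\<Sum>n. ennreal ((cmod (moment P n))\<^sup>2 / real n) + (if n = k then ennreal d else 0))"
    by (intro suminf_add) auto
  also have "\<dots> \<le> (\<Sum>n. ennreal (1 / 2) * ennreal ((cmod (moment M n))\<^sup>2 / real n) + ennreal (1 / 2) * ennreal ((cmod (moment \<mu> n))\<^sup>2 / real n))"
    by (intro suminf_le pw) auto
  also have "\<dots> = ennreal (1 / 2) * log_energy M + ennreal (1 / 2) * log_energy \<mu>"
    unfolding log_energy_def ennreal_suminf_cmult[symmetric] by (intro suminf_add[symmetric]) auto
  finally have main: "log_energy P + ennreal d \<le> ennreal (1 / 2) * log_energy M + ennreal (1 / 2) * log_energy \<mu>" .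
  obtain eM where eM: "log_energy M = ennreal eM" "eM \<ge> 0" using M(2) by (cases "log_energy M") auto
  obtain e\<mu> where e\<mu>: "log_energy \<mu> = ennreal e\<mu>" "e\<mu> \<ge> 0" using \<mu>(2) by (cases "log_energy \<mu>") auto
  have "ennreal (1 / 2) * ennreal eM + ennreal (1 / 2) * ennreal e\<mu> = ennreal (1 / 2 * eM) + ennreal (1 / 2 * e\<mu>)"
    using eM e\<mu> by (intro arg_cong2[where f="(+)"] ennreal_mult[symmetric]) auto
  also have "\<dots> = ennreal (1 / 2 * eM + 1 / 2 * e\<mu>)"
    using eM e\<mu> by (intro ennreal_plus[symmetric]) auto
  finally have rhs: "ennreal (1 / 2) * log_energy M + ennreal (1 / 2) * log_energy \<mu> = ennreal (1 / 2 * eM + 1 / 2 * e\<mu>)"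
    by (simp only: eM e\<mu>)
  have "log_energy P \<noteq> \<infinity>" using main unfolding rhs by (auto simp: top_unique)
  then obtain eP where eP: "log_energy P = ennreal eP" "eP \<ge> 0" by (cases "log_energy P") auto
  have "ennreal (eP + d) \<le> ennreal (1 / 2 * eM + 1 / 2 * e\<mu>)" using main d eP unfolding rhs by (simp add: ennreal_plus)
  moreover have "0 \<le> 1 / 2 * eM + 1 / 2 * e\<mu>" using eM e\<mu> by simp
  ultimately have "eP + d \<le> 1 / 2 * eM + 1 / 2 * e\<mu>" by (simp only: ennreal_le_iff)
  hence "free_energy Q P < free_energy Q \<mu>"
    using le d eM e\<mu> eP by (simp add: free_energy_def QP field_simps)
  moreover have "log_energy P < \<infinity>" using eP by simp
  ultimately show False using \<mu>(3)[OF P(1)] by simp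
qed

section \<open>Existence of a minimizer\<close>

lemma tendsto_integral_circle_law:
  fixes f :: "complex \<Rightarrow> 'b::{banach,second_countable_topology}"
  assumes f: "continuous_on circle f" and Z: "\<And>n. admissible m (Z n)" and Y: "admissible m Y"
    and ae: "AE s in unit_leb. (\<lambda>n. Z n s) \<longlonglongrightarrow> Y s"
  shows "(\<lambda>n. \<integral>a. f a \<partial>circle_law (Z n)) \<longlonglongrightarrow> (\<integral>a. f a \<partial>circle_law Y)"
  unfolding integral_circle_law[OF Z f] integral_circle_law[OF Y f]
proof -
  obtain B where B: "B > 0" "\<And>x. cmod x = 1 \<Longrightarrow> norm (f x) \<le> B" using circle_bounded[OF f] by blast
  show "(\<lambda>n. \<integral>s. f (cis (Z n s)) \<partial>unit_leb) \<longlonglongrightarrow> (\<integral>s. f (cis (Y s)) \<partial>unit_leb)"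
  proof (rule integral_dominated_convergence[where w="\<lambda>_. B"])
    show "AE s in unit_leb. (\<lambda>n. f (cis (Z n s))) \<longlonglongrightarrow> f (cis (Y s))"
      using ae
    proof eventually_elim
      case (elim s)
      have "continuous_on UNIV (\<lambda>t. f (cis t))" by (intro continuous_on_compose2[OF f] continuous_intros) auto
      thus ?case using elim by (intro isCont_tendsto_compose[of _ "\<lambda>t. f (cis t)"]) (auto simp: continuous_on_eq_continuous_at)
    qed
    show "(\<lambda>s. f (cis (Y s))) \<in> borel_measurable unit_leb"
      by (rule measurable_compose[OF admissible_measurable_cis[OF Y] circle_continuous_measurable_borel[OF f]])
    show "(\<lambda>s. f (cis (Z n s))) \<in> borel_measurable unit_leb" for n
      by (rule measurable_compose[OF admissible_measurable_cis[OF Z] circle_continuous_measurable_borel[OF f]])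
  qed (use B in auto)
qed

lemma log_energy_partial_sum:
  assumes "log_energy M < \<infinity>"
  shows "(\<Sum>k<N. (cmod (moment M k))\<^sup>2 / real k) \<le> enn2real (log_energy M)"
proof -
  obtain e where e: "log_energy M = ennreal e" "e \<ge> 0" using assms by (cases "log_energy M") auto
  have "ennreal (\<Sum>k<N. (cmod (moment M k))\<^sup>2 / real k) = (\<Sum>k<N. ennreal ((cmod (moment M k))\<^sup>2 / real k))"
    by (intro sum_ennreal[symmetric]) auto
  also have "\<dots> \<le> log_energy M" unfolding log_energy_def by (intro sum_le_suminf) auto
  finally show ?thesis using e by (simp add: ennreal_le_iff)
qed

lemma log_energy_le:
  assumes "\<And>N. (\<Sum>k<N. (cmod (moment M k))\<^sup>2 / real k) \<le> e"
  shows "log_energy M \<le> ennreal e"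
proof -
  have "(\<Sum>k<N. ennreal ((cmod (moment M k))\<^sup>2 / real k)) \<le> ennreal e" for N
    using assms[of N] by (subst sum_ennreal) (auto intro: ennreal_leI)
  thus ?thesis unfolding log_energy_def by (intro suminf_le_const) auto
qed

text \<open>The direct method. Potential, distance and every moment converge along an almost
  everywhere convergent minimizing sequence. The logarithmic energies need not converge to that of
  the limit: a subsequence has some limit j, and the finite partial sums of the series show that the
  limit has energy at most j.\<close>

lemma exists_minimizer:
  assumes Q: "continuous_on circle Q" and X0: "admissible m X0" "log_energy (circle_law X0) < \<infinity>" and c: "c > 0"
    and E0: "\<And>M. circle_prob M \<Longrightarrow> log_energy M < \<infinity> \<Longrightarrow> E0 \<le> free_energy Q M"
  obtains Y where "admissible m Y" "log_energy (circle_law Y) < \<infinity>"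
    "\<And>X. admissible m X \<Longrightarrow> log_energy (circle_law X) < \<infinity> \<Longrightarrow>
       sqrt (free_energy Q (circle_law Y) - E0) + c * L2_dist Y X0 \<le> sqrt (free_energy Q (circle_law X) - E0) + c * L2_dist X X0"
proof -
  define S where "S = {X. admissible m X \<and> log_energy (circle_law X) < \<infinity>}"
  define \<Phi> where "\<Phi> X = sqrt (free_energy Q (circle_law X) - E0) + c * L2_dist X X0" for X
  have pos: "E0 \<le> free_energy Q (circle_law X)" if "X \<in> S" for X
    using that E0 circle_prob_law by (auto simp: S_def)
  have \<Phi>0: "0 \<le> \<Phi> X" if "X \<in> S" for X using pos[OF that] c by (simp add: \<Phi>_def L2_dist_def)
  define I where "I = (INF X\<in>S. \<Phi> X)"
  have ne: "S \<noteq> {}" using X0 by (auto simp: S_def)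
  have bb: "bdd_below (\<Phi> ` S)" using \<Phi>0 by (auto simp: bdd_below_def)
  have I0: "0 \<le> I" unfolding I_def using ne \<Phi>0 by (intro cINF_greatest) auto
  have "\<exists>X. X \<in> S \<and> \<Phi> X < I + 1 / (real n + 1)" for n
  proof -
    have "\<exists>X\<in>S. \<Phi> X < I + 1 / (real n + 1)"
      using cINF_less_iff[OF ne bb, of "I + 1 / (real n + 1)"] by (simp add: I_def)
    thus ?thesis by blast
  qed
  hence "\<exists>X. \<forall>n. X n \<in> S \<and> \<Phi> (X n) < I + 1 / (real n + 1)" by (intro choice allI)
  then obtain X where X: "\<And>n. X n \<in> S" "\<And>n. \<Phi> (X n) < I + 1 / (real n + 1)" by blast
  obtain B where B: "B > 0" "\<And>x. cmod x = 1 \<Longrightarrow> norm (Q x) \<le> B" using circle_bounded[OF Q] by blast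
  have QB: "\<bar>\<integral>a. Q a \<partial>M\<bar> \<le> B" if M: "circle_prob M" for M
  proof -
    interpret prob_space M using circle_probD(1)[OF M] .
    have "\<bar>\<integral>a. Q a \<partial>M\<bar> \<le> (\<integral>a. B \<partial>M)"
      using circle_integrable[OF M Q] B circle_probD(3)[OF M] by (intro integral_abs_bound_integral) auto
    thus ?thesis using prob_space by simp
  qed
  define e where "e n = enn2real (log_energy (circle_law (X n)))" for n
  define R where "R = (I + 1)\<^sup>2 + E0 + B"
  \<comment> \<open>The square root term stays below I + 1 along the minimizing sequence and the
    potential is bounded by B, so the logarithmic energies stay in a compact interval.\<close>
  have e: "e n \<in> {0..R}" for n
  proof -
    let ?F = "free_energy Q (circle_law (X n)) - E0"
    have "1 / (real n + 1) \<le> 1" by simp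
    moreover have "0 \<le> c * L2_dist (X n) X0" using c by (simp add: L2_dist_def)
    ultimately have "sqrt ?F \<le> I + 1" using X(2)[of n] unfolding \<Phi>_def by linarith
    hence "?F \<le> (I + 1)\<^sup>2" by (rule sqrt_le_D)
    moreover have "\<bar>\<integral>a. Q a \<partial>circle_law (X n)\<bar> \<le> B" using X(1)[of n] by (intro QB circle_prob_law[of m]) (auto simp: S_def)
    ultimately show ?thesis by (auto simp: e_def R_def free_energy_def)
  qed
  have Xa: "admissible m (X n)" for n using X(1)[of n] by (auto simp: S_def)
  obtain r Y where r: "strict_mono r" and Y: "admissible m Y" and ae: "AE s in unit_leb. (\<lambda>n. X (r n) s) \<longlonglongrightarrow> Y s"
    by (rule admissible_compact[OF Xa])
  obtain j r' where r': "strict_mono (r' :: nat \<Rightarrow> nat)" "(\<lambda>n. e (r (r' n))) \<longlonglongrightarrow> j"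
    using compact_Icc[of 0 R, unfolded compact_def, rule_format, of "\<lambda>n. e (r n)"] e by (auto simp: o_def)
  define Z where "Z n = X (r (r' n))" for n
  have Za: "admissible m (Z n)" for n using Xa by (simp add: Z_def)
  have Zae: "AE s in unit_leb. (\<lambda>n. Z n s) \<longlonglongrightarrow> Y s"
    using ae unfolding Z_def
  proof eventually_elim
    case (elim s)
    from LIMSEQ_subseq_LIMSEQ[OF elim r'(1)] show ?case by (simp add: o_def)
  qed
  have Zfin: "log_energy (circle_law (Z n)) < \<infinity>" for n using X(1) by (auto simp: Z_def S_def)
  have Ze: "(\<lambda>n. enn2real (log_energy (circle_law (Z n)))) \<longlonglongrightarrow> j" using r'(2) by (simp add: e_def Z_def)
  have mom: "(\<lambda>n. moment (circle_law (Z n)) k) \<longlonglongrightarrow> moment (circle_law Y) k" for k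
    unfolding moment_def by (intro tendsto_integral_circle_law[OF _ Za Y Zae] continuous_intros)
  have Qlim: "(\<lambda>n. \<integral>a. Q a \<partial>circle_law (Z n)) \<longlonglongrightarrow> (\<integral>a. Q a \<partial>circle_law Y)"
    by (intro tendsto_integral_circle_law[OF Q Za Y Zae])
  have "(\<Sum>k<N. (cmod (moment (circle_law Y) k))\<^sup>2 / real k) \<le> j" for N
  proof (rule LIMSEQ_le[OF _ Ze])
    show "(\<lambda>n. \<Sum>k<N. (cmod (moment (circle_law (Z n)) k))\<^sup>2 / real k) \<longlonglongrightarrow> (\<Sum>k<N. (cmod (moment (circle_law Y) k))\<^sup>2 / real k)"
      unfolding divide_inverse by (intro tendsto_intros mom)
  qed (use log_energy_partial_sum[OF Zfin] in auto)
  hence Yle: "log_energy (circle_law Y) \<le> ennreal j" by (rule log_energy_le)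
  have Yfin: "log_energy (circle_law Y) < \<infinity>" using Yle by (simp add: order_le_less_trans)
  have j0: "j \<ge> 0" by (rule LIMSEQ_le_const[OF Ze]) auto
  have Yj: "enn2real (log_energy (circle_law Y)) \<le> j" using Yle j0 by (simp add: enn2real_leI)
  have "(\<lambda>n. L2_dist (Z n) X0) \<longlonglongrightarrow> L2_dist Y X0"
    unfolding L2_dist_def
  proof (intro tendsto_real_sqrt integral_dominated_convergence[where w="\<lambda>_. (2 * (\<bar>m\<bar> + 2 * pi))\<^sup>2"])
    note [measurable] = unit_leb_measurableI[OF admissible_measurable[OF X0(1)]]
      unit_leb_measurableI[OF admissible_measurable[OF Y]] unit_leb_measurableI[OF admissible_measurable[OF Za]]
    show "(\<lambda>s. (Y s - X0 s)\<^sup>2) \<in> borel_measurable unit_leb" "\<And>n. (\<lambda>s. (Z n s - X0 s)\<^sup>2) \<in> borel_measurable unit_leb"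
      by measurable
    show "AE s in unit_leb. (\<lambda>n. (Z n s - X0 s)\<^sup>2) \<longlonglongrightarrow> (Y s - X0 s)\<^sup>2"
      using Zae by eventually_elim (intro tendsto_intros)
    show "AE s in unit_leb. norm ((Z n s - X0 s)\<^sup>2) \<le> (2 * (\<bar>m\<bar> + 2 * pi))\<^sup>2" for n
    proof (rule AE_I2)
      fix s
      have "\<bar>Z n s - X0 s\<bar> \<le> \<bar>Z n s\<bar> + \<bar>X0 s\<bar>" by (rule abs_triangle_ineq4)
      also have "\<dots> \<le> (\<bar>m\<bar> + 2 * pi) + (\<bar>m\<bar> + 2 * pi)"
        by (intro add_mono admissible_bounded[OF Za] admissible_bounded[OF X0(1)])
      finally have "\<bar>Z n s - X0 s\<bar> \<le> 2 * (\<bar>m\<bar> + 2 * pi)" by simp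
      from power_mono[OF this, of 2] show "norm ((Z n s - X0 s)\<^sup>2) \<le> (2 * (\<bar>m\<bar> + 2 * pi))\<^sup>2" by simp
    qed
  qed simp
  hence lim: "(\<lambda>n. \<Phi> (Z n)) \<longlonglongrightarrow> sqrt ((\<integral>a. Q a \<partial>circle_law Y) + j - E0) + c * L2_dist Y X0"
    unfolding \<Phi>_def free_energy_def by (intro tendsto_intros Qlim Ze)
  have "sqrt ((\<integral>a. Q a \<partial>circle_law Y) + j - E0) + c * L2_dist Y X0 \<le> I"
  proof (rule LIMSEQ_le[OF lim])
    have "(\<lambda>n. I + 1 / (real n + 1)) \<longlonglongrightarrow> I" by real_asymp
    from LIMSEQ_subseq_LIMSEQ[OF this strict_mono_o[OF r r'(1)]]
    show "(\<lambda>n. I + 1 / (real (r (r' n)) + 1)) \<longlonglongrightarrow> I" by (simp add: o_def)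
    show "\<exists>N. \<forall>n\<ge>N. \<Phi> (Z n) \<le> I + 1 / (real (r (r' n)) + 1)" using X(2) by (auto simp: Z_def intro: less_imp_le)
  qed
  moreover have "\<Phi> Y \<le> sqrt ((\<integral>a. Q a \<partial>circle_law Y) + j - E0) + c * L2_dist Y X0"
    unfolding \<Phi>_def free_energy_def using Yj by simp
  ultimately have "\<Phi> Y \<le> I" by linarith
  moreover have "I \<le> \<Phi> X" if "X \<in> S" for X unfolding I_def using that bb by (intro cINF_lower)
  ultimately show ?thesis using that[OF Y Yfin] by (force simp: \<Phi>_def S_def)
qed

section \<open>Slope and Fisher information\<close>

text \<open>X is displaced by \<epsilon> g(cis X), where g is the Poisson mean of h. The
  displacement has length exactly \<epsilon> G, so squaring the slope inequality and comparing first
  order terms in \<epsilon> bounds the directional derivative by 2 c sqrt F G.\<close>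

lemma slope_bound:
  assumes Q: "circle_C1 Q" and X: "admissible m X" "log_energy (circle_law X) < \<infinity>"
    and c: "c > 0" and F: "0 < F" "F = free_energy Q (circle_law X) - E0"
    and E0: "\<And>M. circle_prob M \<Longrightarrow> log_energy M < \<infinity> \<Longrightarrow> E0 \<le> free_energy Q M"
    and slope: "\<And>Y. admissible m Y \<Longrightarrow> log_energy (circle_law Y) < \<infinity> \<Longrightarrow>
        sqrt F - c * L2_dist Y X \<le> sqrt (free_energy Q (circle_law Y) - E0)"
    and s: "0 \<le> s" "s < 1" and h: "continuous_on circle h"
    and mean: "(\<integral>w. h w \<partial>smoothed (circle_law X) s) = 0"
  shows "(\<integral>w. h w * Im (smoothing (circle_law X) s w) \<partial>smoothed (circle_law X) s)
     - (\<integral>a. poisson_mean h s a * circle_deriv Q a \<partial>circle_law X)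
    \<le> 2 * c * sqrt F * sqrt (\<integral>a. (poisson_mean h s a)\<^sup>2 \<partial>circle_law X)"
proof -
  let ?M = "circle_law X"
  have M: "circle_prob ?M" by (rule circle_prob_law[OF X(1)])
  define g where "g = poisson_mean h s"
  note cQ = circle_C1_continuous[OF Q]
  have cg: "continuous_on circle g" unfolding g_def by (rule continuous_on_poisson_mean[OF s h])
  have gmean: "(\<integral>a. g a \<partial>?M) = 0"
    using poisson_duality[OF M s h] mean integral_smoothed_real[OF M s h] by (simp add: g_def poisson_mean_def)
  obtain L where L: "L > 0" "\<And>x y. \<bar>g (cis x) - g (cis y)\<bar> \<le> L * \<bar>x - y\<bar>"
    using poisson_mean_Lipschitz[OF s h] unfolding g_def by blast
  obtain B where B: "B > 0" "\<And>x. cmod x = 1 \<Longrightarrow> norm (g x) \<le> B" using circle_bounded[OF cg] by blast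
  define A where "A = (\<integral>w. h w * Im (smoothing ?M s w) \<partial>smoothed ?M s)"
  define D where "D = (\<integral>a. g a * circle_deriv Q a \<partial>?M)"
  define G where "G = sqrt (\<integral>a. (g a)\<^sup>2 \<partial>?M)"
  have G0: "G \<ge> 0" by (simp add: G_def)
  obtain \<epsilon>0 C where C: "\<epsilon>0 > 0" "C \<ge> 0"
    "\<And>\<epsilon>. 0 < \<epsilon> \<Longrightarrow> \<epsilon> \<le> \<epsilon>0 \<Longrightarrow> log_energy (distr ?M circle_borel (transport g \<epsilon>)) < \<infinity> \<and>
       enn2real (log_energy (distr ?M circle_borel (transport g \<epsilon>))) \<le> enn2real (log_energy ?M) - \<epsilon> * A + C * \<epsilon>\<^sup>2"
    by (rule log_energy_variation[OF M X(2) s h, folded g_def A_def]) blast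
  have "A - D \<le> 2 * c * sqrt F * G + e" if e: "e > 0" for e
  proof -
    obtain d where d: "d > 0"
      "\<And>x \<tau>. \<bar>\<tau>\<bar> \<le> d \<Longrightarrow> Q (cis (x + \<tau>)) \<le> Q (cis x) + \<tau> * circle_deriv Q (cis x) + (e / (2 * B)) * \<bar>\<tau>\<bar>"
      using circle_C1_increment[OF Q, of "e / (2 * B)"] e B by auto
    \<comment> \<open>In order: validity of the variation of the logarithmic energy, monotonicity of
      the displaced function, validity of the increment bound for Q, absorption of C \<epsilon> into
      e / 2, and nonnegativity of sqrt F - c \<epsilon> G, so that the slope inequality may be
      squared.\<close>
    define \<epsilon> where "\<epsilon> = Min {\<epsilon>0, 1 / L, d / B, e / (2 * (C + 1)), sqrt F / (c * (G + 1))}"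
    have \<epsilon>: "0 < \<epsilon>" unfolding \<epsilon>_def using C L d B e F c G0 by (subst Min_gr_iff) auto
    have "\<epsilon> \<le> \<epsilon>0" "\<epsilon> \<le> 1 / L" "\<epsilon> \<le> d / B" "\<epsilon> \<le> e / (2 * (C + 1))" "\<epsilon> \<le> sqrt F / (c * (G + 1))"
      unfolding \<epsilon>_def by (auto intro!: Min_le)
    hence b: "\<epsilon> \<le> \<epsilon>0" "\<epsilon> * L \<le> 1" "\<epsilon> * B \<le> d" "\<epsilon> * (2 * (C + 1)) \<le> e" "\<epsilon> * (c * (G + 1)) \<le> sqrt F"
      using L B C c G0 by (simp_all add: pos_le_divide_eq)
    define Y where "Y t = X t + \<epsilon> * g (cis (X t))" for t
    have Y: "admissible m Y" and law: "circle_law Y = distr ?M circle_borel (transport g \<epsilon>)"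
      unfolding Y_def using admissible_transport[OF X(1) cg L(2) gmean _ b(2)] \<epsilon> by auto
    have Yfin: "log_energy (circle_law Y) < \<infinity>"
      and Ylog: "enn2real (log_energy (circle_law Y)) \<le> enn2real (log_energy ?M) - \<epsilon> * A + C * \<epsilon>\<^sup>2"
      using C(3)[OF \<epsilon> b(1)] unfolding law by auto
    have gm: "(\<lambda>t. f (cis (X t))) \<in> borel_measurable unit_leb" if "continuous_on circle f" for f :: "complex \<Rightarrow> real"
      by (rule measurable_compose[OF admissible_measurable_cis[OF X(1)] circle_continuous_measurable_borel[OF that]])
    have iX: "integrable unit_leb (\<lambda>t. f (cis (X t)))" if f: "continuous_on circle f" for f :: "complex \<Rightarrow> real"
    proof -
      obtain K where "K > 0" "\<And>x. cmod x = 1 \<Longrightarrow> norm (f x) \<le> K" using circle_bounded[OF f] by blast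
      thus ?thesis using gm[OF f] by (intro unit_leb.integrable_const_bound[of _ K] AE_I2) auto
    qed
    have iY: "integrable unit_leb (\<lambda>t. Q (cis (Y t)))"
    proof -
      obtain K where "K > 0" "\<And>x. cmod x = 1 \<Longrightarrow> norm (Q x) \<le> K" using circle_bounded[OF cQ(1)] by blast
      thus ?thesis
        using measurable_compose[OF admissible_measurable_cis[OF Y] circle_continuous_measurable_borel[OF cQ(1)]]
        by (intro unit_leb.integrable_const_bound[of _ K] AE_I2) auto
    qed
    have "(\<integral>a. Q a \<partial>circle_law Y) = (\<integral>t. Q (cis (Y t)) \<partial>unit_leb)" by (rule integral_circle_law[OF Y cQ(1)])
    also have "\<dots> \<le> (\<integral>t. (Q (cis (X t)) + \<epsilon> * (g (cis (X t)) * circle_deriv Q (cis (X t)))) + \<epsilon> * (e / 2) \<partial>unit_leb)"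
    proof (rule integral_mono[OF iY])
      show "integrable unit_leb (\<lambda>t. (Q (cis (X t)) + \<epsilon> * (g (cis (X t)) * circle_deriv Q (cis (X t)))) + \<epsilon> * (e / 2))"
        using iX[OF cQ(1)] iX[OF continuous_on_mult[OF cg cQ(2)]] by simp
      fix t
      let ?\<tau> = "\<epsilon> * g (cis (X t))"
      have gb: "\<bar>g (cis (X t))\<bar> \<le> B" using B(2)[of "cis (X t)"] by simp
      hence \<tau>B: "\<bar>?\<tau>\<bar> \<le> \<epsilon> * B" using \<epsilon> by (simp add: abs_mult)
      have "Q (cis (Y t)) \<le> Q (cis (X t)) + ?\<tau> * circle_deriv Q (cis (X t)) + (e / (2 * B)) * \<bar>?\<tau>\<bar>"
        unfolding Y_def using \<tau>B b(3) by (intro d(2)) linarith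
      moreover have "(e / (2 * B)) * \<bar>?\<tau>\<bar> \<le> (e / (2 * B)) * (\<epsilon> * B)" using \<tau>B e B by (intro mult_left_mono) auto
      moreover have "(e / (2 * B)) * (\<epsilon> * B) = \<epsilon> * (e / 2)" using B by (simp add: field_simps)
      ultimately show "Q (cis (Y t)) \<le> (Q (cis (X t)) + \<epsilon> * (g (cis (X t)) * circle_deriv Q (cis (X t)))) + \<epsilon> * (e / 2)"
        by (simp add: mult.assoc)
    qed
    also have "\<dots> = (\<integral>a. Q a \<partial>?M) + \<epsilon> * D + \<epsilon> * (e / 2)"
      using iX[OF cQ(1)] iX[OF continuous_on_mult[OF cg cQ(2)]]
      by (simp add: D_def integral_circle_law[OF X(1) cQ(1)] integral_circle_law[OF X(1) continuous_on_mult[OF cg cQ(2)]])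
    finally have Qle: "(\<integral>a. Q a \<partial>circle_law Y) \<le> (\<integral>a. Q a \<partial>?M) + \<epsilon> * D + \<epsilon> * (e / 2)" .
    have Fle: "free_energy Q (circle_law Y) - E0 \<le> F + \<epsilon> * (D - A + e / 2) + C * \<epsilon>\<^sup>2"
      using Qle Ylog by (simp add: F(2) free_energy_def algebra_simps)
    have dist: "L2_dist Y X = \<epsilon> * G"
    proof -
      have "(\<integral>t. (Y t - X t)\<^sup>2 \<partial>unit_leb) = \<epsilon>\<^sup>2 * (\<integral>t. (g (cis (X t)))\<^sup>2 \<partial>unit_leb)"
        by (simp add: Y_def power_mult_distrib)
      also have "(\<integral>t. (g (cis (X t)))\<^sup>2 \<partial>unit_leb) = (\<integral>a. (g a)\<^sup>2 \<partial>?M)"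
        by (rule integral_circle_law[symmetric, OF X(1)]) (intro continuous_intros cg)
      finally show ?thesis using \<epsilon> by (simp add: L2_dist_def G_def real_sqrt_mult)
    qed
    have "\<epsilon> * (c * G) \<le> \<epsilon> * (c * (G + 1))" using \<epsilon> c by (intro mult_left_mono) auto
    hence nn: "0 \<le> sqrt F - c * (\<epsilon> * G)" using b(5) by (simp add: mult_ac)
    have "(sqrt F - c * (\<epsilon> * G))\<^sup>2 \<le> (sqrt (free_energy Q (circle_law Y) - E0))\<^sup>2"
      using slope[OF Y Yfin] nn unfolding dist by (intro power_mono) auto
    also have "\<dots> = free_energy Q (circle_law Y) - E0" using E0[OF circle_prob_law[OF Y] Yfin] by simp
    finally have "(sqrt F - c * (\<epsilon> * G))\<^sup>2 \<le> F + \<epsilon> * (D - A + e / 2) + C * \<epsilon>\<^sup>2" using Fle by linarith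
    moreover have "(sqrt F - c * (\<epsilon> * G))\<^sup>2 = F - \<epsilon> * (2 * c * sqrt F * G) + (c * (\<epsilon> * G))\<^sup>2"
      using F(1) by (simp add: power2_diff)
    ultimately have "\<epsilon> * (A - D) \<le> \<epsilon> * (2 * c * sqrt F * G + e / 2 + C * \<epsilon>)"
      using zero_le_power2[of "c * (\<epsilon> * G)"] by (simp add: algebra_simps power2_eq_square)
    hence "A - D \<le> 2 * c * sqrt F * G + e / 2 + C * \<epsilon>" using \<epsilon> by simp
    moreover have "C * \<epsilon> \<le> e / 2" using b(4) \<epsilon> by (simp add: algebra_simps)
    ultimately show ?thesis by linarith
  qed
  hence "A - D \<le> 2 * c * sqrt F * G" by (rule field_le_epsilon)
  thus ?thesis by (simp add: A_def D_def G_def g_def)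
qed

section \<open>Mean of the Hilbert transform and centring of the Fisher information\<close>

lemma variation_kernel_one:
  assumes s: "0 \<le> s" "s < 1" and ab: "cmod a = 1" "cmod b = 1"
  shows "variation_kernel (\<lambda>_. 1) s (a, b) = 0"
proof -
  have off: "variation_kernel (\<lambda>_. 1) s (cis x, cis y) = 0" if "cis x \<noteq> cis y" for x y
  proof -
    have "sin ((x - y) / 2) \<noteq> 0" using that cmod_cis_diff[of x y] by auto
    hence "variation_kernel (\<lambda>_. 1) s (cis x, cis y) =
       cot ((x - y) / 2) * (poisson_mean (\<lambda>_. 1) s (cis x) - poisson_mean (\<lambda>_. 1) s (cis y)) / 2"
      by (intro variation_kernel_eq s) auto
    thus ?thesis by (simp add: poisson_mean_def haar_poisson s)
  qed
  show ?thesis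
  proof (cases "a = b")
    case False
    thus ?thesis using off[of "Arg a" "Arg b"] ab by (simp add: cis_Arg_unit)
  next
    case True
    define b' where "b' n = a * cis (1 / (real n + 1))" for n
    have b': "cmod (b' n) = 1" for n using ab by (simp add: b'_def norm_mult)
    have "(\<lambda>n. 1 / (real n + 1)) \<longlonglongrightarrow> 0" by real_asymp
    hence "(\<lambda>n. cis (1 / (real n + 1))) \<longlonglongrightarrow> cis 0"
    proof (rule isCont_tendsto_compose[rotated])
      have "continuous_on UNIV (\<lambda>x :: real. cis x)" by (intro continuous_intros)
      thus "isCont cis (0 :: real)" by (simp add: continuous_on_eq_continuous_at)
    qed
    hence "b' \<longlonglongrightarrow> a * cis 0" unfolding b'_def by (intro tendsto_mult tendsto_const)
    hence "(\<lambda>n. (a, b' n)) \<longlonglongrightarrow> (a, b)" using True by (intro tendsto_Pair tendsto_const) simp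
    hence "(\<lambda>n. variation_kernel (\<lambda>_. 1) s (a, b' n)) \<longlonglongrightarrow> variation_kernel (\<lambda>_. 1) s (a, b)"
      using continuous_on_variation_kernel[OF s, of "\<lambda>_. 1"] ab b'
      unfolding continuous_on_sequentially by (auto simp: o_def)
    moreover have "variation_kernel (\<lambda>_. 1) s (a, b' n) = 0" for n
    proof -
      have "cis (1 / (real n + 1)) \<noteq> 1"
      proof
        assume "cis (1 / (real n + 1)) = 1"
        moreover have "sin (1 / (real n + 1)) > 0"
        proof (rule sin_gt_zero)
          have "1 / (real n + 1) \<le> 1" by simp
          thus "1 / (real n + 1) < pi" using pi_gt3 by linarith
        qed simp
        ultimately show False by (simp add: complex_eq_iff)
      qed
      hence "cis (Arg a) \<noteq> cis (Arg (b' n))" using ab b'[of n] by (auto simp: cis_Arg_unit b'_def)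
      from off[OF this] show ?thesis using ab b'[of n] by (simp add: cis_Arg_unit)
    qed
    ultimately show ?thesis by (simp add: LIMSEQ_const_iff)
  qed
qed

text \<open>The field h = 1 generates rotations, under which the logarithmic energy does not
  vary.\<close>

lemma integral_hilbert_smoothed:
  assumes M: "circle_prob M" and s: "0 \<le> s" "s < 1"
  shows "(\<integral>w. Im (smoothing M s w) \<partial>smoothed M s) = 0"
proof -
  have "(\<integral>w. 1 * Im (smoothing M s w) \<partial>smoothed M s) = (\<integral>p. variation_kernel (\<lambda>_. 1) s p \<partial>(M \<Otimes>\<^sub>M M))"
    by (rule integral_variation_kernel[symmetric, OF M s]) auto
  also have "\<dots> = (\<integral>p. 0 \<partial>(M \<Otimes>\<^sub>M M))"
    using circle_probD(3)[OF M] by (intro Bochner_Integration.integral_cong refl) (auto simp: space_pair_measure variation_kernel_one[OF s])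
  finally show ?thesis by simp
qed

text \<open>The Hilbert transform has mean 0, so the mean of H - Q' is minus that of Q', and the
  Fisher information is a variance. The function h is H - Q' recentred, a mean-zero field as
  required of a displacement.\<close>

lemma fisher_info_smoothed:
  assumes M: "circle_prob M" and s: "0 < s" "s < 1" and Q': "continuous_on circle (circle_deriv Q)"
  defines "h \<equiv> \<lambda>w. Im (smoothing M s w) - circle_deriv Q w + (\<integral>z. circle_deriv Q z \<partial>smoothed M s)"
  shows "fisher_info Q (smoothed M s) = (\<integral>w. (h w)\<^sup>2 \<partial>smoothed M s)"
    and "(\<integral>w. h w \<partial>smoothed M s) = 0"
proof -
  have s0: "0 \<le> s" using s by simp
  let ?N = "smoothed M s"
  have N: "circle_prob ?N" by (rule circle_prob_smoothed[OF M s0 s(2)])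
  interpret prob_space ?N using circle_probD(1)[OF N] .
  define q where "q = (\<integral>z. circle_deriv Q z \<partial>?N)"
  define k where "k w = Im (smoothing M s w) - circle_deriv Q w" for w
  have ck: "continuous_on circle k" unfolding k_def by (intro continuous_intros M s0 s Q')
  have ik: "integrable ?N k" "integrable ?N (\<lambda>w. (k w)\<^sup>2)"
    by (intro circle_integrable[OF N] continuous_intros ck)+
  have "(\<integral>w. k w \<partial>?N) = (\<integral>w. Im (smoothing M s w) \<partial>?N) - q"
    unfolding k_def q_def by (intro Bochner_Integration.integral_diff circle_integrable[OF N] continuous_intros M s0 s Q')
  hence k: "(\<integral>w. k w \<partial>?N) = - q" using integral_hilbert_smoothed[OF M s0 s(2)] by simp
  have h: "h w = k w + q" for w by (simp add: h_def k_def q_def)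
  show "(\<integral>w. h w \<partial>?N) = 0" using ik k prob_space by (simp add: h)
  have "(\<integral>w. (h w)\<^sup>2 \<partial>?N) = (\<integral>w. ((k w)\<^sup>2 + 2 * q * k w) + q\<^sup>2 \<partial>?N)"
    by (intro Bochner_Integration.integral_cong) (auto simp: h power2_sum)
  also have "\<dots> = (\<integral>w. (k w)\<^sup>2 \<partial>?N) - q\<^sup>2"
    using ik k prob_space by (simp add: power2_eq_square)
  also have "(\<integral>w. (k w)\<^sup>2 \<partial>?N) = (\<integral>z. (hilbert ?N z - circle_deriv Q z)\<^sup>2 \<partial>?N)"
    using circle_probD(3)[OF N] by (intro Bochner_Integration.integral_cong refl) (simp add: k_def hilbert_smoothed[OF M s])
  finally show "fisher_info Q ?N = (\<integral>w. (h w)\<^sup>2 \<partial>?N)" by (simp add: fisher_info_def q_def)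
qed

section \<open>Errors made by passing to the Poisson mean\<close>

text \<open>Measures the discrepancy between q at the point w of the smoothed measure and q at the
  point a from which the Poisson kernel spreads the mass.\<close>

definition oscillation :: "(complex \<Rightarrow> real) \<Rightarrow> complex measure \<Rightarrow> real \<Rightarrow> real" where
  "oscillation q M s = (\<integral>a. \<integral>w. poisson s w a * (q w - q a)\<^sup>2 \<partial>circle_haar \<partial>M)"

text \<open>For each a the Poisson kernel is a probability density in w, and the variance of h under
  it is nonnegative.\<close>

lemma poisson_mean_square:
  assumes M: "circle_prob M" and s: "0 \<le> s" "s < 1" and h: "continuous_on circle h"
  shows "(\<integral>a. (poisson_mean h s a)\<^sup>2 \<partial>M) \<le> (\<integral>w. (h w)\<^sup>2 \<partial>smoothed M s)"
proof -
  have h2: "continuous_on circle (\<lambda>w. (h w)\<^sup>2)" by (intro continuous_intros h)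
  have "(\<integral>a. (poisson_mean h s a)\<^sup>2 \<partial>M) \<le> (\<integral>a. poisson_mean (\<lambda>w. (h w)\<^sup>2) s a \<partial>M)"
  proof (intro integral_mono circle_integrable[OF M] continuous_intros continuous_on_poisson_mean s h)
    fix a assume "a \<in> space M"
    hence a: "cmod a = 1" using circle_probD(3)[OF M] by simp
    define g where "g = poisson_mean h s a"
    have i: "integrable circle_haar (\<lambda>w. (h w)\<^sup>2 * poisson s w a)" "integrable circle_haar (\<lambda>w. h w * poisson s w a)"
      "integrable circle_haar (\<lambda>w. poisson s w a)"
      by (intro circle_integrable[OF circle_prob_haar] continuous_intros h s a)+
    have "0 \<le> (\<integral>w. (h w - g)\<^sup>2 * poisson s w a \<partial>circle_haar)"
      using circle_probD(3)[OF circle_prob_haar] poisson_nonneg[OF a _ s]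
      by (intro integral_nonneg_AE AE_I2 mult_nonneg_nonneg) auto
    also have "\<dots> = (\<integral>w. ((h w)\<^sup>2 * poisson s w a - (2 * g) * (h w * poisson s w a)) + g\<^sup>2 * poisson s w a \<partial>circle_haar)"
      by (intro Bochner_Integration.integral_cong refl) (simp add: power2_eq_square algebra_simps)
    also have "\<dots> = poisson_mean (\<lambda>w. (h w)\<^sup>2) s a - g\<^sup>2"
      using i haar_poisson[OF s a] by (simp add: poisson_mean_def g_def power2_eq_square)
    finally show "(poisson_mean h s a)\<^sup>2 \<le> poisson_mean (\<lambda>w. (h w)\<^sup>2) s a" by (simp add: g_def)
  qed
  also have "\<dots> = (\<integral>w. (h w)\<^sup>2 \<partial>smoothed M s)"
    using poisson_duality[OF M s h2] integral_smoothed_real[OF M s h2] by (simp add: poisson_mean_def)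
  finally show ?thesis .
qed

text \<open>The left side is the integral of h(w) (q(a) - q(w)) against the Poisson kernel on the
  torus. Giving each factor the square root of the kernel, the Cauchy-Schwarz inequality separates
  the norm of h from the oscillation of q.\<close>

lemma poisson_mean_cross:
  assumes M: "circle_prob M" and s: "0 \<le> s" "s < 1" and h: "continuous_on circle h" and q: "continuous_on circle q"
  shows "(\<integral>a. poisson_mean h s a * q a \<partial>M) - (\<integral>w. h w * q w \<partial>smoothed M s)
    \<le> sqrt (\<integral>w. (h w)\<^sup>2 \<partial>smoothed M s) * sqrt (oscillation q M s)"
proof -
  let ?P = "circle_haar \<Otimes>\<^sub>M M"
  define f where "f = (\<lambda>p. h (fst p) * sqrt (poisson s (fst p) (snd p)))"
  define g where "g = (\<lambda>p. (q (snd p) - q (fst p)) * sqrt (poisson s (fst p) (snd p)))"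
  have c: "continuous_on (circle \<times> circle) f" "continuous_on (circle \<times> circle) g"
    unfolding f_def g_def
    by (intro continuous_intros continuous_on_compose2[OF h] continuous_on_compose2[OF q] s; auto)+
  have cs: "(\<integral>p. f p * g p \<partial>?P) \<le> sqrt (\<integral>p. (f p)\<^sup>2 \<partial>?P) * sqrt (\<integral>p. (g p)\<^sup>2 \<partial>?P)"
    by (intro integral_Cauchy_Schwarz circle_pair_integrable[OF circle_prob_haar M] continuous_intros c)
  have P0: "sqrt (poisson s w a) * sqrt (poisson s w a) = poisson s w a" if "cmod w = 1" "cmod a = 1" for w a
    using poisson_nonneg[OF that(2,1) s] by simp
  have it: "(\<integral>p. F p \<partial>?P) = (\<integral>a. \<integral>w. F (w, a) \<partial>circle_haar \<partial>M)"
    if "continuous_on (circle \<times> circle) F" for F :: "complex \<times> complex \<Rightarrow> real"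
    using circle_Fubini[OF circle_prob_haar M that] by simp
  have inner: "(\<integral>a. \<integral>w. F w a \<partial>circle_haar \<partial>M) = (\<integral>a. \<integral>w. F' w a \<partial>circle_haar \<partial>M)"
    if "\<And>w a. cmod w = 1 \<Longrightarrow> cmod a = 1 \<Longrightarrow> F w a = F' w a" for F F' :: "complex \<Rightarrow> complex \<Rightarrow> real"
    using that circle_probD(3)[OF M] circle_probD(3)[OF circle_prob_haar]
    by (intro Bochner_Integration.integral_cong refl) auto
  have h2: "continuous_on circle (\<lambda>w. (h w)\<^sup>2)" by (intro continuous_intros h)
  have "(\<integral>p. (f p)\<^sup>2 \<partial>?P) = (\<integral>a. \<integral>w. (f (w, a))\<^sup>2 \<partial>circle_haar \<partial>M)"
    by (rule it) (intro continuous_intros c)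
  also have "\<dots> = (\<integral>a. \<integral>w. (h w)\<^sup>2 * poisson s w a \<partial>circle_haar \<partial>M)"
    by (rule inner) (simp add: f_def power_mult_distrib poisson_nonneg s)
  also have "\<dots> = (\<integral>w. (h w)\<^sup>2 \<partial>smoothed M s)"
    using poisson_duality[OF M s h2] integral_smoothed_real[OF M s h2] by simp
  finally have f2: "(\<integral>p. (f p)\<^sup>2 \<partial>?P) = (\<integral>w. (h w)\<^sup>2 \<partial>smoothed M s)" .
  have "(\<integral>p. (g p)\<^sup>2 \<partial>?P) = (\<integral>a. \<integral>w. (g (w, a))\<^sup>2 \<partial>circle_haar \<partial>M)"
    by (rule it) (intro continuous_intros c)
  also have "\<dots> = oscillation q M s"
    unfolding oscillation_def
    by (rule inner) (simp add: g_def power_mult_distrib poisson_nonneg s power2_commute)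
  finally have g2: "(\<integral>p. (g p)\<^sup>2 \<partial>?P) = oscillation q M s" .
  have "(\<integral>p. f p * g p \<partial>?P) = (\<integral>a. \<integral>w. f (w, a) * g (w, a) \<partial>circle_haar \<partial>M)"
    by (rule it) (intro continuous_intros c)
  also have "\<dots> = (\<integral>a. \<integral>w. q a * (h w * poisson s w a) - h w * q w * poisson s w a \<partial>circle_haar \<partial>M)"
  proof (rule inner)
    fix w a :: complex assume wa: "cmod w = 1" "cmod a = 1"
    have "f (w, a) * g (w, a) = h w * (q a - q w) * (sqrt (poisson s w a) * sqrt (poisson s w a))"
      by (simp add: f_def g_def mult_ac)
    thus "f (w, a) * g (w, a) = q a * (h w * poisson s w a) - h w * q w * poisson s w a"
      unfolding P0[OF wa] by (simp add: algebra_simps)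
  qed
  also have "\<dots> = (\<integral>a. poisson_mean h s a * q a - poisson_mean (\<lambda>w. h w * q w) s a \<partial>M)"
  proof (rule circle_integral_cong[OF M])
    fix a :: complex assume a: "cmod a = 1"
    have i: "integrable circle_haar (\<lambda>w. h w * q w * poisson s w a)" "integrable circle_haar (\<lambda>w. h w * poisson s w a)"
      by (intro circle_integrable[OF circle_prob_haar] continuous_intros h q s a)+
    thus "(\<integral>w. q a * (h w * poisson s w a) - h w * q w * poisson s w a \<partial>circle_haar) =
        poisson_mean h s a * q a - poisson_mean (\<lambda>w. h w * q w) s a"
      by (simp add: poisson_mean_def)
  qed
  also have "\<dots> = (\<integral>a. poisson_mean h s a * q a \<partial>M) - (\<integral>a. poisson_mean (\<lambda>w. h w * q w) s a \<partial>M)"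
    by (intro Bochner_Integration.integral_diff circle_integrable[OF M] continuous_intros continuous_on_poisson_mean s h q)
  also have "(\<integral>a. poisson_mean (\<lambda>w. h w * q w) s a \<partial>M) = (\<integral>w. h w * q w \<partial>smoothed M s)"
  proof -
    have hq: "continuous_on circle (\<lambda>w. h w * q w)" by (intro continuous_intros h q)
    show ?thesis using poisson_duality[OF M s hq] integral_smoothed_real[OF M s hq] by (simp add: poisson_mean_def)
  qed
  finally show ?thesis using cs unfolding f2 g2 by simp
qed

lemma oscillation_nonneg:
  assumes M: "circle_prob M" and s: "0 \<le> s" "s < 1"
  shows "0 \<le> oscillation q M s"
  unfolding oscillation_def using circle_probD(3)[OF M] circle_probD(3)[OF circle_prob_haar]
  by (intro integral_nonneg_AE AE_I2 mult_nonneg_nonneg poisson_nonneg s) auto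

lemma oscillation_tendsto:
  fixes s :: "nat \<Rightarrow> real"
  assumes M: "circle_prob M" and q: "continuous_on circle q"
    and s: "\<And>n. 0 \<le> s n" "\<And>n. s n < 1" "s \<longlonglongrightarrow> 1"
  shows "(\<lambda>n. oscillation q M (s n)) \<longlonglongrightarrow> 0"
proof (rule LIMSEQ_I)
  fix r :: real assume r: "r > 0"
  interpret prob_space M using circle_probD(1)[OF M] .
  obtain B where B: "B > 0" "\<And>x. cmod x = 1 \<Longrightarrow> norm (q x) \<le> B" using circle_bounded[OF q] by blast
  \<comment> \<open>The squared increment is at most 2 B times its absolute value, so the tolerance
    r / (4 B) contributes r / 2.\<close>
  obtain K where K: "K > 0"
    "\<And>s a. 0 \<le> s \<Longrightarrow> s < 1 \<Longrightarrow> cmod a = 1 \<Longrightarrow>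
       (\<integral>w. poisson s w a * \<bar>q w - q a\<bar> \<partial>circle_haar) \<le> r / (4 * B) + K * (1 - s)"
    using poisson_approx[OF q, of "r / (4 * B)"] r B by auto
  have "(\<lambda>n. 2 * B * (r / (4 * B) + K * (1 - s n))) \<longlonglongrightarrow> 2 * B * (r / (4 * B) + K * (1 - 1))" by (intro tendsto_intros s)
  moreover have "2 * B * (r / (4 * B) + K * (1 - 1)) < r" using r B by (simp add: field_simps)
  ultimately have "\<forall>\<^sub>F n in sequentially. 2 * B * (r / (4 * B) + K * (1 - s n)) < r" by (rule order_tendstoD(2))
  then obtain N where N: "\<And>n. n \<ge> N \<Longrightarrow> 2 * B * (r / (4 * B) + K * (1 - s n)) < r" by (auto simp: eventually_sequentially)
  show "\<exists>N. \<forall>n\<ge>N. norm (oscillation q M (s n) - 0) < r"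
  proof (intro exI allI impI)
    fix n assume n: "n \<ge> N"
    have c: "continuous_on (circle \<times> circle) (\<lambda>(a, w). poisson (s n) w a * (q w - q a)\<^sup>2)"
      unfolding case_prod_beta by (intro continuous_intros continuous_on_compose2[OF q] s) auto
    have "oscillation q M (s n) \<le> (\<integral>a. 2 * B * (r / (4 * B) + K * (1 - s n)) \<partial>M)"
      unfolding oscillation_def
    proof (rule integral_mono)
      show "integrable M (\<lambda>a. \<integral>w. poisson (s n) w a * (q w - q a)\<^sup>2 \<partial>circle_haar)"
        using continuous_on_circle_integral[OF circle_prob_haar c] by (intro circle_integrable[OF M]) simp
      fix a assume "a \<in> space M"
      hence a: "cmod a = 1" using circle_probD(3)[OF M] by simp
      have "(\<integral>w. poisson (s n) w a * (q w - q a)\<^sup>2 \<partial>circle_haar) \<le> (\<integral>w. 2 * B * (poisson (s n) w a * \<bar>q w - q a\<bar>) \<partial>circle_haar)"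
      proof (intro integral_mono circle_integrable[OF circle_prob_haar])
        fix w assume "w \<in> space circle_haar"
        hence w: "cmod w = 1" using circle_probD(3)[OF circle_prob_haar] by simp
        have "\<bar>q w - q a\<bar> \<le> 2 * B" using B(2)[OF w] B(2)[OF a] by simp
        hence "\<bar>q w - q a\<bar> * \<bar>q w - q a\<bar> \<le> 2 * B * \<bar>q w - q a\<bar>" by (intro mult_right_mono) auto
        hence "(q w - q a)\<^sup>2 \<le> 2 * B * \<bar>q w - q a\<bar>" by (simp add: power2_eq_square)
        from mult_left_mono[OF this poisson_nonneg[OF a w s(1,2)]]
        show "poisson (s n) w a * (q w - q a)\<^sup>2 \<le> 2 * B * (poisson (s n) w a * \<bar>q w - q a\<bar>)" by (simp add: mult_ac)
      qed (intro continuous_intros s q a)+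
      also have "\<dots> = 2 * B * (\<integral>w. poisson (s n) w a * \<bar>q w - q a\<bar> \<partial>circle_haar)" by simp
      also have "\<dots> \<le> 2 * B * (r / (4 * B) + K * (1 - s n))" using K(2)[OF s(1,2) a] B by (intro mult_left_mono) auto
      finally show "(\<integral>w. poisson (s n) w a * (q w - q a)\<^sup>2 \<partial>circle_haar) \<le> 2 * B * (r / (4 * B) + K * (1 - s n))" .
    qed simp
    also have "\<dots> = 2 * B * (r / (4 * B) + K * (1 - s n))" using prob_space by simp
    also have "\<dots> < r" by (rule N[OF n])
    finally show "norm (oscillation q M (s n) - 0) < r" using oscillation_nonneg[OF M s(1,2), of q n] by simp
  qed
qed

section \<open>Quadratic growth\<close>

lemma log_energy_smoothed_le:
  assumes "circle_prob M" "0 \<le> s" "s < 1"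
  shows "log_energy (smoothed M s) \<le> log_energy M"
  unfolding log_energy_def
proof (intro suminf_le ennreal_leI divide_right_mono)
  fix n
  have "cmod (moment (smoothed M s) n) = s ^ n * cmod (moment M n)"
    using assms by (simp add: moment_smoothed norm_mult norm_power)
  also have "\<dots> \<le> cmod (moment M n)" using assms by (intro mult_left_le_one_le) (auto simp: power_le_one)
  finally show "(cmod (moment (smoothed M s) n))\<^sup>2 \<le> (cmod (moment M n))\<^sup>2" by (rule power_mono) simp
qed auto

text \<open>The slope bound is tested on the centred gradient h of the smoothed measure itself. Its
  squared norm J, the Fisher information, then satisfies J \<le> sqrt J (\<kappa> + sqrt osc), where
  the oscillation of Q' vanishes as s tends to 1. In the limit F \<le> \<kappa>^2 / (4 \<rho>), and
  \<kappa> = 2 c sqrt F gives the constant.\<close>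

lemma LSI_slope:
  assumes Q: "circle_C1 Q" and LSI: "free_LSI Q \<mu>Q \<rho>" and eq: "equilibrium_measure Q \<mu>Q" and \<rho>: "\<rho> > 0"
    and X: "admissible m X" "log_energy (circle_law X) < \<infinity>"
    and c: "c > 0" and F: "0 < F" "F = free_energy Q (circle_law X) - free_energy Q \<mu>Q"
    and slope: "\<And>Y. admissible m Y \<Longrightarrow> log_energy (circle_law Y) < \<infinity> \<Longrightarrow>
        sqrt F - c * L2_dist Y X \<le> sqrt (free_energy Q (circle_law Y) - free_energy Q \<mu>Q)"
  shows "F \<le> c\<^sup>2 / \<rho> * F"
proof -
  let ?M = "circle_law X"
  have M: "circle_prob ?M" by (rule circle_prob_law[OF X(1)])
  note eqD = equilibriumD[OF eq] and cQ = circle_C1_continuous[OF Q]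
  let ?q = "circle_deriv Q"
  define \<kappa> where "\<kappa> = 2 * c * sqrt F"
  have \<kappa>: "\<kappa> \<ge> 0" using c F by (simp add: \<kappa>_def)
  have fisher: "fisher_info Q (smoothed ?M s) \<le> (\<kappa> + sqrt (oscillation ?q ?M s))\<^sup>2" if s: "0 < s" "s < 1" for s
  proof -
    let ?N = "smoothed ?M s"
    have s0: "0 \<le> s" using s by simp
    have N: "circle_prob ?N" by (rule circle_prob_smoothed[OF M s0 s(2)])
    define q0 where "q0 = (\<integral>z. ?q z \<partial>?N)"
    define h where "h w = Im (smoothing ?M s w) - ?q w + q0" for w
    define J where "J = (\<integral>w. (h w)\<^sup>2 \<partial>?N)"
    have fi: "fisher_info Q ?N = J" and mean: "(\<integral>w. h w \<partial>?N) = 0"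
      using fisher_info_smoothed[OF M s cQ(2)] by (simp_all add: h_def[abs_def] q0_def J_def)
    have h: "continuous_on circle h" unfolding h_def by (intro continuous_intros M s0 s cQ)
    have J0: "J \<ge> 0" by (simp add: J_def)
    have "J = (\<integral>w. (h w * Im (smoothing ?M s w) - h w * ?q w) + q0 * h w \<partial>?N)"
      unfolding J_def by (intro Bochner_Integration.integral_cong refl) (simp add: h_def power2_eq_square algebra_simps)
    also have "\<dots> = (\<integral>w. h w * Im (smoothing ?M s w) - h w * ?q w \<partial>?N) + (\<integral>w. q0 * h w \<partial>?N)"
      by (intro Bochner_Integration.integral_add circle_integrable[OF N] continuous_intros h M s0 s cQ)
    also have "(\<integral>w. h w * Im (smoothing ?M s w) - h w * ?q w \<partial>?N) = (\<integral>w. h w * Im (smoothing ?M s w) \<partial>?N) - (\<integral>w. h w * ?q w \<partial>?N)"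
      by (intro Bochner_Integration.integral_diff circle_integrable[OF N] continuous_intros h M s0 s cQ)
    finally have J: "J = (\<integral>w. h w * Im (smoothing ?M s w) \<partial>?N) - (\<integral>w. h w * ?q w \<partial>?N)" using mean by simp
    have "(\<integral>w. h w * Im (smoothing ?M s w) \<partial>?N) - (\<integral>a. poisson_mean h s a * ?q a \<partial>?M) \<le>
        \<kappa> * sqrt (\<integral>a. (poisson_mean h s a)\<^sup>2 \<partial>?M)"
      unfolding \<kappa>_def by (rule slope_bound[OF Q X c F eqD(3) slope s0 s(2) h mean])
    also have "\<dots> \<le> \<kappa> * sqrt J"
      using poisson_mean_square[OF M s0 s(2) h] \<kappa> by (intro mult_left_mono) (auto simp: J_def)
    finally have 1: "(\<integral>w. h w * Im (smoothing ?M s w) \<partial>?N) - (\<integral>a. poisson_mean h s a * ?q a \<partial>?M) \<le> \<kappa> * sqrt J" .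
    have 2: "(\<integral>a. poisson_mean h s a * ?q a \<partial>?M) - (\<integral>w. h w * ?q w \<partial>?N) \<le> sqrt J * sqrt (oscillation ?q ?M s)"
      using poisson_mean_cross[OF M s0 s(2) h cQ(2)] by (simp add: J_def)
    have "J \<le> \<kappa> * sqrt J + sqrt J * sqrt (oscillation ?q ?M s)" using 1 2 J by linarith
    hence "sqrt J * sqrt J \<le> sqrt J * (\<kappa> + sqrt (oscillation ?q ?M s))"
      using J0 by (simp add: algebra_simps)
    hence "sqrt J \<le> \<kappa> + sqrt (oscillation ?q ?M s)"
    proof (cases "J = 0")
      case False
      hence "0 < sqrt J" using J0 by simp
      with \<open>sqrt J * sqrt J \<le> sqrt J * (\<kappa> + sqrt (oscillation ?q ?M s))\<close> show ?thesis
        by (rule mult_left_le_imp_le)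
    qed (use \<kappa> oscillation_nonneg[OF M s0 s(2), of ?q] in simp)
    hence "(sqrt J)\<^sup>2 \<le> (\<kappa> + sqrt (oscillation ?q ?M s))\<^sup>2" using J0 by (intro power_mono) auto
    thus ?thesis using J0 by (simp add: fi)
  qed
  define s where "s n = 1 - 1 / (real n + 2)" for n
  have s: "0 < s n" "0 \<le> s n" "s n < 1" for n by (auto simp: s_def field_simps)
  have sl: "s \<longlonglongrightarrow> 1" unfolding s_def by real_asymp
  have osc: "(\<lambda>n. oscillation ?q ?M (s n)) \<longlonglongrightarrow> 0" by (rule oscillation_tendsto[OF M cQ(2) s(2,3) sl])
  have Qlim: "(\<lambda>n. \<integral>a. Q a \<partial>smoothed ?M (s n)) \<longlonglongrightarrow> (\<integral>a. Q a \<partial>?M)"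
    using smoothing_tendsto[OF M cQ(1) s(2,3) sl] by (simp add: integral_smoothed_real[OF M s(2,3) cQ(1)])
  \<comment> \<open>The energy of the smoothed measure is bounded below by a finite partial sum, in
    which s may tend to 1 term by term; the cut-off K is released only afterwards.\<close>
  have le: "(\<integral>a. Q a \<partial>smoothed ?M (s n)) + (\<Sum>k<K. (s n ^ k * cmod (moment ?M k))\<^sup>2 / real k) - free_energy Q \<mu>Q
      \<le> 1 / (4 * \<rho>) * (\<kappa> + sqrt (oscillation ?q ?M (s n)))\<^sup>2" for n K
  proof -
    let ?N = "smoothed ?M (s n)"
    have N: "circle_prob ?N" by (rule circle_prob_smoothed[OF M s(2,3)])
    have Nfin: "log_energy ?N < \<infinity>" using log_energy_smoothed_le[OF M s(2,3)] X(2) by (rule order_le_less_trans)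
    have "energy Q ?N - energy Q \<mu>Q \<le> ereal (1 / (4 * \<rho>) * fisher_info Q ?N)"
      using LSI smooth_circle_prob_smoothed[OF M s(1,3)] by (simp add: free_LSI_def)
    hence "free_energy Q ?N - free_energy Q \<mu>Q \<le> 1 / (4 * \<rho>) * fisher_info Q ?N"
      by (simp add: energy_eq_free_energy[OF N Nfin] energy_eq_free_energy[OF eqD(1,2)])
    also have "\<dots> \<le> 1 / (4 * \<rho>) * (\<kappa> + sqrt (oscillation ?q ?M (s n)))\<^sup>2"
      using fisher[OF s(1,3)] \<rho> by (intro mult_left_mono) auto
    finally have "free_energy Q ?N - free_energy Q \<mu>Q \<le> 1 / (4 * \<rho>) * (\<kappa> + sqrt (oscillation ?q ?M (s n)))\<^sup>2" .
    moreover have "(\<Sum>k<K. (s n ^ k * cmod (moment ?M k))\<^sup>2 / real k) \<le> enn2real (log_energy ?N)"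
      using log_energy_partial_sum[OF Nfin, of K] s(2)[of n] by (simp add: moment_smoothed[OF M s(2,3)] norm_mult norm_power)
    ultimately show ?thesis by (simp add: free_energy_def)
  qed
  have part: "(\<integral>a. Q a \<partial>?M) + (\<Sum>k<K. (cmod (moment ?M k))\<^sup>2 / real k) - free_energy Q \<mu>Q \<le> \<kappa>\<^sup>2 / (4 * \<rho>)" for K
  proof -
    have "(\<lambda>n. (\<integral>a. Q a \<partial>smoothed ?M (s n)) + (\<Sum>k<K. (s n ^ k * cmod (moment ?M k))\<^sup>2 / real k) - free_energy Q \<mu>Q)
        \<longlonglongrightarrow> (\<integral>a. Q a \<partial>?M) + (\<Sum>k<K. (1 ^ k * cmod (moment ?M k))\<^sup>2 / real k) - free_energy Q \<mu>Q"
      unfolding divide_inverse by (intro tendsto_intros Qlim sl)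
    moreover have "(\<lambda>n. 1 / (4 * \<rho>) * (\<kappa> + sqrt (oscillation ?q ?M (s n)))\<^sup>2) \<longlonglongrightarrow> 1 / (4 * \<rho>) * (\<kappa> + sqrt 0)\<^sup>2"
      by (intro tendsto_intros osc)
    ultimately have "(\<integral>a. Q a \<partial>?M) + (\<Sum>k<K. (1 ^ k * cmod (moment ?M k))\<^sup>2 / real k) - free_energy Q \<mu>Q \<le> 1 / (4 * \<rho>) * (\<kappa> + sqrt 0)\<^sup>2"
      by (rule LIMSEQ_le) (use le in auto)
    thus ?thesis by simp
  qed
  define e where "e = \<kappa>\<^sup>2 / (4 * \<rho>) + free_energy Q \<mu>Q - (\<integral>a. Q a \<partial>?M)"
  have "log_energy ?M \<le> ennreal e" by (rule log_energy_le) (use part in \<open>simp add: e_def algebra_simps\<close>)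
  moreover have "0 \<le> e" using part[of 0] by (simp add: e_def)
  ultimately have "enn2real (log_energy ?M) \<le> e" by (simp add: enn2real_leI)
  hence "F \<le> \<kappa>\<^sup>2 / (4 * \<rho>)" by (simp add: F(2) free_energy_def e_def)
  also have "\<dots> = c\<^sup>2 / \<rho> * F" using F(1) by (simp add: \<kappa>_def power_mult_distrib)
  finally show ?thesis .
qed

lemma quadratic_growth:
  assumes Q: "circle_C1 Q" and LSI: "free_LSI Q \<mu>Q \<rho>" and eq: "equilibrium_measure Q \<mu>Q" and \<rho>: "\<rho> > 0"
    and X0: "admissible m X0" "log_energy (circle_law X0) < \<infinity>" and Y: "admissible m Y" "circle_law Y = \<mu>Q"
  shows "\<rho> * (\<integral>s. (X0 s - Y s)\<^sup>2 \<partial>unit_leb) \<le> free_energy Q (circle_law X0) - free_energy Q \<mu>Q"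
proof (rule ccontr)
  assume neg: "\<not> ?thesis"
  note eqD = equilibriumD[OF eq] and cQ = circle_C1_continuous[OF Q]
  define E0 where "E0 = free_energy Q \<mu>Q"
  define F where "F X = free_energy Q (circle_law X) - E0" for X
  have F0: "0 \<le> F X" if "admissible m X" "log_energy (circle_law X) < \<infinity>" for X
    using eqD(3)[OF circle_prob_law[OF that(1)] that(2)] by (simp add: F_def E0_def)
  define R where "R = L2_dist X0 Y"
  have R0: "R \<ge> 0" by (simp add: R_def L2_dist_def)
  have "F X0 < \<rho> * R\<^sup>2" using neg by (simp add: F_def E0_def R_def L2_dist_def)
  hence "sqrt (F X0) < sqrt (\<rho> * R\<^sup>2)" by (rule real_sqrt_less_mono)
  hence lt: "sqrt (F X0) < sqrt \<rho> * R" using R0 by (simp add: real_sqrt_mult)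
  have Rpos: "R > 0"
  proof (rule ccontr)
    assume "\<not> R > 0"
    thus False using lt R0 F0[OF X0] by simp
  qed
  have "sqrt (F X0) / R < sqrt \<rho>" using lt Rpos by (simp add: pos_divide_less_eq)
  \<comment> \<open>Above sqrt (F X0) / R, the constant c prevents the minimizer from being the
    equilibrium; below sqrt \<rho>, it contradicts the log-Sobolev inequality at any other
    point.\<close>
  then obtain c where c: "sqrt (F X0) / R < c" "c < sqrt \<rho>" using dense by blast
  have "0 \<le> sqrt (F X0) / R" using F0[OF X0] Rpos by simp
  hence c0: "c > 0" using c by linarith
  have cR: "sqrt (F X0) < c * R" using c Rpos by (simp add: pos_divide_less_eq)
  obtain Z where Z: "admissible m Z" "log_energy (circle_law Z) < \<infinity>"
    and min: "\<And>X. admissible m X \<Longrightarrow> log_energy (circle_law X) < \<infinity> \<Longrightarrow>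
       sqrt (F Z) + c * L2_dist Z X0 \<le> sqrt (F X) + c * L2_dist X X0"
    by (rule exists_minimizer[OF cQ(1) X0 c0 eqD(3), folded E0_def, folded F_def]) (assumption, assumption, rule that)
  have "L2_dist X0 X0 = 0" by (simp add: L2_dist_def)
  hence Zle: "sqrt (F Z) + c * L2_dist Z X0 \<le> sqrt (F X0)" using min[OF X0] by simp
  \<comment> \<open>Otherwise the law of Z is the equilibrium measure and Z agrees with Y almost
    everywhere, by uniqueness of the measure and of its lift. The penalty at Z would then be c R,
    already larger than the value of the functional at X0.\<close>
  have FZ: "F Z > 0"
  proof (rule ccontr)
    assume "\<not> F Z > 0"
    hence "free_energy Q (circle_law Z) \<le> free_energy Q \<mu>Q" by (simp add: F_def E0_def)
    hence law: "circle_law Z = \<mu>Q" by (intro equilibrium_unique[OF eq cQ(1) circle_prob_law[OF Z(1)] Z(2)])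
    have "AE s in unit_leb. Z s = Y s"
      by (rule admissible_unique[OF Z(1) Y(1)]) (use law Y finite_log_energy_atomless[OF eqD(1,2)] in auto)
    hence "L2_dist Z X0 = L2_dist Y X0"
      unfolding L2_dist_def
      using admissible_measurable[OF Z(1), THEN unit_leb_measurableI] admissible_measurable[OF Y(1), THEN unit_leb_measurableI]
        admissible_measurable[OF X0(1), THEN unit_leb_measurableI]
      by (intro arg_cong[where f=sqrt] integral_cong_AE) auto
    also have "\<dots> = R" by (simp add: R_def L2_dist_def power2_commute)
    finally show False using Zle cR real_sqrt_ge_zero[OF F0[OF Z]] by simp
  qed
  have slope: "sqrt (F Z) - c * L2_dist X Z \<le> sqrt (F X)" if X: "admissible m X" "log_energy (circle_law X) < \<infinity>" for X
  proof -
    have "c * L2_dist X X0 \<le> c * (L2_dist X Z + L2_dist Z X0)"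
      using L2_dist_triangle[OF X(1) Z(1) X0(1)] c0 by (intro mult_left_mono) auto
    thus ?thesis using min[OF X] by (simp add: algebra_simps)
  qed
  have "F Z \<le> c\<^sup>2 / \<rho> * F Z"
    by (rule LSI_slope[OF Q LSI eq \<rho> Z c0 FZ]) (use slope in \<open>auto simp: F_def E0_def\<close>)
  moreover have "c\<^sup>2 / \<rho> < 1"
  proof -
    have "c\<^sup>2 < (sqrt \<rho>)\<^sup>2" using c(2) c0 by (intro power_strict_mono) auto
    thus ?thesis using \<rho> by simp
  qed
  ultimately show False using FZ mult_strict_right_mono[of "c\<^sup>2 / \<rho>" 1 "F Z"] by simp
qed

theorem theorem10:
  fixes Q :: "complex \<Rightarrow> real" and \<mu>Q :: "complex measure" and \<rho> :: real
  assumes "circle_C1 Q"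
    and "equilibrium_measure Q \<mu>Q"
    and "\<rho> > 0"
    and "free_LSI Q \<mu>Q \<rho>"
  shows "free_transport Q \<mu>Q \<rho>"
  unfolding free_transport_def
proof (intro allI impI)
  fix \<mu> assume "smooth_circle_prob \<mu>"
  hence \<mu>: "circle_prob \<mu>" by (simp add: smooth_circle_prob_def)
  note eqD = equilibriumD[OF assms(2)]
  have EQ: "energy Q \<mu>Q = ereal (free_energy Q \<mu>Q)" by (rule energy_eq_free_energy[OF eqD(1,2)])
  show "ereal \<rho> * enn2ereal ((circle_wasserstein 2 \<mu> \<mu>Q)\<^sup>2) \<le> energy Q \<mu> - energy Q \<mu>Q"
  \<comment> \<open>If the logarithmic energy is infinite, so is the right-hand side, the
    equilibrium energy being finite.\<close>
  proof (cases "log_energy \<mu> < \<infinity>")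
    case False
    hence "log_energy \<mu> = \<infinity>" by (simp add: less_top[symmetric])
    thus ?thesis by (simp add: EQ energy_eq[OF \<mu>])
  next
    case fin: True
    define F where "F = free_energy Q \<mu> - free_energy Q \<mu>Q"
    have F0: "F \<ge> 0" using eqD(3)[OF \<mu> fin] by (simp add: F_def)
    define S where "S = {wasserstein 2 (lift_from \<mu> u) (lift_from \<mu>Q v) | u v.
                 u \<in> {0..2 * pi} \<and> v \<in> {0..2 * pi} \<and>
                 (\<integral>x. x \<partial>lift_from \<mu> u) = (\<integral>x. x \<partial>lift_from \<mu>Q v)}"
    obtain u v where "u \<in> {0..2 * pi}" "v \<in> {0..2 * pi}" "(\<integral>x. x \<partial>lift_from \<mu> u) = (\<integral>x. x \<partial>lift_from \<mu>Q v)"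
      by (rule equal_means_exist[OF \<mu> eqD(1) finite_log_energy_atomless[OF \<mu> fin]])
    hence ne: "S \<noteq> {}" unfolding S_def by blast
    have CW: "circle_wasserstein 2 \<mu> \<mu>Q = Sup S"
      unfolding circle_wasserstein_def Let_def S_def[symmetric] using ne by (simp only: if_False)
    have "x \<le> ennreal (sqrt (F / \<rho>))" if "x \<in> S" for x
    proof -
      obtain u v where uv: "x = wasserstein 2 (lift_from \<mu> u) (lift_from \<mu>Q v)" "u \<in> {0..2 * pi}" "v \<in> {0..2 * pi}"
        "(\<integral>x. x \<partial>lift_from \<mu> u) = (\<integral>x. x \<partial>lift_from \<mu>Q v)" using \<open>x \<in> S\<close> unfolding S_def by blast
      obtain X where X: "admissible (\<integral>x. x \<partial>lift_from \<mu> u) X" "distr unit_leb borel X = lift_from \<mu> u" "circle_law X = \<mu>"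
        by (rule lift_quantile[OF \<mu> uv(2)])
      obtain Y where Y: "admissible (\<integral>x. x \<partial>lift_from \<mu>Q v) Y" "distr unit_leb borel Y = lift_from \<mu>Q v" "circle_law Y = \<mu>Q"
        by (rule lift_quantile[OF eqD(1) uv(3)])
      have "x\<^sup>2 \<le> ennreal (\<integral>s. (X s - Y s)\<^sup>2 \<partial>unit_leb)"
        unfolding uv(1) by (rule wasserstein_le[OF X(1) Y(1) X(2) Y(2)])
      also have "\<dots> \<le> ennreal (F / \<rho>)"
      proof (rule ennreal_leI)
        have "\<rho> * (\<integral>s. (X s - Y s)\<^sup>2 \<partial>unit_leb) \<le> F"
          using quadratic_growth[OF assms(1,4,2,3) X(1) _ Y(1)[folded uv(4)] Y(3)] fin unfolding X(3) F_def by blast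
        thus "(\<integral>s. (X s - Y s)\<^sup>2 \<partial>unit_leb) \<le> F / \<rho>" using assms(3) by (simp add: field_simps)
      qed
      finally have x2: "x\<^sup>2 \<le> ennreal (F / \<rho>)" .
      then obtain t where t: "x = ennreal t" "t \<ge> 0" by (cases x) (auto simp: top_unique power2_eq_square ennreal_top_mult)
      have "t\<^sup>2 \<le> F / \<rho>" using x2 t F0 assms(3) by (simp add: ennreal_power)
      hence "t \<le> sqrt (F / \<rho>)" by (rule real_le_rsqrt)
      thus ?thesis by (simp add: t ennreal_leI)
    qed
    hence "Sup S \<le> ennreal (sqrt (F / \<rho>))" by (rule Sup_least)
    then obtain t where t: "Sup S = ennreal t" "t \<ge> 0" by (cases "Sup S") (auto simp: top_unique)
    have "t \<le> sqrt (F / \<rho>)" using \<open>Sup S \<le> ennreal (sqrt (F / \<rho>))\<close> t F0 assms(3) by simp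
    hence "t\<^sup>2 \<le> (sqrt (F / \<rho>))\<^sup>2" using t by (intro power_mono) auto
    hence "\<rho> * t\<^sup>2 \<le> F" using F0 assms(3) by (simp add: field_simps)
    thus ?thesis using t
      by (simp add: CW EQ energy_eq_free_energy[OF \<mu> fin] F_def ennreal_power)
  qed
qed

end
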